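(* Let $\Gamma$ be a countable (discrete), i.c.c., simple group with the property that every faithful ergodic measure-preserving action of $\Gamma$ on a standard probability space is essentially free. Then every von Neumann subalgebra $\mathcal{A} \le L(\Gamma)$ that is $\Gamma$-invariant, i.e. satisfies $\lambda(g)\,\mathcal{A}\,\lambda(g)^* = \mathcal{A}$ for all $g \in \Gamma$, is a factor, i.e. its center satisfies $Z(\mathcal{A}) = \mathbb{C} \cdot 1$.
   Context: For a countable discrete group $\Gamma$, $\lambda \colon \Gamma \to B(\ell^2\Gamma)$, $\lambda(g)\delta_h = \delta_{gh}$, is the left regular representation, and $L(\Gamma)$ is the weak operator closure of the linear span of $\{\lambda(g) : g \in \Gamma\}$ in $B(\ell^2\Gamma)$. Von Neumann subalgebras are, as usual, weak operator closed $*$-subalgebras containing the unit of the ambient algebra. $\Gamma$ is i.c.c. (has infinite conjugacy classes) if every conjugacy class other than that of the identity is infinite. A measure-preserving action of $\Gamma$ on a probability space $(X,\mu)$ is faithful if no $g \neq e$ acts as the identity almost everywhere, and essentially free if $\mu(\{x \in X : g\cdot x = x\}) = 0$ for every $g \in \Gamma \setminus \{e\}$. *)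

theory Defs
  imports "HOL-Probability.Probability" "HOL-Algebra.Group_Action"
begin

section \<open>Groups\<close>

definition icc_group :: "('g, 'b) monoid_scheme \<Rightarrow> bool" where
  "icc_group G \<longleftrightarrow> group G \<and>
     (\<forall>h \<in> carrier G - {\<one>\<^bsub>G\<^esub>}.
        infinite {g \<otimes>\<^bsub>G\<^esub> h \<otimes>\<^bsub>G\<^esub> inv\<^bsub>G\<^esub> g | g. g \<in> carrier G})"

text \<open>The locale \<open>simple_group\<close> of \<open>HOL-Algebra\<close> demands \<open>order G > 1\<close>, where \<open>order\<close> is a
  natural number that is \<open>0\<close> for infinite groups, so it only covers finite simple groups.\<close>

definition abstract_simple_group :: "('g, 'b) monoid_scheme \<Rightarrow> bool" where
  "abstract_simple_group G \<longleftrightarrow> group G \<and> carrier G \<noteq> {\<one>\<^bsub>G\<^esub>} \<and>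
     (\<forall>N. N \<lhd> G \<longrightarrow> N = carrier G \<or> N = {\<one>\<^bsub>G\<^esub>})"


section \<open>Measure-preserving actions\<close>

text \<open>A standard probability space is a Borel probability measure on a Polish space, whose
  topology is not part of the data. Every such space has at most continuum many points, hence is
  isomorphic to one carried by a set of reals; quantifying over all standard probability spaces
  thus amounts to quantifying over all \<open>M :: real measure\<close> (with arbitrary \<open>space M\<close>, and
  not necessarily the usual topology) that satisfy this predicate.\<close>

definition standard_prob_space :: "'x measure \<Rightarrow> bool" where
  "standard_prob_space M \<longleftrightarrow> prob_space M \<and>
     (\<exists>X. completely_metrizable_space X \<and> second_countable X \<and> topspace X = space M \<and>
          sets M = sigma_sets (space M) {U. openin X U})"

definition pmp_action ::
    "('g, 'b) monoid_scheme \<Rightarrow> 'x measure \<Rightarrow> ('g \<Rightarrow> 'x \<Rightarrow> 'x) \<Rightarrow> bool" where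
  "pmp_action G M \<phi> \<longleftrightarrow> group_action G (space M) \<phi> \<and>
     (\<forall>g \<in> carrier G. \<phi> g \<in> M \<rightarrow>\<^sub>M M \<and> distr M M (\<phi> g) = M)"

definition ergodic_action ::
    "('g, 'b) monoid_scheme \<Rightarrow> 'x measure \<Rightarrow> ('g \<Rightarrow> 'x \<Rightarrow> 'x) \<Rightarrow> bool" where
  "ergodic_action G M \<phi> \<longleftrightarrow>
     (\<forall>A \<in> sets M. (\<forall>g \<in> carrier G. \<phi> g ` A = A) \<longrightarrow> measure M A = 0 \<or> measure M A = 1)"

definition ae_faithful_action ::
    "('g, 'b) monoid_scheme \<Rightarrow> 'x measure \<Rightarrow> ('g \<Rightarrow> 'x \<Rightarrow> 'x) \<Rightarrow> bool" where
  "ae_faithful_action G M \<phi> \<longleftrightarrow>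
     (\<forall>g \<in> carrier G - {\<one>\<^bsub>G\<^esub>}. \<not> (AE x in M. \<phi> g x = x))"

definition essentially_free_action ::
    "('g, 'b) monoid_scheme \<Rightarrow> 'x measure \<Rightarrow> ('g \<Rightarrow> 'x \<Rightarrow> 'x) \<Rightarrow> bool" where
  "essentially_free_action G M \<phi> \<longleftrightarrow>
     (\<forall>g \<in> carrier G - {\<one>\<^bsub>G\<^esub>}. {x \<in> space M. \<phi> g x = x} \<in> null_sets M)"


section \<open>The Hilbert space \<open>\<ell>\<^sup>2(S)\<close> and its bounded operators\<close>

text \<open>Elements of \<open>\<ell>\<^sup>2(S)\<close> are represented by functions on the whole type that vanish outside \<open>S\<close>;
  operators are represented by extensional functions (\<open>undefined\<close> outside \<open>\<ell>\<^sup>2(S)\<close>), so that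
  equality of operators is equality in HOL.\<close>

definition ell2 :: "'a set \<Rightarrow> ('a \<Rightarrow> complex) set" where
  "ell2 S = {f. (\<forall>x. x \<notin> S \<longrightarrow> f x = 0) \<and> (\<lambda>x. (cmod (f x))\<^sup>2) summable_on S}"

definition ell2_inner :: "'a set \<Rightarrow> ('a \<Rightarrow> complex) \<Rightarrow> ('a \<Rightarrow> complex) \<Rightarrow> complex" where
  "ell2_inner S f g = (\<Sum>\<^sub>\<infinity>x\<in>S. f x * cnj (g x))"

definition ell2_norm :: "'a set \<Rightarrow> ('a \<Rightarrow> complex) \<Rightarrow> real" where
  "ell2_norm S f = sqrt (\<Sum>\<^sub>\<infinity>x\<in>S. (cmod (f x))\<^sup>2)"

type_synonym 'a op = "('a \<Rightarrow> complex) \<Rightarrow> 'a \<Rightarrow> complex"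

definition bounded_ops :: "'a set \<Rightarrow> 'a op set" where
  "bounded_ops S = {T \<in> ell2 S \<rightarrow>\<^sub>E ell2 S.
     (\<forall>f \<in> ell2 S. \<forall>g \<in> ell2 S. T (\<lambda>x. f x + g x) = (\<lambda>x. T f x + T g x)) \<and>
     (\<forall>c. \<forall>f \<in> ell2 S. T (\<lambda>x. c * f x) = (\<lambda>x. c * T f x)) \<and>
     (\<exists>K. \<forall>f \<in> ell2 S. ell2_norm S (T f) \<le> K * ell2_norm S f)}"

definition op_id :: "'a set \<Rightarrow> 'a op" where
  "op_id S = (\<lambda>f \<in> ell2 S. f)"

definition op_add :: "'a set \<Rightarrow> 'a op \<Rightarrow> 'a op \<Rightarrow> 'a op" where
  "op_add S T U = (\<lambda>f \<in> ell2 S. \<lambda>x. T f x + U f x)"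

definition op_scale :: "'a set \<Rightarrow> complex \<Rightarrow> 'a op \<Rightarrow> 'a op" where
  "op_scale S c T = (\<lambda>f \<in> ell2 S. \<lambda>x. c * T f x)"

definition op_comp :: "'a set \<Rightarrow> 'a op \<Rightarrow> 'a op \<Rightarrow> 'a op" where
  "op_comp S T U = compose (ell2 S) T U"

definition op_adj :: "'a set \<Rightarrow> 'a op \<Rightarrow> 'a op" where
  "op_adj S T = (THE U. U \<in> bounded_ops S \<and>
     (\<forall>f \<in> ell2 S. \<forall>g \<in> ell2 S. ell2_inner S (T f) g = ell2_inner S f (U g)))"

text \<open>The weak operator topology on \<open>B(\<ell>\<^sup>2(S))\<close>: the coarsest topology that makes all matrix
  coefficients \<open>T \<mapsto> \<langle>T f, g\<rangle>\<close> continuous.\<close>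

definition wot :: "'a set \<Rightarrow> 'a op topology" where
  "wot S = pullback_topology (bounded_ops S)
     (\<lambda>T. restrict (\<lambda>(f, g). ell2_inner S (T f) g) (ell2 S \<times> ell2 S))
     (product_topology (\<lambda>_. euclidean) (ell2 S \<times> ell2 S))"

lemma topspace_wot: "topspace (wot S) = bounded_ops S"
  by (auto simp: wot_def topspace_pullback_topology)

text \<open>Unital, weak operator closed \<open>*\<close>-subalgebras of \<open>B(\<ell>\<^sup>2(S))\<close>.\<close>

definition von_neumann_algebra :: "'a set \<Rightarrow> 'a op set \<Rightarrow> bool" where
  "von_neumann_algebra S A \<longleftrightarrow> A \<subseteq> bounded_ops S \<and> op_id S \<in> A \<and>
     (\<forall>T \<in> A. \<forall>U \<in> A. op_add S T U \<in> A \<and> op_comp S T U \<in> A) \<and>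
     (\<forall>c. \<forall>T \<in> A. op_scale S c T \<in> A) \<and>
     (\<forall>T \<in> A. op_adj S T \<in> A) \<and>
     closedin (wot S) A"

definition op_center :: "'a set \<Rightarrow> 'a op set \<Rightarrow> 'a op set" where
  "op_center S A = {T \<in> A. \<forall>U \<in> A. op_comp S T U = op_comp S U T}"

definition factor :: "'a set \<Rightarrow> 'a op set \<Rightarrow> bool" where
  "factor S A \<longleftrightarrow> von_neumann_algebra S A \<and> op_center S A = {op_scale S c (op_id S) | c. True}"


section \<open>The group von Neumann algebra\<close>

definition left_reg :: "('g, 'b) monoid_scheme \<Rightarrow> 'g \<Rightarrow> 'g op" where
  "left_reg G g = (\<lambda>f \<in> ell2 (carrier G).
     \<lambda>x. if x \<in> carrier G then f (inv\<^bsub>G\<^esub> g \<otimes>\<^bsub>G\<^esub> x) else 0)"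

lemma delta_in_ell2:
  assumes "h \<in> S"
  shows "(\<lambda>x. if x = h then 1 else 0) \<in> ell2 S"
proof -
  have "(\<lambda>x. (cmod (if x = h then 1 else 0))\<^sup>2) summable_on {h}"
    by simp
  then have "(\<lambda>x. (cmod (if x = h then 1 else 0))\<^sup>2) summable_on S"
    by (rule summable_on_cong_neutral[THEN iffD1, rotated -1]) (use assms in auto)
  with assms show ?thesis
    by (auto simp: ell2_def)
qed

text \<open>The defining formula \<open>\<lambda>(g) \<delta>\<^sub>h = \<delta>\<^sub>g\<^sub>h\<close>.\<close>

lemma left_reg_delta:
  assumes "group G" "g \<in> carrier G" "h \<in> carrier G"
  shows "left_reg G g (\<lambda>x. if x = h then 1 else 0) = (\<lambda>x. if x = g \<otimes>\<^bsub>G\<^esub> h then 1 else 0)"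
proof -
  interpret group G by fact
  have "inv\<^bsub>G\<^esub> g \<otimes>\<^bsub>G\<^esub> x = h \<longleftrightarrow> x = g \<otimes>\<^bsub>G\<^esub> h" if "x \<in> carrier G" for x
    using assms that inv_solve_left by metis
  then show ?thesis
    using assms delta_in_ell2[of h "carrier G"] by (auto simp: left_reg_def fun_eq_iff)
qed

definition left_reg_span :: "('g, 'b) monoid_scheme \<Rightarrow> 'g op set" where
  "left_reg_span G = {(\<lambda>f \<in> ell2 (carrier G). \<lambda>x. \<Sum>g\<in>F. c g * left_reg G g f x) | F c.
     finite F \<and> F \<subseteq> carrier G}"

definition group_vN :: "('g, 'b) monoid_scheme \<Rightarrow> 'g op set" where
  "group_vN G = wot (carrier G) closure_of left_reg_span G"

definition conj_invariant :: "('g, 'b) monoid_scheme \<Rightarrow> 'g op set \<Rightarrow> bool" where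
  "conj_invariant G A \<longleftrightarrow> (\<forall>g \<in> carrier G.
     (\<lambda>T. op_comp (carrier G) (op_comp (carrier G) (left_reg G g) T)
            (op_adj (carrier G) (left_reg G g))) ` A = A)"

end

(* A Gamma-invariant algebra A has a Gamma-invariant center Z, on which Gamma acts by conjugation.
   The spectral theorem (here: the sign of a self-adjoint contraction, as a strong limit of
   polynomials in it) reduces the claim to projections p in Z. The conjugates of p commute, so
   together with the trace they define a shift-invariant measure on {0,1}^Gamma, which is ergodic
   because vectors of l^2(Gamma) that are fixed by conjugation are multiples of delta_1 (i.c.c.).
   The elements of Gamma that act trivially almost everywhere form a normal subgroup. If it is
   Gamma, the vector p delta_1 is fixed by conjugation. Otherwise the action is faithful, hence
   essentially free; since tau(x y lambda(g)^* ) = tau(sigma_g(y) x lambda(g)^* ) for x, y in Z, the measure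
   B |-> tau(1_B lambda(g)^* ) is then carried by the null set of fixed points of g, so that p delta_1
   has no coefficient at g <> 1. Either way p delta_1 is a multiple of delta_1, and p is 0 or 1. *)

theory Submission
  imports Defs
begin

section \<open>The Hilbert space of square-summable functions\<close>

text \<open>No functional calculus is used. Each inequality that the sign iteration needs has a
  certificate: a polynomial with nonnegative coefficients in (1 - x^2) / 2, possibly multiplied by x
  on both sides, and such polynomials are visibly positive at a self-adjoint contraction.
  Projections suffice because the trace is subtracted first: once the spectral projections of the
  sign s of a trace-zero R are trivial, s is a scalar on delta_1, so s R has trace zero, and s R
  dominates R^2. A carrier set is not a type, so the group is enumerated by the natural numbers and
  its Hilbert space becomes the type \<open>nat l2\<close>, where the theory of real inner product
  spaces applies; complex scalars act through a separate operation \<open>scaleC\<close>.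
  Projections are attached to cylinders only. Instead of extending them to a projection-valued
  measure, limits are taken on vectors: sending a cylinder A to \<open>proj A unit_vec\<close> is
  isometric for the L2 distance of indicators.\<close>

typedef 'a l2 = "ell2 (UNIV :: 'a set)"
  morphisms coord Abs_l2
  by (rule exI[of _ "\<lambda>_. 0"]) (simp add: ell2_def)

lemma ell2_UNIV_iff: "f \<in> ell2 UNIV \<longleftrightarrow> (\<lambda>x. (cmod (f x))\<^sup>2) summable_on UNIV"
  by (simp add: ell2_def)

lemma coord_summable: "(\<lambda>x. (cmod (coord v x))\<^sup>2) summable_on UNIV"
  using coord[of v] by (simp add: ell2_UNIV_iff)

lemma l2_eqI: "(\<And>x. coord v x = coord w x) \<Longrightarrow> v = w"
  by (simp add: coord_inject[symmetric] fun_eq_iff)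

lemma coord_Abs_l2: "f \<in> ell2 UNIV \<Longrightarrow> coord (Abs_l2 f) = f"
  by (rule Abs_l2_inverse)

lemma cmod_add_square_le: "(cmod (a + b))\<^sup>2 \<le> 2 * (cmod a)\<^sup>2 + 2 * (cmod b)\<^sup>2"
proof -
  have "(cmod (a + b))\<^sup>2 \<le> (cmod a + cmod b)\<^sup>2"
    by (intro power_mono norm_triangle_ineq) auto
  also have "\<dots> \<le> 2 * (cmod a)\<^sup>2 + 2 * (cmod b)\<^sup>2"
    using sum_squares_bound[of "cmod a" "cmod b"] by (simp add: power2_sum)
  finally show ?thesis .
qed

lemma ell2_add: "f \<in> ell2 UNIV \<Longrightarrow> g \<in> ell2 UNIV \<Longrightarrow> (\<lambda>x. f x + g x) \<in> ell2 UNIV"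
  unfolding ell2_UNIV_iff
  by (rule summable_on_comparison_test
      [where f = "\<lambda>x. 2 * (cmod (f x))\<^sup>2 + 2 * (cmod (g x))\<^sup>2"])
     (auto intro!: summable_on_add summable_on_cmult_right cmod_add_square_le)

lemma ell2_scale: "f \<in> ell2 UNIV \<Longrightarrow> (\<lambda>x. c * f x) \<in> ell2 UNIV"
  unfolding ell2_UNIV_iff norm_mult power_mult_distrib
  by (intro summable_on_cmult_right)

definition scaleC :: "complex \<Rightarrow> 'a l2 \<Rightarrow> 'a l2"
  where "scaleC c v = Abs_l2 (\<lambda>x. c * coord v x)"

lemma coord_scaleC [simp]: "coord (scaleC c v) x = c * coord v x"
  by (simp add: scaleC_def coord_Abs_l2 ell2_scale coord)

instantiation l2 :: (type) real_vector
begin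

definition "0 = Abs_l2 (\<lambda>_. 0)"
definition "v + w = Abs_l2 (\<lambda>x. coord v x + coord w x)"
definition "- v = scaleC (- 1) v"
definition "v - w = v + scaleC (- 1) w" for v w :: "'a l2"
definition "scaleR r v = scaleC (of_real r) v"

lemma coord_0: "coord 0 x = 0"
  by (simp add: zero_l2_def coord_Abs_l2 ell2_UNIV_iff)

lemma coord_add: "coord (v + w) x = coord v x + coord w x"
  by (simp add: plus_l2_def coord_Abs_l2 ell2_add coord)

lemma coord_minus: "coord (- v) x = - coord v x"
  by (simp add: uminus_l2_def)

lemma coord_diff: "coord (v - w) x = coord v x - coord w x"
  by (simp add: minus_l2_def coord_add)

lemma coord_scaleR: "coord (scaleR r v) x = of_real r * coord v x"
  by (simp add: scaleR_l2_def)

instance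
  by standard
    (auto intro!: l2_eqI simp: coord_0 coord_add coord_minus coord_diff coord_scaleR algebra_simps)

end

declare coord_0 [simp] coord_add [simp] coord_minus [simp] coord_diff [simp] coord_scaleR [simp]

lemma Re_mult_cnj_bound: "\<bar>Re (a * cnj b)\<bar> \<le> (cmod a)\<^sup>2 + (cmod b)\<^sup>2"
proof -
  have "\<bar>Re (a * cnj b)\<bar> \<le> cmod a * cmod b"
    by (metis abs_Re_le_cmod complex_mod_cnj norm_mult)
  also have "\<dots> \<le> (cmod a)\<^sup>2 + (cmod b)\<^sup>2"
    using sum_squares_bound[of "cmod a" "cmod b"] mult_nonneg_nonneg[OF norm_ge_zero[of a] norm_ge_zero[of b]]
    unfolding mult.assoc by linarith
  finally show ?thesis .
qed

lemma Re_mult_cnj_summable: "(\<lambda>x. Re (coord v x * cnj (coord w x))) summable_on UNIV"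
proof -
  have "(\<lambda>x. norm (Re (coord v x * cnj (coord w x)))) summable_on UNIV"
  proof (rule Infinite_Sum.abs_summable_on_comparison_test')
    show "(\<lambda>x. (cmod (coord v x))\<^sup>2 + (cmod (coord w x))\<^sup>2) summable_on UNIV"
      by (intro summable_on_add coord_summable)
  qed (metis Re_mult_cnj_bound real_norm_def)
  then show ?thesis
    by (rule summable_on_iff_abs_summable_on_real[THEN iffD2])
qed

lemma Re_of_real_mult: "Re (of_real r * z) = r * Re z"
  by simp

lemma Re_mult_cnj_self: "Re (z * cnj z) = (cmod z)\<^sup>2"
  by (metis Re_complex_of_real complex_norm_square)

text \<open>Only the real part of the hermitian product becomes the inner product. The imaginary
  part is recovered by pairing with \<i> times a vector, as in
  \<open>coord_eq_inner\<close>.\<close>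

instantiation l2 :: (type) real_inner
begin

definition "inner v w = (\<Sum>\<^sub>\<infinity>x. Re (coord v x * cnj (coord w x)))"
definition "norm v = sqrt (inner v v)" for v :: "'a l2"
definition "sgn v = inverse (norm v) *\<^sub>R v" for v :: "'a l2"
definition "dist v w = norm (v - w)" for v w :: "'a l2"
definition "(uniformity :: ('a l2 \<times> 'a l2) filter) = (INF e\<in>{0<..}. principal {(x, y). dist x y < e})"
definition "open (U :: 'a l2 set) \<longleftrightarrow> (\<forall>x\<in>U. eventually (\<lambda>(x', y). x' = x \<longrightarrow> y \<in> U) uniformity)"

instance
proof
  fix u v w :: "'a l2" and r s :: real
  show "dist u v = norm (u - v)" by (simp add: dist_l2_def)
  show "sgn u = u /\<^sub>R norm u" by (simp add: sgn_l2_def)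
  show "norm u = sqrt (inner u u)" by (simp add: norm_l2_def)
  show "inner u v = inner v u" unfolding inner_l2_def by (intro infsum_cong) (simp add: mult.commute)
  show "inner (u + v) w = inner u w + inner v w"
    unfolding inner_l2_def
    by (subst infsum_add[symmetric])
       (auto intro!: infsum_cong Re_mult_cnj_summable simp: distrib_right simp del: times_complex.sel)
  show "inner (r *\<^sub>R u) v = r * inner u v"
    unfolding inner_l2_def coord_scaleR mult.assoc Re_of_real_mult by (rule infsum_cmult_right')
  show "0 \<le> inner u u" unfolding inner_l2_def Re_mult_cnj_self by (intro infsum_nonneg) auto
  show "inner u u = 0 \<longleftrightarrow> u = 0"
  proof
    assume "inner u u = 0"
    then have "(cmod (coord u x))\<^sup>2 = 0" for x
      unfolding inner_l2_def Re_mult_cnj_self by (intro nonneg_infsum_le_0D) (auto intro: coord_summable)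
    then show "u = 0" by (intro l2_eqI) simp
  qed (simp add: inner_l2_def)
qed (rule uniformity_l2_def open_l2_def)+

end

lemma norm_square_l2: "(norm v)\<^sup>2 = (\<Sum>\<^sub>\<infinity>x. (cmod (coord v x))\<^sup>2)" for v :: "'a l2"
  unfolding power2_norm_eq_inner inner_l2_def Re_mult_cnj_self ..

lemma sum_cmod_coord_le: "finite F \<Longrightarrow> (\<Sum>x\<in>F. (cmod (coord v x))\<^sup>2) \<le> (norm v)\<^sup>2"
  unfolding norm_square_l2 by (rule finite_sum_le_infsum) (auto intro: coord_summable)

lemma cmod_coord_le_norm: "cmod (coord v x) \<le> norm v"
  using sum_cmod_coord_le[of "{x}" v] by (simp add: power2_le_iff_abs_le)

lemma ell2_bounded_sumsI:
  assumes "\<And>F. finite F \<Longrightarrow> (\<Sum>x\<in>F. (cmod (f x))\<^sup>2) \<le> B"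
  shows "f \<in> ell2 UNIV" "norm (Abs_l2 f) \<le> sqrt B"
proof -
  show f: "f \<in> ell2 UNIV"
    unfolding ell2_UNIV_iff
    by (rule nonneg_bdd_above_summable_on) (auto intro!: bdd_aboveI2 assms)
  have "(norm (Abs_l2 f))\<^sup>2 \<le> B"
    unfolding norm_square_l2 coord_Abs_l2[OF f]
    by (rule infsum_le_finite_sums) (use f assms in \<open>auto simp: ell2_UNIV_iff\<close>)
  then show "norm (Abs_l2 f) \<le> sqrt B"
    by (simp add: real_le_rsqrt)
qed

instance l2 :: (type) complete_space
proof
  fix X :: "nat \<Rightarrow> 'a l2"
  assume X: "Cauchy X"
  have "Cauchy (\<lambda>n. coord (X n) x)" for x
  proof (rule metric_CauchyI)
    fix e :: real assume "e > 0"
    then obtain N where N: "\<And>m n. m \<ge> N \<Longrightarrow> n \<ge> N \<Longrightarrow> dist (X m) (X n) < e"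
      using metric_CauchyD[OF X] by blast
    have "dist (coord (X m) x) (coord (X n) x) < e" if "m \<ge> N" "n \<ge> N" for m n
      using cmod_coord_le_norm[of "X m - X n" x] N[OF that] by (simp add: dist_norm)
    then show "\<exists>M. \<forall>m\<ge>M. \<forall>n\<ge>M. dist (coord (X m) x) (coord (X n) x) < e"
      by blast
  qed
  then have "\<exists>l. (\<lambda>n. coord (X n) x) \<longlonglongrightarrow> l" for x
    by (meson Cauchy_convergent convergent_def)
  then obtain l where l: "\<And>x. (\<lambda>n. coord (X n) x) \<longlonglongrightarrow> l x"
    by metis
  \<comment> \<open>Finite sets of coordinates allow the passage to the limit before
    \<open>l\<close> is known to be square-summable.\<close>
  have bd: "(\<Sum>x\<in>F. (cmod (coord (X m) x - l x))\<^sup>2) \<le> e\<^sup>2"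
    if "finite F" "e \<ge> 0" "\<And>n. n \<ge> m \<Longrightarrow> dist (X m) (X n) \<le> e" for F m e
  proof (rule LIMSEQ_le_const2)
    show "(\<lambda>n. \<Sum>x\<in>F. (cmod (coord (X m) x - coord (X n) x))\<^sup>2)
            \<longlonglongrightarrow> (\<Sum>x\<in>F. (cmod (coord (X m) x - l x))\<^sup>2)"
      by (intro tendsto_intros l)
    have "(\<Sum>x\<in>F. (cmod (coord (X m) x - coord (X n) x))\<^sup>2) \<le> e\<^sup>2" if "n \<ge> m" for n
    proof -
      have "(\<Sum>x\<in>F. (cmod (coord (X m) x - coord (X n) x))\<^sup>2) \<le> (norm (X m - X n))\<^sup>2"
        using sum_cmod_coord_le[OF \<open>finite F\<close>, of "X m - X n"] by simp
      also have "\<dots> \<le> e\<^sup>2"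
        using \<open>\<And>n. n \<ge> m \<Longrightarrow> dist (X m) (X n) \<le> e\<close>[OF that] by (intro power_mono) (auto simp: dist_norm)
      finally show ?thesis .
    qed
    then show "\<exists>N. \<forall>n\<ge>N. (\<Sum>x\<in>F. (cmod (coord (X m) x - coord (X n) x))\<^sup>2) \<le> e\<^sup>2"
      by blast
  qed
  obtain m where m: "\<And>n. n \<ge> m \<Longrightarrow> dist (X m) (X n) \<le> 1"
    using metric_CauchyD[OF X, of 1] by (metis le_refl less_imp_le zero_less_one)
  have diff: "(\<lambda>x. coord (X m) x - l x) \<in> ell2 UNIV"
    using bd[OF _ _ m] by (intro ell2_bounded_sumsI[where B = "1\<^sup>2"]) auto
  have lin: "l \<in> ell2 UNIV"
    using ell2_add[OF coord[of "X m"] ell2_scale[OF diff, of "-1"]] by simp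
  have "X \<longlonglongrightarrow> Abs_l2 l"
  proof (rule metric_LIMSEQ_I)
    fix e :: real assume "e > 0"
    then obtain N where N: "\<And>m n. m \<ge> N \<Longrightarrow> n \<ge> N \<Longrightarrow> dist (X m) (X n) < e / 2"
      using metric_CauchyD[OF X, of "e / 2"] by auto
    have "dist (X m) (Abs_l2 l) < e" if "m \<ge> N" for m
    proof -
      have 1: "(\<Sum>x\<in>F. (cmod (coord (X m) x - l x))\<^sup>2) \<le> (e / 2)\<^sup>2" if "finite F" for F
        using bd[OF that, of "e / 2" m] N[OF \<open>m \<ge> N\<close>] \<open>e > 0\<close> \<open>m \<ge> N\<close> by (meson half_gt_zero less_imp_le order_trans)
      have "X m - Abs_l2 l = Abs_l2 (\<lambda>x. coord (X m) x - l x)"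
        using ell2_bounded_sumsI(1)[OF 1] by (intro l2_eqI) (simp add: coord_Abs_l2 lin)
      then have "norm (X m - Abs_l2 l) \<le> sqrt ((e / 2)\<^sup>2)"
        using ell2_bounded_sumsI(2)[OF 1] by simp
      then show ?thesis
        using \<open>e > 0\<close> by (simp add: dist_norm)
    qed
    then show "\<exists>no. \<forall>n\<ge>no. dist (X n) (Abs_l2 l) < e"
      by blast
  qed
  then show "convergent X"
    by (auto simp: convergent_def)
qed

definition delta :: "'a \<Rightarrow> 'a l2"
  where "delta a = Abs_l2 (\<lambda>x. if x = a then 1 else 0)"

lemma coord_delta [simp]: "coord (delta a) x = (if x = a then 1 else 0)"
  by (simp add: delta_def coord_Abs_l2 delta_in_ell2)

lemma inner_delta: "inner v (delta a) = Re (coord v a)"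
proof -
  have "(\<Sum>\<^sub>\<infinity>x. Re (coord v x * cnj (coord (delta a) x)))
      = (\<Sum>\<^sub>\<infinity>x\<in>{a}. Re (coord v x * cnj (coord (delta a) x)))"
    by (rule infsum_cong_neutral) auto
  then show ?thesis
    by (simp add: inner_l2_def)
qed

lemma norm_delta [simp]: "norm (delta a) = 1"
  by (simp add: norm_eq_sqrt_inner inner_delta)

lemma inner_scaleC_left: "inner (scaleC c v) w = inner v (scaleC (cnj c) w)"
  unfolding inner_l2_def by (intro infsum_cong) (simp add: algebra_simps)

lemma inner_scaleC_delta: "inner v (scaleC c (delta a)) = Re (cnj c * coord v a)"
  using inner_scaleC_left[of "cnj c" v "delta a"] by (simp add: inner_delta del: times_complex.sel)

lemma coord_eq_inner: "coord v a = Complex (inner v (delta a)) (inner v (scaleC \<i> (delta a)))"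
  by (simp add: inner_scaleC_delta inner_delta)

lemma scaleC_add_right: "scaleC c (v + w) = scaleC c v + scaleC c w"
  by (intro l2_eqI) (simp add: algebra_simps)

lemma scaleC_add_left: "scaleC (c + d) v = scaleC c v + scaleC d v"
  by (intro l2_eqI) (simp add: algebra_simps)

lemma scaleC_scaleC [simp]: "scaleC c (scaleC d v) = scaleC (c * d) v"
  by (intro l2_eqI) simp

lemma scaleC_of_real: "scaleC (of_real r) v = r *\<^sub>R v"
  by (intro l2_eqI) simp

lemma scaleC_one [simp]: "scaleC 1 v = v"
  by (intro l2_eqI) simp

lemma norm_scaleC: "norm (scaleC c v) = cmod c * norm v"
proof -
  have "inner (scaleC c v) (scaleC c v) = inner v (scaleC (of_real ((cmod c)\<^sup>2)) v)"
    by (simp only: inner_scaleC_left scaleC_scaleC complex_norm_square mult.commute)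
  then show ?thesis
    by (simp add: scaleC_of_real norm_eq_sqrt_inner real_sqrt_mult del: of_real_power)
qed

section \<open>The sign of a self-adjoint contraction\<close>

definition op_poly :: "('h \<Rightarrow> 'h) \<Rightarrow> real poly \<Rightarrow> 'h::real_vector \<Rightarrow> 'h"
  where "op_poly T p = fold_coeffs (\<lambda>a f x. a *\<^sub>R x + T (f x)) p (\<lambda>x. 0)"

lemma op_poly_0 [simp]: "op_poly T 0 x = 0"
  by (simp add: op_poly_def)

lemma op_poly_pCons: "T 0 = 0 \<Longrightarrow> op_poly T (pCons a p) x = a *\<^sub>R x + T (op_poly T p x)"
  by (cases "p = 0 \<and> a = 0") (auto simp: op_poly_def)

text \<open>These are the polynomials with nonnegative coefficients in w = (1 - x^2) / 2. Unlike
  nonnegativity on [-1, 1], membership can be transferred to operators by induction, without a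
  spectral theorem. The factor 1/2 makes w the initial \<open>sign_gap\<close>.\<close>

inductive_set positive_cone :: "real poly set" where
  one: "1 \<in> positive_cone"
| add: "p \<in> positive_cone \<Longrightarrow> q \<in> positive_cone \<Longrightarrow> p + q \<in> positive_cone"
| smult: "p \<in> positive_cone \<Longrightarrow> 0 \<le> c \<Longrightarrow> smult c p \<in> positive_cone"
| weight: "p \<in> positive_cone \<Longrightarrow> [:1/2, 0, -1/2:] * p \<in> positive_cone"

lemma positive_cone_mult: "p \<in> positive_cone \<Longrightarrow> q \<in> positive_cone \<Longrightarrow> p * q \<in> positive_cone"
proof (induction rule: positive_cone.induct)
  case (weight p)
  then show ?case
    using positive_cone.weight[of "p * q"] by (simp only: mult.assoc)
qed (auto simp: distrib_right intro: positive_cone.intros)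

lemma positive_cone_0: "0 \<in> positive_cone"
  using positive_cone.smult[OF positive_cone.one, of 0] by simp

text \<open>The Newton-Schulz iteration y -> y (3 - y^2) / 2, started at x. Its fixed points are -1,
  0 and 1, and on [-1, 1] it converges to the sign of x.\<close>

fun sign_poly :: "nat \<Rightarrow> real poly" where
  "sign_poly 0 = [:0, 1:]"
| "sign_poly (Suc n) = smult (1/2) (sign_poly n * (3 - sign_poly n * sign_poly n))"

text \<open>With e = (1 - y^2) / 2 the iteration reads y -> y (1 + e). Hence every iterate is x
  times a product of factors 1 + e, which is the \<open>sign_factor\<close>.\<close>

definition sign_gap :: "nat \<Rightarrow> real poly"
  where "sign_gap n = smult (1/2) (1 - sign_poly n * sign_poly n)"

fun sign_factor :: "nat \<Rightarrow> real poly" where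
  "sign_factor 0 = 1"
| "sign_factor (Suc n) = sign_factor n * (1 + sign_gap n)"

lemma poly_eqI_poly: "(\<And>x. poly p x = poly q x) \<Longrightarrow> p = q" for p q :: "real poly"
  by (simp add: poly_eq_poly_eq_iff[symmetric] fun_eq_iff)

lemma sign_poly_eq_factor: "sign_poly n = [:0, 1:] * sign_factor n"
proof (induction n)
  case (Suc n)
  show ?case
    by (rule poly_eqI_poly) (simp add: Suc sign_gap_def field_simps)
qed simp

text \<open>Insert y^2 = 1 - 2 e into (1 - y^2 (1 + e)^2) / 2: the constant and linear terms cancel.
  The remaining coefficients are nonnegative, which keeps all gaps in the cone.\<close>

lemma sign_gap_Suc:
  "sign_gap (Suc n) = smult (3/2) (sign_gap n * sign_gap n) + sign_gap n * sign_gap n * sign_gap n"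
  by (rule poly_eqI_poly) (simp add: sign_gap_def field_simps)

lemma sign_gap_cone: "sign_gap n \<in> positive_cone"
proof (induction n)
  case 0
  have "sign_gap 0 = [:1/2, 0, -1/2:] * 1"
    by (rule poly_eqI_poly) (simp add: sign_gap_def field_simps)
  then show ?case
    using positive_cone.weight[OF positive_cone.one] by simp
next
  case (Suc n)
  then show ?case
    unfolding sign_gap_Suc
    by (intro positive_cone.add positive_cone.smult positive_cone_mult) auto
qed

lemma sign_factor_cone: "sign_factor n \<in> positive_cone"
  by (induction n) (auto intro!: positive_cone.one positive_cone.add positive_cone_mult sign_gap_cone)

lemma sign_factor_mono: "m \<le> n \<Longrightarrow> sign_factor n - sign_factor m \<in> positive_cone"
proof (induction n rule: dec_induct)
  case (step n)
  have "sign_factor (Suc n) - sign_factor m = (sign_factor n - sign_factor m) + sign_factor n * sign_gap n"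
    by (simp add: algebra_simps)
  then show ?case
    using step by (simp only:) (intro positive_cone.add positive_cone_mult sign_factor_cone sign_gap_cone)
qed (simp add: positive_cone_0)

section \<open>Strong convergence of the sign polynomials at an operator\<close>

locale selfadjoint_contraction =
  fixes T :: "'h::{real_inner,complete_space} \<Rightarrow> 'h"
  assumes linear: "linear T"
    and selfadjoint: "inner (T x) y = inner x (T y)"
    and contraction: "norm (T x) \<le> norm x"
begin

abbreviation ev :: "real poly \<Rightarrow> 'h \<Rightarrow> 'h" where "ev \<equiv> op_poly T"

lemma ev_pCons: "ev (pCons a p) x = a *\<^sub>R x + T (ev p x)"
  by (rule op_poly_pCons) (rule linear_0[OF linear])

lemma ev_add: "ev (p + q) x = ev p x + ev q x"
  by (induction p q rule: poly_induct2) (simp_all add: ev_pCons linear_add[OF linear] algebra_simps)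

lemma ev_smult: "ev (smult c p) x = c *\<^sub>R ev p x"
  by (induction p) (simp_all add: ev_pCons linear_cmul[OF linear] algebra_simps)

lemma ev_diff: "ev (p - q) x = ev p x - ev q x"
proof -
  have "ev (p + smult (- 1) q) x = ev p x - ev q x"
    by (simp only: ev_add ev_smult) simp
  then show ?thesis
    by simp
qed

lemma ev_mult: "ev (p * q) x = ev p (ev q x)"
  by (induction p) (simp_all add: ev_pCons ev_add ev_smult)

lemma ev_1 [simp]: "ev 1 x = x"
  by (simp add: one_pCons ev_pCons linear_0[OF linear])

lemma ev_X: "ev [:0, 1:] x = T x"
  by (simp add: ev_pCons linear_0[OF linear])

lemma linear_ev: "linear (ev p)"
proof (induction p)
  case 0
  show ?case by (rule linearI) auto
next
  case (pCons a p)
  show ?case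
    by (rule linearI) (simp_all add: ev_pCons linear_add[OF pCons(2)] linear_cmul[OF pCons(2)]
        linear_add[OF linear] linear_cmul[OF linear] algebra_simps)
qed

lemma ev_commute: "ev p (T x) = T (ev p x)"
  using ev_mult[of p "[:0,1:]" x] ev_mult[of "[:0,1:]" p x] by (simp only: ev_X mult.commute)

lemma selfadjoint_ev: "inner (ev p x) y = inner x (ev p y)"
  by (induction p arbitrary: x y)
     (simp_all add: ev_pCons inner_add_left inner_add_right selfadjoint ev_commute)

lemma positive_weight: "0 \<le> inner (ev [:1/2, 0, -1/2:] x) x"
proof -
  have "ev [:1/2, 0, -1/2:] x = (1/2) *\<^sub>R x - (1/2) *\<^sub>R T (T x)"
    by (simp add: ev_pCons linear_0[OF linear] linear_cmul[OF linear] linear_neg[OF linear])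
  moreover have "inner (T x) (T x) \<le> inner x x"
    using contraction[of x] by (simp add: power2_norm_eq_inner[symmetric])
  ultimately show ?thesis
    by (simp add: inner_diff_left selfadjoint)
qed

lemma ev_square_positive: "inner (ev (p * p) x) x = (norm (ev p x))\<^sup>2"
  by (simp add: ev_mult selfadjoint_ev power2_norm_eq_inner)

text \<open>That a product of commuting positive operators is positive would call for square roots,
  so the rule \<open>weight\<close> resists a direct induction. Claiming positivity of
  \<open>?w ^ k * p\<close> for all k at once, that rule merely shifts k, and the base case is a
  square, or w between two equal factors.\<close>

lemma positive_cone_positive: "p \<in> positive_cone \<Longrightarrow> 0 \<le> inner (ev p x) x"
proof -
  let ?w = "[:1/2, 0, -1/2:] :: real poly"
  have pow: "0 \<le> inner (ev (?w ^ k) y) y" for k y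
  proof (cases "even k")
    case True
    then obtain j where "k = j + j" by (metis evenE mult_2)
    then show ?thesis by (simp add: power_add ev_square_positive)
  next
    case False
    then obtain j where "k = Suc (j + j)" by (metis oddE mult_2 Suc_eq_plus1)
    then have "inner (ev (?w ^ k) y) y = inner (ev (?w ^ j * (?w * ?w ^ j)) y) y"
      by (simp only: power_Suc power_add mult_ac)
    also have "\<dots> = inner (ev ?w (ev (?w ^ j) y)) (ev (?w ^ j) y)"
      by (simp only: ev_mult selfadjoint_ev)
    finally show ?thesis
      using positive_weight by simp
  qed
  assume "p \<in> positive_cone"
  then have "0 \<le> inner (ev (?w ^ k * p) x) x" for k
  proof (induction arbitrary: k rule: positive_cone.induct)
    case (weight p)
    then show ?case
      using weight(2)[of "Suc k"] by (simp only: power_Suc mult_ac)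
  qed (simp_all only: mult_1_right pow distrib_left ev_add inner_add_left add_nonneg_nonneg
      mult_smult_right ev_smult inner_scaleR_left mult_nonneg_nonneg)
  from this[of 0] show ?thesis by simp
qed

lemma norm_sign_poly_le: "norm (ev (sign_poly n) x) \<le> norm x"
proof -
  have "0 \<le> inner (ev (sign_gap n) x) x"
    by (intro positive_cone_positive sign_gap_cone)
  then have "(norm (ev (sign_poly n) x))\<^sup>2 \<le> (norm x)\<^sup>2"
    by (simp add: sign_gap_def ev_smult ev_diff inner_diff_left ev_square_positive power2_norm_eq_inner[symmetric])
  then show ?thesis
    by (simp add: power2_le_iff_abs_le)
qed

text \<open>For a = x f and b = x h, with f and h the later and earlier \<open>sign_factor\<close>,
  a^2 - b^2 - (a - b)^2 = 2 b (a - b) = x (2 h (f - h)) x, a cone element between two factors x. So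
  the norms increase, and their convergence controls the distances.\<close>

lemma norm_sign_poly_diff:
  assumes "m \<le> n"
  shows "(norm (ev (sign_poly n - sign_poly m) x))\<^sup>2
          \<le> (norm (ev (sign_poly n) x))\<^sup>2 - (norm (ev (sign_poly m) x))\<^sup>2"
proof -
  let ?y = sign_poly
  let ?q = "smult 2 (sign_factor m * (sign_factor n - sign_factor m))"
  have "?y n * ?y n - ?y m * ?y m - (?y n - ?y m) * (?y n - ?y m) = [:0,1:] * (?q * [:0,1:])"
    by (rule poly_eqI_poly) (simp add: sign_poly_eq_factor algebra_simps)
  then have "inner (ev (?y n * ?y n - ?y m * ?y m - (?y n - ?y m) * (?y n - ?y m)) x) x
      = inner (ev ?q (T x)) (T x)"
    by (simp only: ev_mult ev_X selfadjoint)
  also have "\<dots> \<ge> 0"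
    by (intro positive_cone_positive positive_cone.smult positive_cone_mult sign_factor_cone sign_factor_mono assms) auto
  finally show ?thesis
    by (simp only: ev_diff[of "_ * _"] ev_diff[of "_ - _"] inner_diff_left ev_square_positive)
qed

lemma sign_poly_convergent: "convergent (\<lambda>n. ev (sign_poly n) x)"
proof -
  let ?a = "\<lambda>n. (norm (ev (sign_poly n) x))\<^sup>2"
  have "incseq ?a"
    using norm_sign_poly_diff[of _ _ x] unfolding incseq_def by (smt (verit) zero_le_power2)
  moreover have "?a n \<le> (norm x)\<^sup>2" for n
    by (intro power_mono norm_sign_poly_le) auto
  ultimately have "convergent ?a"
    by (meson incseq_convergent convergentI)
  then have C: "Cauchy ?a"
    by (rule convergent_Cauchy)
  have "Cauchy (\<lambda>n. ev (sign_poly n) x)"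
  proof (rule CauchyI')
    fix e :: real assume "e > 0"
    then obtain N where N: "\<And>m n. m \<ge> N \<Longrightarrow> n \<ge> N \<Longrightarrow> norm (?a m - ?a n) < e\<^sup>2"
      using CauchyD[OF C, of "e\<^sup>2"] by auto
    have "dist (ev (sign_poly m) x) (ev (sign_poly n) x) < e" if "m \<ge> N" "n > m" for m n
    proof -
      have "(norm (ev (sign_poly n) x - ev (sign_poly m) x))\<^sup>2 < e\<^sup>2"
        using norm_sign_poly_diff[of m n x] N[of n m] that by (simp add: ev_diff)
      then show ?thesis
        using \<open>e > 0\<close> by (simp add: dist_norm norm_minus_commute power2_less_imp_less)
    qed
    then show "\<exists>M. \<forall>m\<ge>M. \<forall>n>m. dist (ev (sign_poly m) x) (ev (sign_poly n) x) < e"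
      by blast
  qed
  then show ?thesis
    by (rule Cauchy_convergent)
qed

definition sign_op :: "'h \<Rightarrow> 'h"
  where "sign_op x = lim (\<lambda>n. ev (sign_poly n) x)"

lemma sign_op_lim: "(\<lambda>n. ev (sign_poly n) x) \<longlonglongrightarrow> sign_op x"
  unfolding sign_op_def using sign_poly_convergent convergent_LIMSEQ_iff by blast

lemma linear_sign_op: "linear sign_op"
proof (rule linearI)
  fix x y and r :: real
  show "sign_op (x + y) = sign_op x + sign_op y"
    using tendsto_add[OF sign_op_lim[of x] sign_op_lim[of y]]
    by (intro LIMSEQ_unique[OF sign_op_lim]) (simp add: linear_add[OF linear_ev])
  show "sign_op (r *\<^sub>R x) = r *\<^sub>R sign_op x"
    using tendsto_scaleR[OF tendsto_const[of r] sign_op_lim[of x]]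
    by (intro LIMSEQ_unique[OF sign_op_lim]) (simp add: linear_cmul[OF linear_ev])
qed

lemma selfadjoint_sign_op: "inner (sign_op x) y = inner x (sign_op y)"
  using tendsto_inner[OF sign_op_lim[of x] tendsto_const[of y]]
        tendsto_inner[OF tendsto_const[of x] sign_op_lim[of y]]
  by (intro LIMSEQ_unique[of "\<lambda>n. inner (ev (sign_poly n) x) y"]) (simp_all add: selfadjoint_ev)

text \<open>Contractivity uniform in n lets the argument vary with n; this yields the limit of the
  cubic term of the iteration.\<close>

lemma sign_poly_comp_lim:
  assumes "u \<longlonglongrightarrow> x"
  shows "(\<lambda>n. ev (sign_poly n) (u n)) \<longlonglongrightarrow> sign_op x"
proof -
  have "(\<lambda>n. ev (sign_poly n) (u n - x)) \<longlonglongrightarrow> 0"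
  proof (rule Lim_null_comparison)
    show "\<forall>\<^sub>F n in sequentially. norm (ev (sign_poly n) (u n - x)) \<le> norm (u n - x)"
      by (simp add: norm_sign_poly_le)
    show "(\<lambda>n. norm (u n - x)) \<longlonglongrightarrow> 0"
      using assms by (simp add: LIM_zero tendsto_norm_zero)
  qed
  from tendsto_add[OF this sign_op_lim[of x]] show ?thesis
    by (simp add: linear_diff[OF linear_ev])
qed

text \<open>In the limit the iteration becomes s = (3 s - s^3) / 2. The conclusion s^3 = s is what
  makes (s^2 + s) / 2 and (s^2 - s) / 2 idempotent.\<close>

lemma sign_op_cube: "sign_op (sign_op (sign_op x)) = sign_op x"
proof -
  let ?s = sign_op and ?y = sign_poly
  have "(\<lambda>n. ev (?y (Suc n)) x) \<longlonglongrightarrow> ?s x"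
    using sign_op_lim by (rule LIMSEQ_Suc)
  moreover have "(\<lambda>n. ev (?y (Suc n)) x) \<longlonglongrightarrow> (1/2) *\<^sub>R (3 *\<^sub>R ?s x - ?s (?s (?s x)))"
  proof -
    have "?y (Suc n) = smult (1/2) (smult 3 (?y n) - ?y n * (?y n * ?y n))" for n
      by (rule poly_eqI_poly) (simp add: field_simps)
    then have "ev (?y (Suc n)) x = (1/2) *\<^sub>R (3 *\<^sub>R ev (?y n) x - ev (?y n) (ev (?y n) (ev (?y n) x)))" for n
      by (simp only: ev_smult ev_diff ev_mult)
    then show ?thesis
      by (simp only:) (intro tendsto_intros sign_op_lim sign_poly_comp_lim)
  qed
  ultimately have "?s x = (1/2) *\<^sub>R (3 *\<^sub>R ?s x - ?s (?s (?s x)))"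
    by (rule LIMSEQ_unique)
  then have "2 *\<^sub>R ?s x = 3 *\<^sub>R ?s x - ?s (?s (?s x))"
    by (metis scaleR_half_double scaleR_2 scaleR_right_distrib)
  then have "?s (?s (?s x)) = 3 *\<^sub>R ?s x - 2 *\<^sub>R ?s x"
    by (simp add: algebra_simps)
  then show ?thesis
    by (simp flip: scaleR_diff_left)
qed

text \<open>Every \<open>sign_factor\<close> exceeds the first one, which is 1, by a cone element.
  This is the link from the sign back to T: if s v is a real multiple of v and T v is orthogonal to
  v, then T v = 0.\<close>

lemma inner_sign_op_ge: "(norm (T x))\<^sup>2 \<le> inner (sign_op x) (T x)"
proof (rule LIMSEQ_le_const)
  show "(\<lambda>n. inner (ev (sign_poly n) x) (T x)) \<longlonglongrightarrow> inner (sign_op x) (T x)"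
    by (intro tendsto_intros sign_op_lim)
  have "(norm (T x))\<^sup>2 \<le> inner (ev (sign_poly n) x) (T x)" for n
  proof -
    have "0 \<le> inner (ev (sign_factor n - sign_factor 0) (T x)) (T x)"
      by (intro positive_cone_positive sign_factor_mono) simp
    then have "inner (T x) (T x) \<le> inner (ev (sign_factor n) (T x)) (T x)"
      by (simp add: ev_diff inner_diff_left)
    then show ?thesis
      by (simp only: sign_poly_eq_factor ev_mult ev_X ev_commute power2_norm_eq_inner)
  qed
  then show "\<exists>N. \<forall>n\<ge>N. (norm (T x))\<^sup>2 \<le> inner (ev (sign_poly n) x) (T x)"
    by blast
qed

end

section \<open>Measures on the Cantor space from commuting projections\<close>

definition determined_by :: "nat \<Rightarrow> (nat \<Rightarrow> bool) set \<Rightarrow> bool"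
  where "determined_by n A \<longleftrightarrow> (\<forall>x y. (\<forall>i<n. x i = y i) \<longrightarrow> x \<in> A \<longrightarrow> y \<in> A)"

definition cylinders :: "(nat \<Rightarrow> bool) set set"
  where "cylinders = {A. \<exists>n. determined_by n A}"

definition Cantor_top :: "(nat \<Rightarrow> bool) topology"
  where "Cantor_top = product_topology (\<lambda>_. discrete_topology UNIV) UNIV"

lemma determined_byD:
  assumes "determined_by n A" "\<And>i. i < n \<Longrightarrow> x i = y i"
  shows "x \<in> A \<longleftrightarrow> y \<in> A"
proof -
  have "\<forall>i<n. x i = y i" "\<forall>i<n. y i = x i"
    by (simp_all add: assms(2))
  with assms(1) show ?thesis
    unfolding determined_by_def by blast
qed

lemma determined_byI:
  "(\<And>x y. (\<And>i. i < n \<Longrightarrow> x i = y i) \<Longrightarrow> x \<in> A \<Longrightarrow> y \<in> A) \<Longrightarrow> determined_by n A"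
  unfolding determined_by_def by blast

lemma determined_by_mono:
  assumes "determined_by m A" "m \<le> n"
  shows "determined_by n A"
proof (rule determined_byI)
  fix x y assume xy: "\<And>i. i < n \<Longrightarrow> x i = y i" and "x \<in> A"
  have "x i = y i" if "i < m" for i
    by (rule xy) (use that assms in simp)
  from determined_byD[of m A x y, OF assms(1) this] \<open>x \<in> A\<close> show "y \<in> A" by blast
qed

lemma cylindersI: "determined_by n A \<Longrightarrow> A \<in> cylinders"
  by (auto simp: cylinders_def)

lemma cylinders_common:
  assumes "A \<in> cylinders" "B \<in> cylinders"
  obtains n where "determined_by n A" "determined_by n B"
proof -
  obtain m k where "determined_by m A" "determined_by k B"
    using assms by (auto simp: cylinders_def)
  then show ?thesis
    using that[of "max m k"] determined_by_mono[of m A "max m k"] determined_by_mono[of k B "max m k"] by simp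
qed

lemma determined_by_Int: "determined_by n A \<Longrightarrow> determined_by n B \<Longrightarrow> determined_by n (A \<inter> B)"
  by (rule determined_byI) (use determined_byD[of n] in blast)

lemma determined_by_Compl: "determined_by n A \<Longrightarrow> determined_by n (- A)"
  by (rule determined_byI) (use determined_byD[of n A] in blast)

lemma coordinate_cylinder: "{x. x n} \<in> cylinders"
  by (rule cylindersI[of "Suc n"]) (auto simp: determined_by_def)

lemma cylinders_Int: "A \<in> cylinders \<Longrightarrow> B \<in> cylinders \<Longrightarrow> A \<inter> B \<in> cylinders"
  by (meson cylinders_common cylindersI determined_by_Int)

lemma cylinders_Compl: "A \<in> cylinders \<Longrightarrow> - A \<in> cylinders"
  using determined_by_Compl by (auto simp: cylinders_def)

lemma cylinders_Un: "A \<in> cylinders \<Longrightarrow> B \<in> cylinders \<Longrightarrow> A \<union> B \<in> cylinders"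
  using cylinders_Compl[OF cylinders_Int[OF cylinders_Compl cylinders_Compl]] by fastforce

lemma cylinders_Diff: "A \<in> cylinders \<Longrightarrow> B \<in> cylinders \<Longrightarrow> A - B \<in> cylinders"
  by (simp add: Diff_eq cylinders_Int cylinders_Compl)

lemma cylinders_UNIV: "UNIV \<in> cylinders"
  by (rule cylindersI[of 0]) (simp add: determined_by_def)

lemma cylinders_empty: "{} \<in> cylinders"
  by (rule cylindersI[of 0]) (simp add: determined_by_def)

text \<open>A set determined by n + 1 coordinates splits along coordinate n into two sets determined
  by n coordinates. Since \<open>proj\<close> turns complements and intersections into operator
  expressions, facts about it can be reduced to single coordinates.\<close>

lemma cylinders_induct [consumes 1, case_names coordinate Compl Int]:
  assumes A: "A \<in> cylinders"
    and coord: "\<And>n. Q {x. x n}"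
    and Compl: "\<And>A. A \<in> cylinders \<Longrightarrow> Q A \<Longrightarrow> Q (- A)"
    and Int: "\<And>A B. A \<in> cylinders \<Longrightarrow> Q A \<Longrightarrow> B \<in> cylinders \<Longrightarrow> Q B \<Longrightarrow> Q (A \<inter> B)"
  shows "Q A"
proof -
  note cyl = cylinders_Int cylinders_Compl coordinate_cylinder
  have empty: "Q {}"
    using Int[OF _ coord[of 0] _ Compl[OF _ coord[of 0]]] by (simp add: cyl)
  have Un: "Q (A \<union> B)" if "A \<in> cylinders" "Q A" "B \<in> cylinders" "Q B" for A B
    using Compl[OF _ Int[OF _ Compl[of A] _ Compl[of B]]] that by (simp add: cyl)
  have "Q A" if "determined_by n A" for n A
    using that
  proof (induction n arbitrary: A)
    case 0
    then have "A = {} \<or> A = - {}"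
      unfolding determined_by_def by blast
    then show ?case
      using empty Compl[OF cylinders_empty empty] by auto
  next
    case (Suc n)
    define B where "B b = {x. x(n := b) \<in> A}" for b
    have det: "determined_by n (B b)" for b
      unfolding B_def determined_by_def
      by clarify (rule determined_byD[OF Suc.prems, THEN iffD1], auto simp: less_Suc_eq)
    have mem: "x \<in> B (x n) \<longleftrightarrow> x \<in> A" for x
      by (simp add: B_def)
    have "A = ({x. x n} \<inter> B True) \<union> (- {x. x n} \<inter> B False)"
    proof (rule Set.set_eqI)
      fix x
      show "x \<in> A \<longleftrightarrow> x \<in> ({x. x n} \<inter> B True) \<union> (- {x. x n} \<inter> B False)"
        using mem[of x] by (cases "x n") simp_all
    qed
    moreover have "Q (({x. x n} \<inter> B True) \<union> (- {x. x n} \<inter> B False))"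
      by (intro Un Int Compl coord Suc.IH det cyl cylindersI[OF det])
    ultimately show ?case by simp
  qed
  with A show ?thesis
    by (auto simp: cylinders_def)
qed

lemma topspace_Cantor_top [simp]: "topspace Cantor_top = UNIV"
  by (simp add: Cantor_top_def)

lemma openin_Cantor_top_iff:
  "openin Cantor_top U \<longleftrightarrow> (\<forall>x\<in>U. \<exists>n. \<forall>y. (\<forall>i<n. y i = x i) \<longrightarrow> y \<in> U)"
proof
  assume U: "openin Cantor_top U"
  show "\<forall>x\<in>U. \<exists>n. \<forall>y. (\<forall>i<n. y i = x i) \<longrightarrow> y \<in> U"
  proof
    fix x assume "x \<in> U"
    then obtain V :: "nat \<Rightarrow> bool set" where V: "finite {i. V i \<noteq> UNIV}" "x \<in> Pi\<^sub>E UNIV V" "Pi\<^sub>E UNIV V \<subseteq> U"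
      using U unfolding Cantor_top_def openin_product_topology_alt by force
    obtain n where n: "\<And>i. V i \<noteq> UNIV \<Longrightarrow> i < n"
      using finite_nat_bounded[OF V(1)] by auto
    have "y \<in> U" if y: "\<forall>i<n. y i = x i" for y
    proof -
      have "y i \<in> V i" for i
        using n[of i] y V(2) by (cases "V i = UNIV") (auto simp: PiE_iff)
      then show ?thesis
        using V(3) by (auto simp: PiE_iff)
    qed
    then show "\<exists>n. \<forall>y. (\<forall>i<n. y i = x i) \<longrightarrow> y \<in> U"
      by blast
  qed
next
  assume U: "\<forall>x\<in>U. \<exists>n. \<forall>y. (\<forall>i<n. y i = x i) \<longrightarrow> y \<in> U"
  show "openin Cantor_top U"
    unfolding Cantor_top_def openin_product_topology_alt
  proof (intro ballI)
    fix x assume "x \<in> U"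
    then obtain n where n: "\<And>y. (\<forall>i<n. y i = x i) \<Longrightarrow> y \<in> U"
      using U by blast
    define V where "V i = (if i < n then {x i} else UNIV)" for i
    have "{i. V i \<noteq> UNIV} \<subseteq> {..<n}"
      by (auto simp: V_def)
    then have "finite {i. V i \<noteq> UNIV}"
      by (rule finite_subset) simp
    moreover have "Pi\<^sub>E UNIV V \<subseteq> U"
    proof
      fix y assume "y \<in> Pi\<^sub>E UNIV V"
      then have "y i \<in> V i" for i by (auto simp: PiE_iff)
      then show "y \<in> U"
        by (intro n) (metis V_def singletonD)
    qed
    moreover have "x \<in> Pi\<^sub>E UNIV V"
      by (auto simp: V_def)
    ultimately show "\<exists>V. finite {i \<in> UNIV. V i \<noteq> topspace (discrete_topology (UNIV::bool set))} \<and>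
        (\<forall>i\<in>UNIV. openin (discrete_topology UNIV) (V i)) \<and> x \<in> Pi\<^sub>E UNIV V \<and> Pi\<^sub>E UNIV V \<subseteq> U"
      by auto
  qed
qed

lemma cylinders_openin: "A \<in> cylinders \<Longrightarrow> openin Cantor_top A"
  unfolding openin_Cantor_top_iff cylinders_def determined_by_def by (auto simp: eq_commute)

lemma cylinders_closedin: "A \<in> cylinders \<Longrightarrow> closedin Cantor_top A"
  by (simp add: closedin_def cylinders_openin cylinders_Compl flip: Compl_eq_Diff_UNIV)

lemma compact_Cantor_top: "compact_space Cantor_top"
  unfolding Cantor_top_def by (simp add: compact_space_product_topology compact_space_discrete_topology)

lemma completely_metrizable_Cantor_top: "completely_metrizable_space Cantor_top"
  unfolding Cantor_top_def completely_metrizable_space_product_topology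
  by (simp add: completely_metrizable_space_discrete_topology)

lemma second_countable_Cantor_top: "second_countable Cantor_top"
proof -
  define B :: "bool list \<Rightarrow> (nat \<Rightarrow> bool) set" where "B s = {x. \<forall>i<length s. x i = s ! i}" for s
  show ?thesis
    unfolding second_countable_def
  proof (intro exI[of _ "range B"] conjI allI ballI impI)
    show "openin Cantor_top V" if "V \<in> range B" for V
      using that unfolding openin_Cantor_top_iff B_def by force
    fix U x assume "openin Cantor_top U \<and> x \<in> U"
    then obtain n where n: "\<And>y. (\<forall>i<n. y i = x i) \<Longrightarrow> y \<in> U"
      unfolding openin_Cantor_top_iff by blast
    show "\<exists>V\<in>range B. x \<in> V \<and> V \<subseteq> U"
      by (rule bexI[OF _ rangeI[of B "map x [0..<n]"]]) (auto simp: B_def intro: n)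
  qed auto
qed

lemma sigma_sets_cylinders:
  "sigma_sets UNIV cylinders = sigma_sets UNIV {U. openin Cantor_top U}"
proof
  show "sigma_sets UNIV cylinders \<subseteq> sigma_sets UNIV {U. openin Cantor_top U}"
    by (rule sigma_sets_mono') (auto intro: cylinders_openin)
  show "sigma_sets UNIV {U. openin Cantor_top U} \<subseteq> sigma_sets UNIV cylinders"
  proof (rule sigma_sets_mono, rule subsetI)
    fix U assume "U \<in> {U. openin Cantor_top U}"
    then have U: "openin Cantor_top U" by simp
    \<comment> \<open>The largest subset of U that is determined by the first n coordinates;
      openness of U says that these subsets exhaust it.\<close>
    define C where "C n = {x. \<forall>y. (\<forall>i<n. y i = x i) \<longrightarrow> y \<in> U}" for n
    have "determined_by n (C n)" for n
      unfolding determined_by_def C_def by auto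
    then have "C n \<in> cylinders" for n
      by (rule cylindersI)
    moreover have "U = (\<Union>n. C n)"
      using U unfolding openin_Cantor_top_iff C_def by auto
    ultimately show "U \<in> sigma_sets UNIV cylinders"
      by (auto intro!: sigma_sets.Union)
  qed
qed

text \<open>Cylinders are closed in a compact space. Continuity at the empty set, the analytic
  hypothesis of Caratheodory's theorem, thus becomes immediate for a finitely additive function on
  cylinders.\<close>

lemma decseq_cylinders_empty:
  assumes "range A \<subseteq> cylinders" "decseq A" "(\<Inter>i. A i) = {}"
  shows "\<exists>n. A n = {}"
proof (rule ccontr)
  assume "\<nexists>n. A n = {}"
  have "(\<Inter>n. A n) \<noteq> {}"
  proof (rule compact_space_imp_nest[OF compact_Cantor_top])
    show "closedin Cantor_top (A n)" for n
      using assms(1) by (auto intro: cylinders_closedin)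
    show "A n \<noteq> {}" for n
      using \<open>\<nexists>n. A n = {}\<close> by blast
  qed (rule assms)
  with assms(3) show False by simp
qed

section \<open>The projection of an event and the spectral measure of a vector\<close>

locale commuting_projections =
  fixes P :: "nat \<Rightarrow> 'h::real_inner \<Rightarrow> 'h"
  assumes linear_P: "linear (P n)"
    and idem_P: "P n (P n v) = P n v"
    and selfadjoint_P: "inner (P n v) w = inner v (P n w)"
    and commute_P: "P m (P n v) = P n (P m v)"
begin

text \<open>\<open>partial_proj k A x\<close> is the projection onto the event that the first \<open>k\<close> coordinates,
  completed by those of \<open>x\<close>, give a point of \<open>A\<close>, where the \<open>n\<close>-th coordinate being \<open>True\<close>
  is the event \<open>P n\<close>.\<close>

primrec partial_proj :: "nat \<Rightarrow> (nat \<Rightarrow> bool) set \<Rightarrow> (nat \<Rightarrow> bool) \<Rightarrow> 'h \<Rightarrow> 'h" where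
  "partial_proj 0 A x v = (if x \<in> A then v else 0)"
| "partial_proj (Suc k) A x v = P k (partial_proj k A (x(k := True)) v)
     + (partial_proj k A (x(k := False)) v - P k (partial_proj k A (x(k := False)) v))"

lemmas P_simps = linear_add[OF linear_P] linear_diff[OF linear_P] linear_cmul[OF linear_P] linear_0[OF linear_P] idem_P

lemma partial_proj_P: "partial_proj k A x (P j v) = P j (partial_proj k A x v)"
  by (induction k arbitrary: x) (simp_all add: P_simps commute_P[of _ j])

lemma partial_proj_add: "partial_proj k A x (v + w) = partial_proj k A x v + partial_proj k A x w"
  by (induction k arbitrary: x) (simp_all add: P_simps)

lemma partial_proj_cmul: "partial_proj k A x (c *\<^sub>R v) = c *\<^sub>R partial_proj k A x v"
  by (induction k arbitrary: x) (simp_all add: P_simps algebra_simps)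

lemma linear_partial_proj: "linear (partial_proj k A x)"
  by (rule linearI) (simp_all add: partial_proj_add partial_proj_cmul)

lemma selfadjoint_partial_proj: "inner (partial_proj k A x v) w = inner v (partial_proj k A x w)"
proof (induction k arbitrary: x v w)
  case (Suc k)
  then show ?case
    by (simp only: partial_proj.simps inner_add_left inner_diff_left inner_add_right inner_diff_right
        selfadjoint_P partial_proj_P)
qed simp

text \<open>The two branches of the recursion carry the factors P k and 1 - P k, whose product is 0,
  so the mixed terms of the composition cancel.\<close>

lemma partial_proj_Int: "partial_proj k (A \<inter> B) x v = partial_proj k A x (partial_proj k B x v)"
proof (induction k arbitrary: x v)
  case (Suc k)
  define x1 x2 where "x1 = x(k := True)" and "x2 = x(k := False)"
  show ?case
    unfolding partial_proj.simps Suc.IH x1_def[symmetric] x2_def[symmetric]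
    by (simp add: linear_add[OF linear_partial_proj] linear_diff[OF linear_partial_proj] partial_proj_P P_simps)
qed (auto simp: linear_0[OF linear_partial_proj])

lemma partial_proj_Compl: "partial_proj k (- A) x v = v - partial_proj k A x v"
  by (induction k arbitrary: x) (simp_all add: P_simps)

lemma partial_proj_cong:
  assumes "\<And>u. (\<lambda>i. if i < k then u i else x i) \<in> A \<longleftrightarrow> (\<lambda>i. if i < k then u i else y i) \<in> B"
  shows "partial_proj k A x v = partial_proj k B y v"
  using assms
proof (induction k arbitrary: x y)
  case 0
  then show ?case by simp
next
  case (Suc k)
  have "partial_proj k A (x(k := b)) v = partial_proj k B (y(k := b)) v" for b
  proof (rule Suc.IH)
    fix u
    have *: "(\<lambda>i. if i < k then u i else (z(k := b)) i) = (\<lambda>i. if i < Suc k then (u(k := b)) i else z i)" for z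
      by (auto simp: fun_eq_iff less_Suc_eq)
    show "(\<lambda>i. if i < k then u i else (x(k := b)) i) \<in> A \<longleftrightarrow> (\<lambda>i. if i < k then u i else (y(k := b)) i) \<in> B"
      unfolding * by (rule Suc.prems)
  qed
  then show ?case by simp
qed

text \<open>By \<open>proj_eq\<close> every number of coordinates that determines A, and every base
  point, gives the same operator; the least number and the constant point only fix a choice.\<close>

definition proj :: "(nat \<Rightarrow> bool) set \<Rightarrow> 'h \<Rightarrow> 'h"
  where "proj A = partial_proj (LEAST n. determined_by n A) A (\<lambda>_. False)"

lemma proj_eq:
  assumes "determined_by n A"
  shows "proj A v = partial_proj n A x v"
proof -
  have step: "partial_proj (Suc k) A x v = partial_proj k A y v" if "determined_by k A" for k x y
  proof -
    have "partial_proj k A (x(k := b)) v = partial_proj k A y v" for b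
      by (rule partial_proj_cong) (rule determined_byD[OF that], auto)
    then show ?thesis by simp
  qed
  have "partial_proj k A x v = partial_proj m A y v" if "m \<le> k" "determined_by m A" for k m x y
    using that
  proof (induction k arbitrary: x rule: dec_induct)
    case base
    show ?case by (rule partial_proj_cong) (rule determined_byD[OF that(2)], auto)
  next
    case (step k)
    then show ?case
      using \<open>\<And>k x y. determined_by k A \<Longrightarrow> partial_proj (Suc k) A x v = partial_proj k A y v\<close>
        determined_by_mono[of m A k] by auto
  qed
  then show ?thesis
    unfolding proj_def by (metis assms LeastI Least_le)
qed

lemma linear_proj: "linear (proj A)"
  unfolding proj_def by (rule linear_partial_proj)

lemma selfadjoint_proj: "inner (proj A v) w = inner v (proj A w)"
  unfolding proj_def by (rule selfadjoint_partial_proj)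

lemma proj_Compl:
  assumes "A \<in> cylinders"
  shows "proj (- A) v = v - proj A v"
proof -
  obtain n where "determined_by n A"
    using assms by (auto simp: cylinders_def)
  then show ?thesis
    using proj_eq[of n A] proj_eq[OF determined_by_Compl, of n A] partial_proj_Compl by metis
qed

lemma proj_Int: "A \<in> cylinders \<Longrightarrow> B \<in> cylinders \<Longrightarrow> proj (A \<inter> B) v = proj A (proj B v)"
  by (rule cylinders_common[of A B]) (use proj_eq determined_by_Int partial_proj_Int in metis)+

lemma proj_empty: "proj {} v = 0"
proof -
  have "determined_by 0 {}" by (simp add: determined_by_def)
  from proj_eq[OF this] show ?thesis by simp
qed

lemma proj_UNIV: "proj UNIV v = v"
  using proj_Compl[OF cylinders_empty, of v] by (simp add: proj_empty)

lemma proj_coordinate: "proj {x. x n} v = P n v"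
proof -
  have 1: "partial_proj n {x. x n} (x(n := True)) v = partial_proj n UNIV x v"
    and 2: "partial_proj n {x. x n} (x(n := False)) v = partial_proj n {} x v" for x
    by (rule partial_proj_cong, simp)+
  have 0: "determined_by 0 UNIV" "determined_by 0 {}"
    by (simp_all add: determined_by_def)
  have "determined_by (Suc n) {x. x n}"
    by (auto simp: determined_by_def)
  then have "proj {x. x n} v = partial_proj (Suc n) {x. x n} x v" for x
    by (rule proj_eq)
  also have "\<dots> x = P n (proj UNIV v) + (proj {} v - P n (proj {} v))" for x
    unfolding partial_proj.simps 1 2
    using proj_eq[OF determined_by_mono[OF 0(1), of n]] proj_eq[OF determined_by_mono[OF 0(2), of n]] by simp
  finally show ?thesis
    by (simp add: proj_UNIV proj_empty P_simps)
qed

lemma proj_Un_disjoint: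
  assumes "A \<in> cylinders" "B \<in> cylinders" "A \<inter> B = {}"
  shows "proj (A \<union> B) v = proj A v + proj B v"
proof -
  have "proj (- (- A \<inter> - B)) v = v - (v - proj A v - (proj B v - proj A (proj B v)))"
    using assms(1,2) by (simp only: proj_Compl proj_Int cylinders_Int cylinders_Compl linear_diff[OF linear_proj])
  moreover have "proj A (proj B v) = 0"
    using proj_Int[OF assms(1,2), of v] assms(3) by (simp add: proj_empty)
  ultimately show ?thesis
    by simp
qed

lemma inner_proj_proj:
  assumes "A \<in> cylinders" "B \<in> cylinders"
  shows "inner (proj A v) (proj B v) = (norm (proj (A \<inter> B) v))\<^sup>2"
proof -
  have "inner (proj A v) (proj B v) = inner v (proj (A \<inter> B) v)"
    using assms by (simp add: selfadjoint_proj proj_Int)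
  also have "\<dots> = inner v (proj (A \<inter> B) (proj (A \<inter> B) v))"
    using proj_Int[of "A \<inter> B" "A \<inter> B" v] assms by (simp add: cylinders_Int)
  finally show ?thesis
    by (simp add: selfadjoint_proj power2_norm_eq_inner)
qed

lemma norm_proj_Un_disjoint:
  assumes "A \<in> cylinders" "B \<in> cylinders" "A \<inter> B = {}"
  shows "(norm (proj (A \<union> B) v))\<^sup>2 = (norm (proj A v))\<^sup>2 + (norm (proj B v))\<^sup>2"
  using inner_proj_proj[OF assms(1,2), of v] assms
  by (simp add: proj_Un_disjoint proj_empty power2_norm_eq_inner inner_add_left inner_add_right inner_commute)

text \<open>The common part of A and B cancels, and the two differences are orthogonal. With the
  measure constructed next, the distance of the vectors becomes the L2 distance of the
  indicators.\<close>

lemma norm_proj_diff: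
  assumes "A \<in> cylinders" "B \<in> cylinders"
  shows "(norm (proj A v - proj B v))\<^sup>2 = (norm (proj (A - B \<union> (B - A)) v))\<^sup>2"
proof -
  note cyl = cylinders_Int cylinders_Diff assms
  have "proj A v = proj (A - B) v + proj (A \<inter> B) v"
  proof -
    have "A = (A - B) \<union> (A \<inter> B)" "(A - B) \<inter> (A \<inter> B) = {}" by blast+
    then show ?thesis
      using proj_Un_disjoint[of "A - B" "A \<inter> B" v] cyl by metis
  qed
  moreover have "proj B v = proj (B - A) v + proj (A \<inter> B) v"
  proof -
    have "B = (B - A) \<union> (A \<inter> B)" "(B - A) \<inter> (A \<inter> B) = {}" by blast+
    then show ?thesis
      using proj_Un_disjoint[of "B - A" "A \<inter> B" v] cyl by metis
  qed
  ultimately have "proj A v - proj B v = proj (A - B) v - proj (B - A) v"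
    by simp
  moreover have "inner (proj (A - B) v) (proj (B - A) v) = 0"
  proof -
    have "(A - B) \<inter> (B - A) = {}" by blast
    then show ?thesis
      using inner_proj_proj[of "A - B" "B - A" v] by (simp add: cyl proj_empty)
  qed
  moreover have "(norm (proj (A - B \<union> (B - A)) v))\<^sup>2 = (norm (proj (A - B) v))\<^sup>2 + (norm (proj (B - A) v))\<^sup>2"
    by (rule norm_proj_Un_disjoint) (use cyl in auto)
  ultimately show ?thesis
    by (simp add: power2_norm_eq_inner inner_diff_left inner_diff_right inner_commute)
qed

text \<open>The spectral measure of v for the family P; its additivity is the theorem of Pythagoras
  for disjoint events.\<close>

lemma ex_cylinder_measure:
  "\<exists>M. space M = UNIV \<and> sets M = sigma_sets UNIV cylinders \<and>
       (\<forall>A\<in>cylinders. emeasure M A = ennreal ((norm (proj A v))\<^sup>2))"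
proof -
  interpret algebra UNIV cylinders
    by (rule algebra_iff_Un[THEN iffD2])
       (auto simp: cylinders_empty cylinders_Un cylinders_Compl simp flip: Compl_eq_Diff_UNIV)
  define f where "f A = ennreal ((norm (proj A v))\<^sup>2)" for A
  have "\<exists>\<mu>. (\<forall>s\<in>cylinders. \<mu> s = f s) \<and> measure_space UNIV (sigma_sets UNIV cylinders) \<mu>"
  proof (rule caratheodory_empty_continuous)
    show "positive cylinders f"
      by (simp add: positive_def f_def proj_empty)
    show "additive cylinders f"
      by (simp add: additive_def f_def norm_proj_Un_disjoint ennreal_plus)
    show "f A \<noteq> \<infinity>" for A
      by (simp add: f_def)
    fix A :: "nat \<Rightarrow> (nat \<Rightarrow> bool) set"
    assume A: "range A \<subseteq> cylinders" "decseq A" "(\<Inter>i. A i) = {}"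
    then obtain n where "A n = {}"
      using decseq_cylinders_empty by blast
    then have "f (A i) = 0" if "i \<ge> n" for i
      using decseqD[OF A(2) that] by (simp add: f_def proj_empty)
    then show "(\<lambda>i. f (A i)) \<longlonglongrightarrow> 0"
      by (intro tendsto_eventually) (auto simp: eventually_sequentially)
  qed
  then obtain \<mu> where \<mu>: "\<And>s. s \<in> cylinders \<Longrightarrow> \<mu> s = f s" "measure_space UNIV (sigma_sets UNIV cylinders) \<mu>"
    by blast
  let ?M = "measure_of UNIV cylinders \<mu>"
  have "emeasure ?M A = f A" if "A \<in> cylinders" for A
    using \<mu> that by (subst emeasure_measure_of[OF refl]) (auto simp: measure_space_def)
  then show ?thesis
    by (intro exI[of _ ?M]) (simp add: f_def)
qed

end

section \<open>Transporting actions on the Cantor space to the reals\<close>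

lemma ex_inj_Cantor_real: "\<exists>j :: (nat \<Rightarrow> bool) \<Rightarrow> real. inj j"
proof -
  obtain f :: "nat set \<Rightarrow> real" where "inj f"
    using nat_sets_lepoll_reals01 unfolding lepoll_def by blast
  moreover have "inj (Collect :: (nat \<Rightarrow> bool) \<Rightarrow> nat set)"
    by (auto intro: injI)
  ultimately show ?thesis
    by (metis inj_compose)
qed

text \<open>The freeness hypothesis speaks of measures on sets of reals. Any injection transports
  the Cantor space there, because its topology is carried along: X is pulled back from
  \<open>Cantor_top\<close> along the inverse of j, independently of the topology of the
  reals.\<close>

lemma standard_prob_space_embed_Cantor:
  fixes j :: "(nat \<Rightarrow> bool) \<Rightarrow> 'x"
  assumes "inj j" "prob_space M" "space M = UNIV" "sets M = sigma_sets UNIV cylinders"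
  shows "standard_prob_space (embed_measure M j)"
proof -
  let ?k = "the_inv_into UNIV j"
  define X where "X = pullback_topology (range j) ?k Cantor_top"
  have k: "?k (j x) = x" for x
    using assms(1) by (simp add: the_inv_into_f_f)
  have openX: "openin X U \<longleftrightarrow> (\<exists>V. openin Cantor_top V \<and> U = ?k -` V \<inter> range j)" for U
    unfolding X_def openin_pullback_topology by simp
  have topX: "topspace X = range j"
    by (simp add: X_def topspace_pullback_topology)
  have img: "?k -` V \<inter> range j = j ` V" for V
    using k by auto
  have pre: "{x \<in> topspace Cantor_top. j x \<in> j ` V} = V" "{y \<in> range j. ?k y \<in> V} = j ` V" for V
    using k inj_eq[OF assms(1)] by auto
  have "continuous_map Cantor_top X j" "continuous_map X Cantor_top ?k"
    unfolding continuous_map_def topX openX img using pre by auto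
  then have "homeomorphic_maps Cantor_top X j ?k"
    unfolding homeomorphic_maps_def topX using k by auto
  then have hom: "Cantor_top homeomorphic_space X"
    unfolding homeomorphic_space_def by blast
  have "prob_space (embed_measure M j)"
  proof
    have "emeasure (embed_measure M j) (j ` space M) = emeasure M (space M)"
      by (rule emeasure_embed_measure_image) (use assms(1) in auto)
    then show "emeasure (embed_measure M j) (space (embed_measure M j)) = 1"
      using assms(2) by (simp add: space_embed_measure prob_space.emeasure_space_1)
  qed
  moreover have "completely_metrizable_space X" "second_countable X"
    using hom completely_metrizable_Cantor_top second_countable_Cantor_top
      homeomorphic_completely_metrizable_space homeomorphic_space_second_countability by blast+
  moreover have "topspace X = space (embed_measure M j)"
    by (simp add: topX space_embed_measure assms(3))
  moreover have "sets (embed_measure M j) = sigma_sets (space (embed_measure M j)) {U. openin X U}"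
  proof -
    have "sets (embed_measure M j) = sets (vimage_algebra (range j) ?k M)"
      using sets_embed_eq_vimage_algebra[of j M] assms(1,3) by simp
    also have "\<dots> = sets (vimage_algebra (range j) ?k (sigma UNIV {U. openin Cantor_top U}))"
      by (rule sets_vimage_algebra_cong) (simp add: assms(4) sigma_sets_cylinders)
    also have "\<dots> = sets (sigma (range j) {?k -` A \<inter> range j | A. A \<in> {U. openin Cantor_top U}})"
      by (subst vimage_algebra_sigma) auto
    also have "\<dots> = sigma_sets (range j) {?k -` A \<inter> range j | A. A \<in> {U. openin Cantor_top U}}"
      by (rule sets_measure_of) auto
    also have "{?k -` A \<inter> range j | A. A \<in> {U. openin Cantor_top U}} = {U. openin X U}"
      by (auto simp: openX)
    finally show ?thesis
      by (simp add: space_embed_measure assms(3))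
  qed
  ultimately show ?thesis
    unfolding standard_prob_space_def by blast
qed

locale Cantor_action = group G for G (structure) +
  fixes M :: "(nat \<Rightarrow> bool) measure" and act :: "'a \<Rightarrow> (nat \<Rightarrow> bool) \<Rightarrow> nat \<Rightarrow> bool"
  assumes prob: "prob_space M"
    and space_M: "space M = UNIV"
    and sets_M: "sets M = sigma_sets UNIV cylinders"
    and act_mult: "g \<in> carrier G \<Longrightarrow> h \<in> carrier G \<Longrightarrow> act (g \<otimes> h) x = act g (act h x)"
    and act_one: "act \<one> x = x"
    and act_measurable: "g \<in> carrier G \<Longrightarrow> act g \<in> M \<rightarrow>\<^sub>M M"
    and act_distr: "g \<in> carrier G \<Longrightarrow> distr M M (act g) = M"
begin

lemma act_inv: "g \<in> carrier G \<Longrightarrow> act g (act (inv g) x) = x" "g \<in> carrier G \<Longrightarrow> act (inv g) (act g x) = x"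
  by (metis act_mult act_one inv_closed r_inv) (metis act_mult act_one inv_closed l_inv)

lemma essentially_free:
  assumes free: "\<And>(M :: real measure) (\<phi> :: 'a \<Rightarrow> real \<Rightarrow> real).
           standard_prob_space M \<Longrightarrow> pmp_action G M \<phi> \<Longrightarrow> ergodic_action G M \<phi> \<Longrightarrow>
           ae_faithful_action G M \<phi> \<Longrightarrow> essentially_free_action G M \<phi>"
    and ergodic: "\<And>A. A \<in> sets M \<Longrightarrow> (\<And>g. g \<in> carrier G \<Longrightarrow> act g ` A = A) \<Longrightarrow> measure M A = 0 \<or> measure M A = 1"
    and faithful: "\<And>g. g \<in> carrier G \<Longrightarrow> g \<noteq> \<one> \<Longrightarrow> \<not> (AE x in M. act g x = x)"
    and g: "g \<in> carrier G" "g \<noteq> \<one>"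
  shows "{x. act g x = x} \<in> null_sets M"
proof -
  obtain j :: "(nat \<Rightarrow> bool) \<Rightarrow> real" where j: "inj j"
    using ex_inj_Cantor_real by blast
  define k where "k = the_inv_into UNIV j"
  have k: "k (j x) = x" for x
    unfolding k_def using j by (simp add: the_inv_into_f_f)
  let ?M = "embed_measure M j"
  \<comment> \<open>Elements of \<open>BijGroup\<close> are extensional, so the transported action
    has to be restricted to the range of j.\<close>
  define \<phi> where "\<phi> g = (\<lambda>r\<in>range j. j (act g (k r)))" for g
  have \<phi>_j: "\<phi> g (j x) = j (act g x)" for g x
    by (simp add: \<phi>_def k)
  have space: "space ?M = range j"
    by (simp add: space_embed_measure space_M)
  have j_meas: "j \<in> M \<rightarrow>\<^sub>M ?M"
    using j by (rule measurable_embed_measure2)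
  have k_meas: "k \<in> ?M \<rightarrow>\<^sub>M M"
  proof (rule measurableI)
    fix A assume "A \<in> sets M"
    moreover have "k -` A \<inter> range j = j ` A"
      using k by auto
    ultimately show "k -` A \<inter> space ?M \<in> sets ?M"
      using j by (simp add: space in_sets_embed_measure)
  qed (simp add: space_M)
  have \<phi>_meas: "\<phi> g \<in> ?M \<rightarrow>\<^sub>M ?M" if "g \<in> carrier G" for g
  proof -
    have "(\<lambda>r. j (act g (k r))) \<in> ?M \<rightarrow>\<^sub>M ?M"
      using measurable_compose[OF measurable_compose[OF k_meas act_measurable[OF that]] j_meas] by simp
    then show ?thesis
      by (rule measurable_cong[THEN iffD1, rotated]) (auto simp: space \<phi>_j k)
  qed
  have "group_action G (space ?M) \<phi>"
    unfolding group_action_def group_hom_def group_hom_axioms_def space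
  proof (intro conjI group_BijGroup homI)
    show "group G" by (rule is_group)
    show Bij: "\<phi> g \<in> carrier (BijGroup (range j))" if "g \<in> carrier G" for g
    proof -
      have "bij_betw (\<phi> g) (range j) (range j)"
        by (rule bij_betw_byWitness[where f' = "\<phi> (inv g)"]) (auto simp: \<phi>_j act_inv that)
      then show ?thesis
        by (simp add: BijGroup_def Bij_def \<phi>_def)
    qed
    show "\<phi> (g \<otimes> h) = \<phi> g \<otimes>\<^bsub>BijGroup (range j)\<^esub> \<phi> h" if "g \<in> carrier G" "h \<in> carrier G" for g h
    proof -
      have "\<phi> g \<otimes>\<^bsub>BijGroup (range j)\<^esub> \<phi> h = compose (range j) (\<phi> g) (\<phi> h)"
        using Bij[OF that(1)] Bij[OF that(2)] by (simp add: BijGroup_def)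
      also have "\<dots> = \<phi> (g \<otimes> h)"
        using that by (auto simp: compose_def \<phi>_def fun_eq_iff k act_mult)
      finally show ?thesis ..
    qed
  qed
  moreover have "distr ?M ?M (\<phi> g) = ?M" if "g \<in> carrier G" for g
  proof -
    have M_eq: "?M = distr M ?M j"
      using j by (rule embed_measure_eq_distr)
    have "distr ?M ?M (\<phi> g) = distr (distr M ?M j) ?M (\<phi> g)"
      by (rule arg_cong[where f = "\<lambda>N. distr N ?M (\<phi> g)"]) (rule M_eq)
    also have "\<dots> = distr M ?M (\<phi> g \<circ> j)"
      by (rule distr_distr[OF \<phi>_meas[OF that] j_meas])
    also have "\<phi> g \<circ> j = j \<circ> act g"
      by (auto simp: \<phi>_j)
    also have "distr M ?M (j \<circ> act g) = distr (distr M M (act g)) ?M j"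
      by (simp only: distr_distr[OF j_meas act_measurable[OF that]])
    also have "\<dots> = ?M"
      by (simp only: act_distr[OF that] M_eq[symmetric])
    finally show ?thesis .
  qed
  ultimately have pmp: "pmp_action G ?M \<phi>"
    unfolding pmp_action_def using \<phi>_meas by blast
  have img: "\<phi> g ` j ` A = j ` act g ` A" for g A
    by (auto simp: \<phi>_j image_iff)
  have "ergodic_action G ?M \<phi>"
    unfolding ergodic_action_def
  proof (intro ballI impI)
    fix A assume "A \<in> sets ?M" and inv: "\<forall>g\<in>carrier G. \<phi> g ` A = A"
    then obtain B where B: "B \<in> sets M" "A = j ` B"
      using j by (auto simp: sets_embed_measure_alt)
    have "act g ` B = B" if "g \<in> carrier G" for g
      using inv that j unfolding B(2) img by (metis inj_image_eq_iff)
    then have "measure M B = 0 \<or> measure M B = 1"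
      using ergodic B(1) by blast
    then show "measure ?M A = 0 \<or> measure ?M A = 1"
      using emeasure_embed_measure_image[OF j B(1)] by (simp add: measure_def B(2))
  qed
  moreover have "ae_faithful_action G ?M \<phi>"
    unfolding ae_faithful_action_def AE_embed_measure[OF j] \<phi>_j using faithful injD[OF j]
    by (auto simp: inj_eq[OF j])
  ultimately have "essentially_free_action G ?M \<phi>"
    using free standard_prob_space_embed_Cantor[OF j prob space_M sets_M] pmp by blast
  then have "{r \<in> space ?M. \<phi> g r = r} \<in> null_sets ?M"
    using g by (simp add: essentially_free_action_def)
  moreover have "{r \<in> space ?M. \<phi> g r = r} = j ` {x. act g x = x}"
    using inj_eq[OF j] by (auto simp: space \<phi>_j)
  ultimately have null: "j ` {x. act g x = x} \<in> null_sets ?M"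
    by simp
  then obtain B where "B \<in> sets M" "j ` {x. act g x = x} = j ` B"
    using j by (auto simp: null_sets_def sets_embed_measure_alt)
  then have "{x. act g x = x} \<in> sets M"
    using j by (simp add: inj_image_eq_iff)
  then show ?thesis
    using null emeasure_embed_measure_image[OF j] by (simp add: null_sets_def)
qed

lemma AE_fixed_subgroup: "{g \<in> carrier G. AE x in M. act g x = x} \<lhd> G"
proof (rule normal_invI[rotated])
  \<comment> \<open>Measure preservation moves an almost sure property along g. Normality follows by
    applying it to the fixed points of h and the element inv g.\<close>
  have AE_act: "AE x in M. Q (act g x)" if "AE x in M. Q x" "g \<in> carrier G" for Q g
    by (rule AE_distrD[OF act_measurable[OF that(2)], of Q]) (simp only: act_distr that)
  show "g \<otimes> h \<otimes> inv g \<in> {g \<in> carrier G. AE x in M. act g x = x}"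
    if "g \<in> carrier G" "h \<in> {g \<in> carrier G. AE x in M. act g x = x}" for g h
  proof -
    have "AE x in M. act h (act (inv g) x) = act (inv g) x"
      using that by (intro AE_act) auto
    then have "AE x in M. act (g \<otimes> h \<otimes> inv g) x = x"
      by eventually_elim (use that in \<open>simp add: act_mult act_inv\<close>)
    then show ?thesis
      using that by simp
  qed
  show "subgroup {g \<in> carrier G. AE x in M. act g x = x} G"
  proof
    fix g h assume gh: "g \<in> {g \<in> carrier G. AE x in M. act g x = x}" "h \<in> {g \<in> carrier G. AE x in M. act g x = x}"
    then have "AE x in M. act g x = x" "AE x in M. act h x = x" by auto
    then have "AE x in M. act (g \<otimes> h) x = x"
      by eventually_elim (use gh in \<open>simp add: act_mult\<close>)
    then show "g \<otimes> h \<in> {g \<in> carrier G. AE x in M. act g x = x}"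
      using gh by simp
  next
    fix g assume g: "g \<in> {g \<in> carrier G. AE x in M. act g x = x}"
    then have "AE x in M. act g x = x" by auto
    then have "AE x in M. act (inv g) x = x"
      by eventually_elim (use g act_inv in \<open>metis (no_types, lifting) mem_Collect_eq\<close>)
    then show "inv g \<in> {g \<in> carrier G. AE x in M. act g x = x}"
      using g by simp
  qed (auto simp: act_one)
qed

end

section \<open>Approximation of measurable sets by cylinders\<close>

lemma cylinder_approximation:
  assumes "prob_space M" "space M = UNIV" and sets_M: "sets M = sigma_sets UNIV cylinders"
    and "A \<in> sets M" "0 < \<epsilon>"
  shows "\<exists>C\<in>cylinders. measure M (sym_diff A C) < \<epsilon>"
proof -
  interpret prob_space M by fact
  have cyl: "C \<in> sets M" if "C \<in> cylinders" for C
    using that by (simp add: sets_M sigma_sets.Basic)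
  have "Int_stable cylinders"
    by (auto simp: Int_stable_def cylinders_Int)
  moreover have "cylinders \<subseteq> Pow UNIV"
    by simp
  moreover have "A \<in> sigma_sets UNIV cylinders"
    using assms by simp
  \<comment> \<open>The induction needs the claim for all positive bounds simultaneously: the union
    step splits its bound between the tail of the union and a finite union, and the latter halves
    its share at each set.\<close>
  ultimately have "\<forall>\<epsilon>>0. \<exists>C\<in>cylinders. measure M (sym_diff A C) < \<epsilon>"
  proof (induction rule: sigma_sets_induct_disjoint)
    case (basic A)
    then show ?case by (auto intro!: bexI[of _ A])
  next
    case empty
    then show ?case by (auto intro!: bexI[of _ "{}"] cylinders_empty)
  next
    case (compl A)
    show ?case
    proof (intro allI impI)
      fix \<epsilon> :: real assume "\<epsilon> > 0"
      then obtain C where "C \<in> cylinders" "measure M (sym_diff A C) < \<epsilon>"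
        using compl by blast
      moreover have "sym_diff (UNIV - A) (- C) = sym_diff A C"
        by blast
      ultimately show "\<exists>C\<in>cylinders. measure M (sym_diff (UNIV - A) C) < \<epsilon>"
        by (metis cylinders_Compl)
    qed
  next
    case (union A)
    have A: "A i \<in> sets M" for i
      using union by (auto simp: sets_M)
    have fin: "\<forall>\<epsilon>>0. \<exists>C\<in>cylinders. measure M (sym_diff (\<Union>i<n. A i) C) < \<epsilon>" for n
    proof (induction n)
      case 0
      then show ?case by (auto intro!: bexI[of _ "{}"] cylinders_empty)
    next
      case (Suc n)
      show ?case
      proof (intro allI impI)
        fix \<epsilon> :: real assume "\<epsilon> > 0"
        then have "\<epsilon> / 2 > 0" by simp
        then obtain C D where C: "C \<in> cylinders" "measure M (sym_diff (\<Union>i<n. A i) C) < \<epsilon> / 2"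
          and D: "D \<in> cylinders" "measure M (sym_diff (A n) D) < \<epsilon> / 2"
          using Suc union by meson
        have "measure M (sym_diff (\<Union>i<Suc n. A i) (C \<union> D))
            \<le> measure M (sym_diff (\<Union>i<n. A i) C \<union> sym_diff (A n) D)"
          by (rule finite_measure_mono) (use A cyl C D in \<open>auto simp: less_Suc_eq\<close>)
        also have "\<dots> \<le> measure M (sym_diff (\<Union>i<n. A i) C) + measure M (sym_diff (A n) D)"
          by (rule measure_Un_le) (use A cyl C D in auto)
        also have "\<dots> < \<epsilon>"
          using C(2) D(2) by simp
        finally show "\<exists>C\<in>cylinders. measure M (sym_diff (\<Union>i<Suc n. A i) C) < \<epsilon>"
          using cylinders_Un C D by blast
      qed
    qed
    show ?case
    proof (intro allI impI)
      fix \<epsilon> :: real assume \<epsilon>: "\<epsilon> > 0"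
      have "(\<lambda>n. measure M (\<Union>i<n. A i)) \<longlonglongrightarrow> measure M (\<Union>n. \<Union>i<n. A i)"
        by (rule finite_Lim_measure_incseq)
           (use A in \<open>auto simp: incseq_def intro: order_less_le_trans\<close>)
      moreover have "(\<Union>n. \<Union>i<n. A i) = (\<Union>i. A i)"
        by auto
      ultimately obtain n where n: "\<bar>measure M (\<Union>i<n. A i) - measure M (\<Union>i. A i)\<bar> < \<epsilon> / 2"
        using \<epsilon> LIMSEQ_D[of _ _ "\<epsilon> / 2"] by (metis half_gt_zero le_refl real_norm_def)
      obtain C where C: "C \<in> cylinders" "measure M (sym_diff (\<Union>i<n. A i) C) < \<epsilon> / 2"
        using fin \<epsilon> half_gt_zero by blast
      have "measure M (sym_diff (\<Union>i. A i) C)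
          \<le> measure M (((\<Union>i. A i) - (\<Union>i<n. A i)) \<union> sym_diff (\<Union>i<n. A i) C)"
        by (rule finite_measure_mono) (use A cyl C in auto)
      also have "\<dots> \<le> measure M ((\<Union>i. A i) - (\<Union>i<n. A i)) + measure M (sym_diff (\<Union>i<n. A i) C)"
        by (rule measure_Un_le) (use A cyl C in auto)
      also have "measure M ((\<Union>i. A i) - (\<Union>i<n. A i)) = measure M (\<Union>i. A i) - measure M (\<Union>i<n. A i)"
        by (rule finite_measure_Diff) (use A in auto)
      finally have "measure M (sym_diff (\<Union>i. A i) C) < \<epsilon>"
        using n C(2) by linarith
      then show "\<exists>C\<in>cylinders. measure M (sym_diff (\<Union>(range A)) C) < \<epsilon>"
        using C(1) by blast
    qed
  qed
  with assms(5) show ?thesis by blast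
qed

section \<open>Translation operators\<close>

definition permute :: "('a \<Rightarrow> 'b) \<Rightarrow> 'b l2 \<Rightarrow> 'a l2"
  where "permute \<pi> v = Abs_l2 (\<lambda>n. coord v (\<pi> n))"

lemma coord_permute [simp]:
  assumes "bij \<pi>"
  shows "coord (permute \<pi> v) n = coord v (\<pi> n)"
proof -
  have "(\<lambda>n. coord v (\<pi> n)) \<in> ell2 UNIV"
    using summable_on_reindex_bij_betw[OF assms, of "\<lambda>n. (cmod (coord v n))\<^sup>2"]
    by (simp add: ell2_UNIV_iff coord_summable)
  then show ?thesis
    by (simp add: permute_def coord_Abs_l2)
qed

lemma inner_permute:
  assumes "bij \<pi>"
  shows "inner (permute \<pi> v) (permute \<pi> w) = inner v w"
  unfolding inner_l2_def coord_permute[OF assms]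
  using infsum_reindex_bij_betw[OF assms, of "\<lambda>n. Re (coord v n * cnj (coord w n))"] by simp

lemma linear_permute: "bij \<pi> \<Longrightarrow> linear (permute \<pi>)"
  by (intro linearI l2_eqI) simp_all

lemma permute_scaleC: "bij \<pi> \<Longrightarrow> permute \<pi> (scaleC c v) = scaleC c (permute \<pi> v)"
  by (intro l2_eqI) simp

definition conjugate :: "'a l2 \<Rightarrow> 'a l2"
  where "conjugate v = Abs_l2 (\<lambda>x. cnj (coord v x))"

lemma coord_conjugate [simp]: "coord (conjugate v) x = cnj (coord v x)"
  using coord[of v] by (simp add: conjugate_def coord_Abs_l2 ell2_UNIV_iff)

lemma inner_conjugate: "inner (conjugate v) (conjugate w) = inner v w"
  unfolding inner_l2_def by simp

lemma scaleC_zero: "scaleC c 0 = 0"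
  by (intro l2_eqI) simp

lemma coord_eqI_scaleC:
  assumes "\<And>c. inner v (scaleC c (delta a)) = inner w (scaleC c (delta b))"
  shows "coord v a = coord w b"
  unfolding coord_eq_inner using assms[of 1] assms[of \<i>] by simp

section \<open>Regular representations and the conjugation J on an enumerated group\<close>

locale enumerated_group = group G for G :: "('g, 'b) monoid_scheme" (structure) +
  fixes enum :: "nat \<Rightarrow> 'g"
  assumes bij_enum: "bij_betw enum UNIV (carrier G)"
begin

definition index :: "'g \<Rightarrow> nat"
  where "index = the_inv_into UNIV enum"

lemma enum_closed [simp]: "enum n \<in> carrier G"
  using bij_enum by (auto simp: bij_betw_def)

lemma index_enum [simp]: "index (enum n) = n"
  using bij_enum by (simp add: index_def the_inv_into_f_f bij_betw_def)

lemma enum_index [simp]: "x \<in> carrier G \<Longrightarrow> enum (index x) = x"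
  using bij_enum by (auto simp: index_def f_the_inv_into_f bij_betw_def)

lemma index_eq_iff [simp]: "x \<in> carrier G \<Longrightarrow> y \<in> carrier G \<Longrightarrow> index x = index y \<longleftrightarrow> x = y"
  by (metis enum_index)

definition entry :: "nat l2 \<Rightarrow> 'g \<Rightarrow> complex"
  where "entry v x = coord v (index x)"

lemma entry_eqI: "(\<And>x. x \<in> carrier G \<Longrightarrow> entry v x = entry w x) \<Longrightarrow> v = w"
  unfolding entry_def by (rule l2_eqI) (metis enum_closed index_enum)

definition left_index :: "'g \<Rightarrow> nat \<Rightarrow> nat"
  where "left_index g n = index (inv g \<otimes> enum n)"

definition right_index :: "'g \<Rightarrow> nat \<Rightarrow> nat"
  where "right_index g n = index (enum n \<otimes> g)"

definition inv_index :: "nat \<Rightarrow> nat"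
  where "inv_index n = index (inv (enum n))"

lemma bij_left_index: "g \<in> carrier G \<Longrightarrow> bij (left_index g)"
  by (rule bij_betw_byWitness[where f' = "left_index (inv g)"])
     (auto simp: left_index_def m_assoc[symmetric])

lemma bij_right_index: "g \<in> carrier G \<Longrightarrow> bij (right_index g)"
  by (rule bij_betw_byWitness[where f' = "right_index (inv g)"])
     (auto simp: right_index_def m_assoc)

lemma bij_inv_index: "bij inv_index"
  by (rule bij_betw_byWitness[where f' = inv_index]) (auto simp: inv_index_def)

definition left_op :: "'g \<Rightarrow> nat l2 \<Rightarrow> nat l2"
  where "left_op g = permute (left_index g)"

definition right_op :: "'g \<Rightarrow> nat l2 \<Rightarrow> nat l2"
  where "right_op g = permute (right_index g)"

text \<open>Tomita's conjugation J for the trace vector: antilinear, isometric, and exchanging left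
  with right translations. On vectors T delta_1 it reflects the passage from T to its adjoint,
  whence \<open>star_op_selfadjoint\<close>.\<close>

definition star_op :: "nat l2 \<Rightarrow> nat l2"
  where "star_op v = conjugate (permute inv_index v)"

definition unit_vec :: "nat l2"
  where "unit_vec = delta (index \<one>)"

definition point_vec :: "'g \<Rightarrow> nat l2"
  where "point_vec g = delta (index g)"

lemma entry_left_op: "g \<in> carrier G \<Longrightarrow> x \<in> carrier G \<Longrightarrow> entry (left_op g v) x = entry v (inv g \<otimes> x)"
  by (simp add: entry_def left_op_def bij_left_index left_index_def)

lemma entry_right_op: "g \<in> carrier G \<Longrightarrow> x \<in> carrier G \<Longrightarrow> entry (right_op g v) x = entry v (x \<otimes> g)"
  by (simp add: entry_def right_op_def bij_right_index right_index_def)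

lemma entry_star_op: "x \<in> carrier G \<Longrightarrow> entry (star_op v) x = cnj (entry v (inv x))"
  by (simp add: entry_def star_op_def bij_inv_index inv_index_def)

lemma entry_point_vec: "g \<in> carrier G \<Longrightarrow> x \<in> carrier G \<Longrightarrow> entry (point_vec g) x = (if x = g then 1 else 0)"
  by (simp add: entry_def point_vec_def)

lemma entry_scaleC: "entry (scaleC c v) x = c * entry v x"
  by (simp add: entry_def)

lemma entry_add: "entry (v + w) x = entry v x + entry w x"
  by (simp add: entry_def)

lemma linear_left_op: "g \<in> carrier G \<Longrightarrow> linear (left_op g)"
  by (simp add: left_op_def linear_permute bij_left_index)

lemma linear_right_op: "g \<in> carrier G \<Longrightarrow> linear (right_op g)"
  by (simp add: right_op_def linear_permute bij_right_index)

lemma inner_left_op: "g \<in> carrier G \<Longrightarrow> inner (left_op g v) (left_op g w) = inner v w"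
  by (simp add: left_op_def inner_permute bij_left_index)

lemma inner_right_op: "g \<in> carrier G \<Longrightarrow> inner (right_op g v) (right_op g w) = inner v w"
  by (simp add: right_op_def inner_permute bij_right_index)

lemma left_op_scaleC: "g \<in> carrier G \<Longrightarrow> left_op g (scaleC c v) = scaleC c (left_op g v)"
  by (simp add: left_op_def permute_scaleC bij_left_index)

lemma right_op_scaleC: "g \<in> carrier G \<Longrightarrow> right_op g (scaleC c v) = scaleC c (right_op g v)"
  by (simp add: right_op_def permute_scaleC bij_right_index)

lemma inner_star_op: "inner (star_op v) (star_op w) = inner v w"
  by (simp add: star_op_def inner_conjugate inner_permute bij_inv_index)

lemma star_op_scaleC: "star_op (scaleC c v) = scaleC (cnj c) (star_op v)"
  by (intro entry_eqI) (simp add: entry_star_op entry_scaleC)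

lemma left_op_inv [simp]:
  "g \<in> carrier G \<Longrightarrow> left_op g (left_op (inv g) v) = v"
  "g \<in> carrier G \<Longrightarrow> left_op (inv g) (left_op g v) = v"
  by (auto intro!: entry_eqI simp: entry_left_op m_assoc[symmetric])

lemma left_op_mult:
  "g \<in> carrier G \<Longrightarrow> h \<in> carrier G \<Longrightarrow> left_op g (left_op h v) = left_op (g \<otimes> h) v"
  by (intro entry_eqI) (simp add: entry_left_op m_assoc inv_mult_group)

lemma left_op_one [simp]: "left_op \<one> v = v"
  by (intro entry_eqI) (simp add: entry_left_op)

lemma right_op_inv [simp]:
  "g \<in> carrier G \<Longrightarrow> right_op g (right_op (inv g) v) = v"
  "g \<in> carrier G \<Longrightarrow> right_op (inv g) (right_op g v) = v"
  by (auto intro!: entry_eqI simp: entry_right_op m_assoc)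

lemma left_right_commute:
  "g \<in> carrier G \<Longrightarrow> h \<in> carrier G \<Longrightarrow> left_op g (right_op h v) = right_op h (left_op g v)"
  by (intro entry_eqI) (simp add: entry_left_op entry_right_op m_assoc)

lemma star_left_op: "g \<in> carrier G \<Longrightarrow> star_op (left_op g v) = right_op g (star_op v)"
  by (intro entry_eqI) (simp add: entry_star_op entry_left_op entry_right_op inv_mult_group)

lemma unit_vec_eq: "unit_vec = point_vec \<one>"
  by (simp add: unit_vec_def point_vec_def)

lemma left_op_point_vec: "g \<in> carrier G \<Longrightarrow> h \<in> carrier G \<Longrightarrow> left_op g (point_vec h) = point_vec (g \<otimes> h)"
  by (intro entry_eqI) (auto simp: entry_left_op entry_point_vec m_assoc[symmetric])

lemma right_op_point_vec: "g \<in> carrier G \<Longrightarrow> h \<in> carrier G \<Longrightarrow> right_op g (point_vec h) = point_vec (h \<otimes> inv g)"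
  by (intro entry_eqI) (auto simp: entry_right_op entry_point_vec m_assoc)

lemma norm_unit_vec [simp]: "norm unit_vec = 1"
  by (simp add: unit_vec_def)

lemma entry_eqI_inner:
  "(\<And>c. inner v (scaleC c (point_vec x)) = inner w (scaleC c (point_vec y))) \<Longrightarrow> entry v x = entry w y"
  unfolding entry_def point_vec_def by (rule coord_eqI_scaleC)

lemma entry_unit_inner: "entry v \<one> = Complex (inner v unit_vec) (inner v (scaleC \<i> unit_vec))"
  by (simp add: entry_def unit_vec_def coord_eq_inner)

lemma inner_right_op_left: "g \<in> carrier G \<Longrightarrow> inner (right_op g v) w = inner v (right_op (inv g) w)"
  using inner_right_op[of g v "right_op (inv g) w"] by simp

lemma inner_left_op_left: "g \<in> carrier G \<Longrightarrow> inner (left_op g v) w = inner v (left_op (inv g) w)"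
  using inner_left_op[of g v "left_op (inv g) w"] by simp

lemma inner_scaleC_right: "inner v (scaleC c w) = inner (scaleC (cnj c) v) w"
  by (simp add: inner_scaleC_left)

definition conj_op :: "'g \<Rightarrow> (nat l2 \<Rightarrow> nat l2) \<Rightarrow> nat l2 \<Rightarrow> nat l2"
  where "conj_op g T v = left_op g (T (left_op (inv g) v))"

text \<open>Operators that commute with right translations form the commutant of the right regular
  representation; the vector \<open>T \<delta>\<^sub>1\<close> then determines \<open>T\<close>, and \<open>\<langle>T \<delta>\<^sub>1, \<delta>\<^sub>1\<rangle>\<close> is the trace.\<close>

definition convolver :: "(nat l2 \<Rightarrow> nat l2) \<Rightarrow> bool"
  where "convolver T \<longleftrightarrow> linear T \<and> (\<forall>c v. T (scaleC c v) = scaleC c (T v)) \<and>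
    (\<forall>g\<in>carrier G. \<forall>v. T (right_op g v) = right_op g (T v))"

definition selfadjoint :: "(nat l2 \<Rightarrow> nat l2) \<Rightarrow> bool"
  where "selfadjoint T \<longleftrightarrow> (\<forall>v w. inner (T v) w = inner v (T w))"

lemma convolver_linear: "convolver T \<Longrightarrow> linear T"
  and convolver_scaleC: "convolver T \<Longrightarrow> T (scaleC c v) = scaleC c (T v)"
  and convolver_right_op: "convolver T \<Longrightarrow> g \<in> carrier G \<Longrightarrow> T (right_op g v) = right_op g (T v)"
  by (auto simp: convolver_def)

lemma selfadjointD: "selfadjoint T \<Longrightarrow> inner (T v) w = inner v (T w)"
  by (simp add: selfadjoint_def)

lemma convolver_point_vec:
  assumes "convolver T" "g \<in> carrier G"
  shows "T (point_vec g) = right_op (inv g) (T unit_vec)"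
proof -
  have "point_vec g = right_op (inv g) unit_vec"
    using assms(2) right_op_point_vec[of "inv g" \<one>] by (simp add: unit_vec_eq)
  then show ?thesis
    using assms by (simp add: convolver_right_op)
qed

text \<open>The unit vector is separating: T kills its right translates, hence every
  \<open>point_vec\<close>. Self-adjointness, in place of continuity, then shows that all
  coefficients of T v vanish.\<close>

lemma convolver_eq_zero:
  assumes "convolver T" "selfadjoint T" "T unit_vec = 0"
  shows "T v = 0"
proof (rule entry_eqI)
  fix x assume x: "x \<in> carrier G"
  have "T (point_vec x) = 0"
    using convolver_point_vec[OF assms(1) x] assms(3) x by (simp add: linear_0[OF linear_right_op])
  then have "T (scaleC c (point_vec x)) = 0" for c
    by (simp add: convolver_scaleC[OF assms(1)] scaleC_zero)
  then have "inner (T v) (scaleC c (point_vec x)) = inner 0 (scaleC c (point_vec x))" for c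
    by (simp add: selfadjointD[OF assms(2)])
  then show "entry (T v) x = entry 0 x"
    by (rule entry_eqI_inner)
qed

text \<open>Self-adjointness turns the coefficient of T delta_1 at x into a product of delta_1 with
  T delta_x, a right translate of T delta_1. Moving the translation to delta_1 gives J delta_x, so
  the coefficient reappears in J T delta_1.\<close>

lemma star_op_selfadjoint:
  assumes "convolver T" "selfadjoint T"
  shows "star_op (T unit_vec) = T unit_vec"
proof (rule entry_eqI)
  fix x assume x: "x \<in> carrier G"
  have "inner (T unit_vec) (scaleC c (point_vec x)) = inner (star_op (T unit_vec)) (scaleC c (point_vec x))" for c
  proof -
    have "inner (T unit_vec) (scaleC c (point_vec x)) = inner unit_vec (scaleC c (right_op (inv x) (T unit_vec)))"
      using assms x by (simp add: selfadjointD convolver_scaleC convolver_point_vec)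
    also have "\<dots> = inner (right_op x (scaleC (cnj c) unit_vec)) (T unit_vec)"
      using x by (simp add: inner_scaleC_right inner_right_op_left)
    also have "right_op x (scaleC (cnj c) unit_vec) = star_op (scaleC c (point_vec x))"
      using x by (intro entry_eqI) (auto simp: unit_vec_eq right_op_scaleC right_op_point_vec star_op_scaleC
          entry_scaleC entry_star_op entry_point_vec)
    also have "inner (star_op (scaleC c (point_vec x))) (T unit_vec) = inner (star_op (T unit_vec)) (scaleC c (point_vec x))"
    proof -
      have "star_op (star_op v) = v" for v
        by (intro entry_eqI) (simp add: entry_star_op)
      then show ?thesis
        by (metis inner_commute inner_star_op)
    qed
    finally show ?thesis .
  qed
  then show "entry (star_op (T unit_vec)) x = entry (T unit_vec) x"
    by (metis entry_eqI_inner)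
qed

text \<open>This is the trace identity \<open>\<tau>(T S \<lambda>(g)\<^sup>*) = \<tau>(\<sigma>\<^sub>g(S) T \<lambda>(g)\<^sup>*)\<close>.\<close>

lemma trace_identity:
  assumes T: "convolver T" "selfadjoint T" and S: "convolver S" "selfadjoint S" and g: "g \<in> carrier G"
  shows "entry (T (S unit_vec)) g = entry (conj_op g S (T unit_vec)) g"
proof (rule entry_eqI_inner)
  fix c
  let ?t = "T unit_vec" and ?s = "S unit_vec"
  have "inner (T (S unit_vec)) (scaleC c (point_vec g)) = inner ?s (scaleC c (right_op (inv g) ?t))"
    using T g by (simp add: selfadjointD convolver_scaleC convolver_point_vec)
  also have "\<dots> = inner (right_op g (scaleC (cnj c) ?s)) ?t"
    using g by (simp add: inner_scaleC_right inner_right_op_left)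
  \<comment> \<open>J fixes \<open>?s\<close>, so it trades the right translation for a left one. In
    the next step it also fixes \<open>?t\<close> and drops out of the product. This exchange plays
    the role of traciality.\<close>
  also have "right_op g (scaleC (cnj c) ?s) = star_op (left_op g (scaleC c ?s))"
    using g by (simp add: star_left_op star_op_scaleC star_op_selfadjoint[OF S])
  also have "inner \<dots> ?t = inner (left_op g (scaleC c ?s)) ?t"
    by (metis inner_star_op star_op_selfadjoint[OF T])
  also have "\<dots> = inner (conj_op g S ?t) (scaleC c (point_vec g))"
  proof -
    have "left_op (inv g) (scaleC c (point_vec g)) = scaleC c unit_vec"
      using g by (simp add: left_op_scaleC left_op_point_vec unit_vec_eq)
    then have "inner (conj_op g S ?t) (scaleC c (point_vec g)) = inner (left_op (inv g) ?t) (S (scaleC c unit_vec))"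
      using g S by (simp add: conj_op_def inner_left_op_left selfadjointD)
    also have "\<dots> = inner ?t (left_op g (scaleC c ?s))"
      using g S inner_left_op_left[of "inv g" ?t] by (simp add: convolver_scaleC left_op_scaleC)
    finally show ?thesis
      by (simp add: inner_commute)
  qed
  finally show "inner (T (S unit_vec)) (scaleC c (point_vec g)) = inner (conj_op g S ?t) (scaleC c (point_vec g))" .
qed

text \<open>On vectors T delta_1 this is conjugation of T, by \<open>conj_op_unit_vec\<close>.
  Unlike \<open>conj_op\<close> it also applies to vectors not known to come from an operator, such
  as the limit in the proof of ergodicity.\<close>

definition conj_vec :: "'g \<Rightarrow> nat l2 \<Rightarrow> nat l2"
  where "conj_vec g v = left_op g (right_op g v)"

lemma entry_conj_vec: "g \<in> carrier G \<Longrightarrow> x \<in> carrier G \<Longrightarrow> entry (conj_vec g v) x = entry v (inv g \<otimes> x \<otimes> g)"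
  by (simp add: conj_vec_def entry_left_op entry_right_op)

lemma linear_conj_vec: "g \<in> carrier G \<Longrightarrow> linear (conj_vec g)"
  unfolding conj_vec_def using linear_compose[OF linear_right_op linear_left_op, of g g] by (simp add: o_def)

lemma norm_conj_vec: "g \<in> carrier G \<Longrightarrow> norm (conj_vec g v) = norm v"
  by (simp add: conj_vec_def norm_eq_sqrt_inner inner_left_op inner_right_op)

lemma conj_op_unit_vec:
  assumes "convolver T" "g \<in> carrier G"
  shows "conj_op g T unit_vec = conj_vec g (T unit_vec)"
  using assms convolver_point_vec[of T "inv g"]
  by (simp add: conj_op_def conj_vec_def unit_vec_eq left_op_point_vec)

text \<open>The entries of v are constant on each conjugacy class, and a square-summable function
  that is constant on an infinite set vanishes there.\<close>

lemma conj_invariant_vec: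
  assumes icc: "\<And>h. h \<in> carrier G \<Longrightarrow> h \<noteq> \<one> \<Longrightarrow> infinite {g \<otimes> h \<otimes> inv g | g. g \<in> carrier G}"
    and inv: "\<And>g. g \<in> carrier G \<Longrightarrow> conj_vec g v = v"
  shows "v = scaleC (entry v \<one>) unit_vec"
proof (rule entry_eqI)
  fix h assume h: "h \<in> carrier G"
  show "entry v h = entry (scaleC (entry v \<one>) unit_vec) h"
  proof (cases "h = \<one>")
    case True
    then show ?thesis by (simp add: entry_scaleC unit_vec_eq entry_point_vec)
  next
    case False
    let ?C = "{g \<otimes> h \<otimes> inv g | g. g \<in> carrier G}"
    have const: "entry v x = entry v h" if x: "x \<in> ?C" for x
    proof -
      obtain g where g: "g \<in> carrier G" "x = g \<otimes> h \<otimes> inv g"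
        using x by blast
      have "inv g \<otimes> x \<otimes> g = (inv g \<otimes> g) \<otimes> h \<otimes> (inv g \<otimes> g)"
        unfolding g(2) by (simp only: m_assoc m_closed inv_closed g(1) h)
      then have "entry (conj_vec g v) x = entry v h"
        unfolding entry_conj_vec[OF g(1) m_closed[OF m_closed[OF g(1) h] inv_closed[OF g(1)]], folded g(2)]
        using g(1) h by simp
      then show ?thesis
        using inv[OF g(1)] by simp
    qed
    have "entry v h = 0"
    proof (rule ccontr)
      assume "entry v h \<noteq> 0"
      then have pos: "(cmod (entry v h))\<^sup>2 > 0" by simp
      obtain n :: nat where n: "(norm v)\<^sup>2 < real n * (cmod (entry v h))\<^sup>2"
        using pos reals_Archimedean3 by blast
      obtain F where F: "finite F" "card F = n" "F \<subseteq> ?C"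
        using infinite_arbitrarily_large[OF icc[OF h False], of n] by (elim exE conjE) (rule that)
      have carr: "?C \<subseteq> carrier G"
        using h by auto
      have inj: "inj_on index F"
        by (rule inj_on_subset[OF _ subset_trans[OF F(3) carr]]) (auto intro: inj_onI)
      have "(\<Sum>n\<in>index ` F. (cmod (coord v n))\<^sup>2) = (\<Sum>x\<in>F. (cmod (entry v x))\<^sup>2)"
        by (simp add: sum.reindex[OF inj] entry_def)
      also have "\<dots> = (\<Sum>x\<in>F. (cmod (entry v h))\<^sup>2)"
        by (rule sum.cong[OF refl]) (simp only: const[OF subsetD[OF F(3)]])
      also have "\<dots> = real n * (cmod (entry v h))\<^sup>2"
        using F(2) by simp
      finally show False
        using sum_cmod_coord_le[of "index ` F" v] F(1) n by simp
    qed
    then show ?thesis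
      using False h by (simp add: entry_scaleC unit_vec_eq entry_point_vec)
  qed
qed

end

section \<open>Commutative conjugation-invariant algebras\<close>

text \<open>The properties of the center that the dynamical argument consumes. The sign polynomials
  are uniformly contractive and have real coefficients, which is why closure is stated for limits of
  contractions and for real scalars. Adjoints are avoided by treating self-adjoint elements
  only.\<close>

locale invariant_center = enumerated_group G enum for G :: "('g, 'b) monoid_scheme" (structure) and enum +
  fixes Z :: "(nat l2 \<Rightarrow> nat l2) set"
  assumes Z_convolver: "T \<in> Z \<Longrightarrow> convolver T"
    and Z_bounded: "T \<in> Z \<Longrightarrow> \<exists>K. \<forall>v. norm (T v) \<le> K * norm v"
    and Z_commute: "T \<in> Z \<Longrightarrow> S \<in> Z \<Longrightarrow> T (S v) = S (T v)"
    and Z_id: "(\<lambda>v. v) \<in> Z"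
    and Z_add: "T \<in> Z \<Longrightarrow> S \<in> Z \<Longrightarrow> (\<lambda>v. T v + S v) \<in> Z"
    and Z_scaleR: "T \<in> Z \<Longrightarrow> (\<lambda>v. r *\<^sub>R T v) \<in> Z"
    and Z_comp: "T \<in> Z \<Longrightarrow> S \<in> Z \<Longrightarrow> (\<lambda>v. T (S v)) \<in> Z"
    and Z_lim: "(\<And>n. Ts n \<in> Z) \<Longrightarrow> (\<And>n v. norm (Ts n v) \<le> norm v) \<Longrightarrow>
      (\<And>v. (\<lambda>n. Ts n v) \<longlonglongrightarrow> T v) \<Longrightarrow> T \<in> Z"
    and Z_conj: "g \<in> carrier G \<Longrightarrow> T \<in> Z \<Longrightarrow> conj_op g T \<in> Z"
    and icc: "h \<in> carrier G \<Longrightarrow> h \<noteq> \<one> \<Longrightarrow> infinite {g \<otimes> h \<otimes> inv g | g. g \<in> carrier G}"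
    and simple: "N \<lhd> G \<Longrightarrow> N = carrier G \<or> N = {\<one>}"
    and free: "\<And>(M :: real measure) (\<phi> :: 'g \<Rightarrow> real \<Rightarrow> real).
           standard_prob_space M \<Longrightarrow> pmp_action G M \<phi> \<Longrightarrow> ergodic_action G M \<phi> \<Longrightarrow>
           ae_faithful_action G M \<phi> \<Longrightarrow> essentially_free_action G M \<phi>"
begin

lemma Z_linear: "T \<in> Z \<Longrightarrow> linear T"
  by (rule convolver_linear[OF Z_convolver])

lemma Z_diff: "T \<in> Z \<Longrightarrow> S \<in> Z \<Longrightarrow> (\<lambda>v. T v - S v) \<in> Z"
  using Z_add[of T "\<lambda>v. (- 1) *\<^sub>R S v"] Z_scaleR[of S "- 1"] by simp

lemma Z_zero: "(\<lambda>v. 0) \<in> Z"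
  using Z_scaleR[OF Z_id, of 0] by simp

text \<open>Idempotence forces c^2 = c, so p or 1 - p kills the unit vector, which is
  separating.\<close>

lemma scalar_projection_trivial:
  assumes "p \<in> Z" "selfadjoint p" "\<And>v. p (p v) = p v" "p unit_vec = scaleC c unit_vec"
  shows "(\<forall>v. p v = 0) \<or> (\<forall>v. p v = v)"
proof -
  have "scaleC (c * c) unit_vec = scaleC c unit_vec"
    using assms(3)[of unit_vec] convolver_scaleC[OF Z_convolver[OF assms(1)], of c unit_vec] assms(4) by simp
  then have "entry (scaleC (c * c) unit_vec) \<one> = entry (scaleC c unit_vec) \<one>"
    by simp
  then have "c * c = c"
    by (simp add: entry_scaleC unit_vec_eq entry_point_vec)
  then consider "c = 0" | "c = 1"
    by auto
  then show ?thesis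
  proof cases
    case 1
    then have "p unit_vec = 0"
      using assms(4) by (intro l2_eqI) simp
    then show ?thesis
      using convolver_eq_zero[OF Z_convolver] assms(1,2) by blast
  next
    case 2
    let ?q = "\<lambda>v. v - p v"
    have "convolver ?q"
      by (intro Z_convolver Z_diff Z_id assms)
    moreover have "selfadjoint ?q"
      using assms(2) by (simp add: selfadjoint_def inner_diff_left inner_diff_right)
    moreover have "?q unit_vec = 0"
      using assms(4) 2 by simp
    ultimately have "?q v = 0" for v
      by (rule convolver_eq_zero)
    then show ?thesis by simp
  qed
qed

end

section \<open>The shift system generated by one projection\<close>

locale invariant_projection = invariant_center +
  fixes p
  assumes p_Z: "p \<in> Z" and selfadjoint_p: "selfadjoint p" and idem_p: "p (p v) = p v"
begin

definition translate :: "nat \<Rightarrow> nat l2 \<Rightarrow> nat l2"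
  where "translate n = conj_op (enum n) p"

lemma translate_Z: "translate n \<in> Z"
  unfolding translate_def by (intro Z_conj p_Z) simp

sublocale commuting_projections translate
proof (rule commuting_projections.intro)
  show "linear (translate n)" for n
    by (rule Z_linear[OF translate_Z])
  show "translate n (translate n v) = translate n v" for n v
    by (simp add: translate_def conj_op_def idem_p)
  show "inner (translate n v) w = inner v (translate n w)" for n v w
    using selfadjoint_p inner_left_op_left[of "enum n"] inner_left_op_left[of "inv (enum n)" v]
    by (simp add: translate_def conj_op_def selfadjoint_def)
  show "translate m (translate n v) = translate n (translate m v)" for m n v
    by (intro Z_commute translate_Z)
qed

text \<open>The left Bernoulli shift (g x)(h) = x(inv g h) on {0,1}^Gamma, written in enumerated
  coordinates.\<close>

definition shift :: "'a \<Rightarrow> (nat \<Rightarrow> bool) \<Rightarrow> nat \<Rightarrow> bool"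
  where "shift g x n = x (left_index g n)"

lemma shift_mult: "g \<in> carrier G \<Longrightarrow> h \<in> carrier G \<Longrightarrow> shift (g \<otimes> h) x = shift g (shift h x)"
  by (auto simp: shift_def left_index_def inv_mult_group m_assoc fun_eq_iff)

lemma shift_one: "shift \<one> x = x"
  by (simp add: shift_def left_index_def fun_eq_iff)

lemma shift_vimage_coordinate: "shift g -` {x. x n} = {x. x (left_index g n)}"
  by (auto simp: shift_def)

lemma shift_cylinders: "A \<in> cylinders \<Longrightarrow> shift g -` A \<in> cylinders"
proof (induction rule: cylinders_induct)
  case (coordinate n)
  show ?case
    unfolding shift_vimage_coordinate by (rule coordinate_cylinder)
qed (simp_all add: vimage_Compl cylinders_Compl cylinders_Int)

lemma proj_Z: "A \<in> cylinders \<Longrightarrow> proj A \<in> Z"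
proof (induction rule: cylinders_induct)
  case (coordinate n)
  have "proj {x. x n} = translate n"
    by (rule ext) (rule proj_coordinate)
  then show ?case
    by (simp add: translate_Z)
next
  case (Compl A)
  then have "proj (- A) = (\<lambda>v. v - proj A v)"
    by (intro ext proj_Compl)
  then show ?case
    using Compl by (simp add: Z_diff Z_id)
next
  case (Int A B)
  then have "proj (A \<inter> B) = (\<lambda>v. proj A (proj B v))"
    by (intro ext proj_Int)
  then show ?case
    using Int by (simp add: Z_comp)
qed

lemma convolver_proj: "A \<in> cylinders \<Longrightarrow> convolver (proj A)"
  by (intro Z_convolver proj_Z)

lemma selfadjoint_op_proj: "selfadjoint (proj A)"
  by (simp add: selfadjoint_def selfadjoint_proj)

lemma conj_op_translate: "g \<in> carrier G \<Longrightarrow> conj_op g (translate n) v = translate (left_index (inv g) n) v"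
  by (simp add: conj_op_def translate_def left_index_def left_op_mult inv_mult_group)

text \<open>Conjugation by g sends the translate of p at h to the translate at g h. On events this
  is the preimage under the shift by \<open>inv g\<close>, as preimages reverse the
  direction.\<close>

lemma proj_shift:
  assumes "A \<in> cylinders" "g \<in> carrier G"
  shows "proj (shift (inv g) -` A) v = conj_op g (proj A) v"
  using assms(1)
proof (induction arbitrary: v rule: cylinders_induct)
  case (coordinate n)
  show ?case
    using conj_op_translate[OF assms(2), of n v]
    unfolding shift_vimage_coordinate proj_coordinate conj_op_def by simp
next
  case (Compl A)
  then show ?case
    using assms(2) by (simp add: vimage_Compl proj_Compl shift_cylinders conj_op_def linear_diff[OF linear_left_op])
next
  case (Int A B)
  then show ?case
    using assms(2) by (simp add: proj_Int shift_cylinders conj_op_def)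
qed

lemma proj_shift_unit_vec:
  assumes "A \<in> cylinders" "g \<in> carrier G"
  shows "proj (shift (inv g) -` A) unit_vec = conj_vec g (proj A unit_vec)"
  using assms by (simp add: proj_shift conj_op_unit_vec convolver_proj)

definition law :: "(nat \<Rightarrow> bool) measure"
  where "law = (SOME M. space M = UNIV \<and> sets M = sigma_sets UNIV cylinders \<and>
       (\<forall>A\<in>cylinders. emeasure M A = ennreal ((norm (proj A unit_vec))\<^sup>2)))"

lemma law_properties:
  "space law = UNIV" "sets law = sigma_sets UNIV cylinders"
  "A \<in> cylinders \<Longrightarrow> emeasure law A = ennreal ((norm (proj A unit_vec))\<^sup>2)"
  using someI_ex[OF ex_cylinder_measure[of unit_vec], folded law_def] by auto

lemma measure_law: "A \<in> cylinders \<Longrightarrow> measure law A = (norm (proj A unit_vec))\<^sup>2"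
  by (simp add: measure_def law_properties)

lemma cylinders_sets_law: "A \<in> cylinders \<Longrightarrow> A \<in> sets law"
  by (simp add: law_properties sigma_sets.Basic)

lemma prob_space_law: "prob_space law"
  by standard (simp add: law_properties cylinders_UNIV proj_UNIV)

lemma shift_measurable: "shift g \<in> law \<rightarrow>\<^sub>M law"
  by (rule measurable_sigma_sets[OF law_properties(2)])
     (auto simp: law_properties(1) intro: cylinders_sets_law shift_cylinders)

lemma shift_distr:
  assumes "g \<in> carrier G"
  shows "distr law law (shift g) = law"
proof (rule measure_eqI_generator_eq[where E = cylinders and \<Omega> = UNIV and A = "\<lambda>_. UNIV"])
  show "emeasure (distr law law (shift g)) A = emeasure law A" if A: "A \<in> cylinders" for A
  proof -
    have "emeasure (distr law law (shift g)) A = emeasure law (shift (inv (inv g)) -` A)"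
      using A assms by (simp add: emeasure_distr shift_measurable cylinders_sets_law law_properties(1))
    also have "\<dots> = emeasure law A"
      using A assms shift_cylinders[OF A, of g] proj_shift_unit_vec[OF A, of "inv g"]
      by (simp add: law_properties(3) norm_conj_vec)
    finally show ?thesis .
  qed
qed (simp_all add: law_properties(2,3) Int_stable_def cylinders_Int cylinders_UNIV
      emeasure_distr shift_measurable law_properties(1))

sublocale Cantor_action G law shift
  by (intro Cantor_action.intro Cantor_action_axioms.intro is_group prob_space_law law_properties(1,2)
      shift_mult shift_one shift_measurable shift_distr)

lemma norm_proj_sym_diff:
  "A \<in> cylinders \<Longrightarrow> B \<in> cylinders \<Longrightarrow>
    (norm (proj A unit_vec - proj B unit_vec))\<^sup>2 = measure law (sym_diff A B)"
  by (simp add: norm_proj_diff measure_law cylinders_Un cylinders_Diff)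

text \<open>As \<open>proj\<close> represents cylinders only, the vector that A should give is built
  as a limit of vectors of approximating cylinders. The limit is fixed by conjugation, hence equals
  c delta_1, and comparing its norm with its trace makes the measure of A idempotent.\<close>

lemma shift_ergodic:
  assumes A: "A \<in> sets law" and inv: "\<And>g. g \<in> carrier G \<Longrightarrow> shift g ` A = A"
  shows "measure law A = 0 \<or> measure law A = 1"
proof -
  interpret prob_space law by (rule prob_space_law)
  let ?\<mu> = "measure law"
  have "\<exists>C\<in>cylinders. ?\<mu> (sym_diff A C) < 1 / real (Suc k)" for k
    by (rule cylinder_approximation[OF prob_space_law law_properties(1,2) A]) simp
  then obtain C where C: "\<And>k. C k \<in> cylinders" "\<And>k. ?\<mu> (sym_diff A (C k)) < 1 / real (Suc k)"
    by metis
  note C_sets = cylinders_sets_law[OF C(1)]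
  define d where "d k = ?\<mu> (sym_diff A (C k))" for k
  define \<xi> where "\<xi> k = proj (C k) unit_vec" for k
  have d_lim: "d \<longlonglongrightarrow> 0"
  proof (rule tendsto_sandwich[OF _ _ tendsto_const LIMSEQ_inverse_real_of_nat])
    show "\<forall>\<^sub>F n in sequentially. d n \<le> inverse (real (Suc n))"
      using C(2) by (auto simp: d_def inverse_eq_divide intro!: always_eventually less_imp_le)
  qed (simp add: d_def)
  have dist: "(norm (\<xi> k - \<xi> l))\<^sup>2 \<le> d k + d l" for k l
  proof -
    have "(norm (\<xi> k - \<xi> l))\<^sup>2 = ?\<mu> (sym_diff (C k) (C l))"
      unfolding \<xi>_def by (intro norm_proj_sym_diff C)
    also have "\<dots> \<le> ?\<mu> (sym_diff A (C k) \<union> sym_diff A (C l))"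
      by (rule finite_measure_mono) (use A C_sets in auto)
    also have "\<dots> \<le> d k + d l"
      unfolding d_def by (rule measure_Un_le) (use A C_sets in auto)
    finally show ?thesis .
  qed
  have "Cauchy \<xi>"
  proof (rule metric_CauchyI)
    fix e :: real assume e: "e > 0"
    then have "e\<^sup>2 / 2 > 0" by simp
    then obtain N where N: "\<And>k. k \<ge> N \<Longrightarrow> d k < e\<^sup>2 / 2"
      using order_tendstoD(2)[OF d_lim] unfolding eventually_sequentially by blast
    have "dist (\<xi> m) (\<xi> n) < e" if "m \<ge> N" "n \<ge> N" for m n
    proof -
      have "(norm (\<xi> m - \<xi> n))\<^sup>2 < e\<^sup>2"
        using dist[of m n] N[OF that(1)] N[OF that(2)] by simp
      then show ?thesis
        using e by (simp add: dist_norm power2_less_imp_less)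
    qed
    then show "\<exists>M. \<forall>m\<ge>M. \<forall>n\<ge>M. dist (\<xi> m) (\<xi> n) < e"
      by blast
  qed
  then obtain \<eta> where \<eta>: "\<xi> \<longlonglongrightarrow> \<eta>"
    using Cauchy_convergent convergent_def by blast
  have "conj_vec g \<eta> = \<eta>" if g: "g \<in> carrier G" for g
  proof -
    have pre: "shift (inv g) -` A = A"
    proof -
      have "shift (inv g) -` A = shift g ` A"
        using act_inv[OF g] by (auto simp: image_iff) metis
      then show ?thesis
        using inv[OF g] by simp
    qed
    \<comment> \<open>Both C k and its shift are within d k of the invariant set A, the latter
      because the shift preserves the measure.\<close>
    have bound: "(norm (conj_vec g (\<xi> k) - \<xi> k))\<^sup>2 \<le> d k + d k" for k
    proof -
      have "(norm (conj_vec g (\<xi> k) - \<xi> k))\<^sup>2 = ?\<mu> (sym_diff (shift (inv g) -` C k) (C k))"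
        unfolding \<xi>_def proj_shift_unit_vec[OF C(1) g, symmetric]
        by (intro norm_proj_sym_diff shift_cylinders C)
      also have "\<dots> \<le> ?\<mu> (shift (inv g) -` (sym_diff A (C k)) \<union> sym_diff A (C k))"
      proof (rule finite_measure_mono)
        show "sym_diff (shift (inv g) -` C k) (C k) \<subseteq> shift (inv g) -` (sym_diff A (C k)) \<union> sym_diff A (C k)"
          using pre by auto
        show "shift (inv g) -` (sym_diff A (C k)) \<union> sym_diff A (C k) \<in> sets law"
          using A C_sets measurable_sets[OF shift_measurable, of "sym_diff A (C k)" "inv g"]
          by (auto simp: law_properties(1))
      qed
      also have "\<dots> \<le> ?\<mu> (shift (inv g) -` (sym_diff A (C k))) + d k"
        unfolding d_def
        using A C_sets measurable_sets[OF shift_measurable, of "sym_diff A (C k)" "inv g"]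
        by (intro measure_Un_le) (auto simp: law_properties(1))
      also have "?\<mu> (shift (inv g) -` (sym_diff A (C k))) = measure (distr law law (shift (inv g))) (sym_diff A (C k))"
        using A C_sets by (subst measure_distr[OF shift_measurable]) (auto simp: law_properties(1))
      also have "\<dots> = d k"
        using g by (simp add: shift_distr d_def)
      finally show ?thesis .
    qed
    have "(\<lambda>k. (norm (conj_vec g (\<xi> k) - \<xi> k))\<^sup>2) \<longlonglongrightarrow> 0"
    proof (rule tendsto_sandwich[OF _ _ tendsto_const])
      show "(\<lambda>k. d k + d k) \<longlonglongrightarrow> 0"
        using tendsto_add[OF d_lim d_lim] by simp
    qed (use bound in auto)
    moreover have "(\<lambda>k. (norm (conj_vec g (\<xi> k) - \<xi> k))\<^sup>2) \<longlonglongrightarrow> (norm (conj_vec g \<eta> - \<eta>))\<^sup>2"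
    proof (intro tendsto_intros \<eta>)
      have "bounded_linear (conj_vec g)"
        by (rule bounded_linear_intro[where K = 1])
           (simp_all add: linear_add[OF linear_conj_vec[OF g]] linear_cmul[OF linear_conj_vec[OF g]] norm_conj_vec g)
      then show "(\<lambda>k. conj_vec g (\<xi> k)) \<longlonglongrightarrow> conj_vec g \<eta>"
        using \<eta> by (rule bounded_linear.tendsto)
    qed
    ultimately have "(norm (conj_vec g \<eta> - \<eta>))\<^sup>2 = 0"
      using LIMSEQ_unique by blast
    then show ?thesis by simp
  qed
  then have \<eta>_eq: "\<eta> = scaleC (entry \<eta> \<one>) unit_vec"
    by (intro conj_invariant_vec icc)
  have norm_lim: "(\<lambda>k. (norm (\<xi> k))\<^sup>2) \<longlonglongrightarrow> ?\<mu> A"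
  proof (rule LIM_zero_cancel, rule Lim_null_comparison[OF _ d_lim], rule always_eventually, rule allI)
    fix k
    have "?\<mu> (C k) \<le> ?\<mu> (A \<union> sym_diff A (C k))" "?\<mu> A \<le> ?\<mu> (C k \<union> sym_diff A (C k))"
      by (rule finite_measure_mono; use A C_sets in auto)+
    moreover have "?\<mu> (A \<union> sym_diff A (C k)) \<le> ?\<mu> A + d k" "?\<mu> (C k \<union> sym_diff A (C k)) \<le> ?\<mu> (C k) + d k"
      unfolding d_def by (rule measure_Un_le; use A C_sets in auto)+
    ultimately show "norm ((norm (\<xi> k))\<^sup>2 - ?\<mu> A) \<le> d k"
      by (simp add: \<xi>_def measure_law[OF C(1), symmetric])
  qed
  have "(norm \<eta>)\<^sup>2 = ?\<mu> A"
    using tendsto_power[OF tendsto_norm[OF \<eta>], of 2] norm_lim by (rule LIMSEQ_unique)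
  \<comment> \<open>For a projection, trace and squared norm of the vector agree. So c has real part
    equal to the measure m of A, while |c|^2 = m; once c is known to be real, m^2 = m.\<close>
  moreover have "inner \<eta> unit_vec = ?\<mu> A"
  proof -
    have "inner (\<xi> k) unit_vec = (norm (\<xi> k))\<^sup>2" for k
      using inner_proj_proj[OF C(1) cylinders_UNIV, where v = unit_vec] by (simp add: \<xi>_def proj_UNIV)
    then show ?thesis
      using tendsto_inner[OF \<eta> tendsto_const[of unit_vec]] norm_lim by (simp add: LIMSEQ_unique)
  qed
  \<comment> \<open>The trace of a self-adjoint operator is real: J fixes its vector, and at the
    identity J is complex conjugation.\<close>
  moreover have "inner \<eta> (scaleC \<i> unit_vec) = 0"
  proof -
    have "inner (\<xi> k) (scaleC \<i> unit_vec) = 0" for k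
    proof -
      have "entry (star_op (\<xi> k)) \<one> = entry (\<xi> k) \<one>"
        unfolding \<xi>_def by (simp only: star_op_selfadjoint convolver_proj C selfadjoint_op_proj)
      then have "Im (entry (\<xi> k) \<one>) = 0"
        by (simp add: entry_star_op complex_eq_iff)
      then show ?thesis
        by (simp add: entry_unit_inner)
    qed
    then show ?thesis
      using tendsto_inner[OF \<eta> tendsto_const[of "scaleC \<i> unit_vec"]] by (simp add: LIMSEQ_const_iff)
  qed
  ultimately have "entry \<eta> \<one> = of_real (?\<mu> A)" "(norm \<eta>)\<^sup>2 = ?\<mu> A"
    by (simp_all add: entry_unit_inner complex_eq_iff)
  moreover have "norm \<eta> = cmod (entry \<eta> \<one>)"
    by (subst \<eta>_eq) (simp add: norm_scaleC)
  ultimately have "(?\<mu> A)\<^sup>2 = ?\<mu> A"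
    by simp
  then show ?thesis
    by (simp add: power2_eq_square)
qed

lemma proj_index_one: "proj {x. x (index \<one>)} v = p v"
  by (simp add: proj_coordinate translate_def conj_op_def)

text \<open>The event represented by p differs from each of its shifts by a null set, and the
  isometry turns this into equality of vectors.\<close>

lemma proj_unit_vec_scalar_trivial:
  assumes "\<And>g. g \<in> carrier G \<Longrightarrow> AE x in law. shift g x = x"
  shows "p unit_vec = scaleC (entry (p unit_vec) \<one>) unit_vec"
proof (rule conj_invariant_vec[OF icc])
  fix g assume g: "g \<in> carrier G"
  let ?C = "{x. x (index \<one>)}"
  have C: "?C \<in> cylinders" by (rule coordinate_cylinder)
  let ?D = "sym_diff (shift (inv g) -` ?C) ?C"
  have "AE x in law. x \<notin> ?D"
    using assms[OF inv_closed[OF g]] by eventually_elim simp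
  moreover have "?D \<in> sets law"
    by (intro cylinders_sets_law cylinders_Un cylinders_Diff shift_cylinders C)
  ultimately have "?D \<in> null_sets law"
    using AE_iff_null_sets by blast
  then have "measure law ?D = 0"
    by (rule measure_eq_0_null_sets)
  then have "(norm (conj_vec g (p unit_vec) - p unit_vec))\<^sup>2 = 0"
    using norm_proj_sym_diff[OF shift_cylinders[OF C] C, of "inv g"] proj_shift_unit_vec[OF C g]
    by (simp add: proj_index_one)
  then show "conj_vec g (p unit_vec) = p unit_vec"
    by simp
qed

text \<open>By the trace identity, the complex measure \<open>B \<mapsto> \<langle>proj B \<delta>\<^sub>1, \<delta>\<^sub>g\<rangle>\<close> does not see points
  moved by \<open>g\<close>.\<close>

lemma entry_proj_free:
  assumes g: "g \<in> carrier G" and null: "{x. shift g x = x} \<in> null_sets law" and B: "B \<in> cylinders"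
  shows "entry (proj B unit_vec) g = 0"
proof -
  interpret prob_space law by (rule prob_space_law)
  let ?\<pi> = "left_index (inv g)"
  define \<nu> where "\<nu> A = entry (proj A unit_vec) g" for A
  define X where "X n = {x :: nat \<Rightarrow> bool. x n}" for n
  have X: "X n \<in> cylinders" for n
    unfolding X_def by (rule coordinate_cylinder)
  note cyl = X cylinders_Int cylinders_Un cylinders_Compl cylinders_Diff
  have \<nu>_Un: "\<nu> (A \<union> A') = \<nu> A + \<nu> A'" if "A \<in> cylinders" "A' \<in> cylinders" "A \<inter> A' = {}" for A A'
    using that by (simp add: \<nu>_def proj_Un_disjoint entry_add)
  have \<nu>_empty: "\<nu> {} = 0"
    by (simp add: \<nu>_def proj_empty entry_def)
  \<comment> \<open>The trace identity for the translate of p at m: conjugation by g carries it to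
    the one at \<open>?\<pi> m\<close>.\<close>
  have \<nu>_trace: "\<nu> (A \<inter> X m) = \<nu> (A \<inter> X (?\<pi> m))" if A: "A \<in> cylinders" for A m
  proof -
    have XP: "proj (A \<inter> X k) unit_vec = translate k (proj A unit_vec)" for k
      using proj_Int[OF X A, of k] by (simp add: X_def proj_coordinate Int_commute)
    have "\<nu> (A \<inter> X m) = entry (proj A (translate m unit_vec)) g"
      unfolding \<nu>_def XP by (simp only: Z_commute[OF translate_Z proj_Z[OF A]])
    also have "\<dots> = entry (conj_op g (translate m) (proj A unit_vec)) g"
      using A g by (intro trace_identity convolver_proj selfadjoint_op_proj Z_convolver translate_Z)
        (auto simp: selfadjoint_def selfadjoint_P)
    also have "\<dots> = \<nu> (A \<inter> X (?\<pi> m))"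
      unfolding \<nu>_def XP by (simp add: conj_op_translate g)
    finally show ?thesis .
  qed
  define E where "E n = {x :: nat \<Rightarrow> bool. x n = x (?\<pi> n)}" for n
  have E_eq: "E n = (X n \<inter> X (?\<pi> n)) \<union> (- X n \<inter> - X (?\<pi> n))" for n
    by (auto simp: E_def X_def)
  have E: "E n \<in> cylinders" for n
    unfolding E_eq by (intro cyl)
  \<comment> \<open>Agreement with the shift by \<open>inv g\<close> on the first N coordinates.
    These cylinders decrease to the set of points fixed by \<open>inv g\<close>, which are those
    fixed by g.\<close>
  define F where "F N = {x :: nat \<Rightarrow> bool. \<forall>n<N. x n = x (?\<pi> n)}" for N
  have F_Suc: "F (Suc N) = F N \<inter> E N" for N
    by (auto simp: F_def E_def less_Suc_eq)
  have F_0: "F 0 = UNIV"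
    by (simp add: F_def)
  have F: "F N \<in> cylinders" for N
    by (induction N) (simp_all add: F_0 F_Suc cylinders_UNIV cylinders_Int E)
  have "\<nu> (B \<inter> F N) = \<nu> B" for N
  proof (induction N)
    case 0
    then show ?case by (simp add: F_0)
  next
    case (Suc N)
    let ?D = "B \<inter> F N"
    have D: "?D \<in> cylinders"
      using B F by (rule cylinders_Int)
    \<comment> \<open>The points of \<open>?D\<close> outside E N, split by which of the two
      coordinates is true. Trading that coordinate for the other one by the trace identity leaves an
      impossible event.\<close>
    let ?U = "?D \<inter> - X (?\<pi> N) \<inter> X N" and ?V = "?D \<inter> - X N \<inter> X (?\<pi> N)"
    have "\<nu> ?U = \<nu> (?D \<inter> - X (?\<pi> N) \<inter> X (?\<pi> N))"
      by (rule \<nu>_trace) (intro cyl D)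
    also have "?D \<inter> - X (?\<pi> N) \<inter> X (?\<pi> N) = {}"
      by blast
    finally have U: "\<nu> ?U = 0"
      by (simp add: \<nu>_empty)
    have "\<nu> ?V = \<nu> (?D \<inter> - X N \<inter> X N)"
      by (rule \<nu>_trace[symmetric]) (intro cyl D)
    also have "?D \<inter> - X N \<inter> X N = {}"
      by blast
    finally have V: "\<nu> ?V = 0"
      by (simp add: \<nu>_empty)
    have "?D = (?D \<inter> E N) \<union> (?U \<union> ?V)"
      unfolding E_eq by blast
    then have "\<nu> ?D = \<nu> ((?D \<inter> E N) \<union> (?U \<union> ?V))"
      by simp
    also have "\<dots> = \<nu> (?D \<inter> E N) + \<nu> (?U \<union> ?V)"
      by (rule \<nu>_Un) (intro cyl D E, intro cyl D, auto simp: E_eq)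
    also have "\<nu> (?U \<union> ?V) = \<nu> ?U + \<nu> ?V"
      by (rule \<nu>_Un) (intro cyl D, intro cyl D, auto)
    finally show ?case
      using Suc U V by (simp add: F_Suc Int_assoc)
  qed
  \<comment> \<open>\<nu> is defined through cylinders and only finitely additive, so it is not
    evaluated at the fixed point set itself. Its domination by the measure replaces countable
    additivity.\<close>
  have bound: "(cmod (\<nu> B))\<^sup>2 \<le> measure law (F N)" for N
  proof -
    have "(cmod (\<nu> B))\<^sup>2 = (cmod (\<nu> (B \<inter> F N)))\<^sup>2"
      by (simp add: \<open>\<And>N. \<nu> (B \<inter> F N) = \<nu> B\<close>)
    also have "\<dots> \<le> (norm (proj (B \<inter> F N) unit_vec))\<^sup>2"
      unfolding \<nu>_def entry_def by (intro power_mono cmod_coord_le_norm) simp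
    also have "\<dots> = measure law (B \<inter> F N)"
      using B F by (simp add: measure_law cylinders_Int)
    also have "\<dots> \<le> measure law (F N)"
      by (rule finite_measure_mono) (auto intro: cylinders_sets_law F)
    finally show ?thesis .
  qed
  have "(\<Inter>N. F N) = {x. shift g x = x}"
  proof -
    have "(\<Inter>N. F N) = {x. \<forall>n. x n = x (?\<pi> n)}"
      by (auto simp: F_def)
    also have "\<dots> = {x. shift (inv g) x = x}"
      by (auto simp: shift_def fun_eq_iff)
    also have "\<dots> = {x. shift g x = x}"
      using act_inv[OF g] by (auto) (metis, metis)
    finally show ?thesis .
  qed
  moreover have "(\<lambda>N. measure law (F N)) \<longlonglongrightarrow> measure law (\<Inter>N. F N)"
  proof (rule finite_Lim_measure_decseq)
    show "decseq F"
      by (auto simp: decseq_def F_def)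
  qed (auto intro: cylinders_sets_law F)
  ultimately have "(\<lambda>N. measure law (F N)) \<longlonglongrightarrow> 0"
    using null by (simp add: measure_def null_sets_def)
  then have "(cmod (\<nu> B))\<^sup>2 \<le> 0"
    by (rule LIMSEQ_le_const) (use bound in auto)
  then show ?thesis
    by (simp add: \<nu>_def)
qed

lemma projection_trivial: "(\<forall>v. p v = 0) \<or> (\<forall>v. p v = v)"
proof -
  have "p unit_vec = scaleC (entry (p unit_vec) \<one>) unit_vec"
  proof (cases "{g \<in> carrier G. AE x in law. shift g x = x} = carrier G")
    case True
    then show ?thesis
      by (intro proj_unit_vec_scalar_trivial) blast
  next
    case False
    then have "{g \<in> carrier G. AE x in law. shift g x = x} = {\<one>}"
      using simple[OF AE_fixed_subgroup] by simp
    then have faithful: "\<not> (AE x in law. shift g x = x)" if "g \<in> carrier G" "g \<noteq> \<one>" for g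
      using that by blast
    have zero: "entry (p unit_vec) g = 0" if g: "g \<in> carrier G" "g \<noteq> \<one>" for g
    proof -
      have "{x. shift g x = x} \<in> null_sets law"
        using free shift_ergodic faithful g by (rule essentially_free)
      then show ?thesis
        using entry_proj_free[OF g(1) _ coordinate_cylinder[of "index \<one>"]] by (simp add: proj_index_one)
    qed
    show ?thesis
      by (rule entry_eqI) (auto simp: entry_scaleC unit_vec_eq entry_point_vec zero[unfolded unit_vec_eq])
  qed
  then show ?thesis
    by (rule scalar_projection_trivial[OF p_Z selfadjoint_p idem_p])
qed

end

section \<open>From projections to self-adjoint elements\<close>

context invariant_center
begin

lemma selfadjoint_scalar:
  assumes T: "T \<in> Z" "selfadjoint T"
  shows "\<exists>c. \<forall>v. T v = c *\<^sub>R v"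
proof -
  \<comment> \<open>The trace of T, the only possible scalar. After subtracting it, a trace-zero
    element has to be shown to vanish.\<close>
  define c where "c = inner (T unit_vec) unit_vec"
  define S where "S v = T v - c *\<^sub>R v" for v
  have S: "S \<in> Z"
    unfolding S_def by (intro Z_diff T Z_scaleR Z_id)
  then obtain K where K: "\<And>v. norm (S v) \<le> K * norm v"
    using Z_bounded by blast
  \<comment> \<open>The maximum with 1 guards the division by L in case K is 0.\<close>
  define L where "L = max K 1"
  have "L > 0" by (simp add: L_def)
  have L: "norm (S v) \<le> L * norm v" for v
    using K[of v] mult_right_mono[of K L "norm v"] by (simp add: L_def)
  define R where "R v = (1 / L) *\<^sub>R S v" for v
  have R: "R \<in> Z"
    unfolding R_def by (intro Z_scaleR S)
  interpret R: selfadjoint_contraction R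
  proof (rule selfadjoint_contraction.intro)
    show "linear R" by (rule Z_linear[OF R])
    show "inner (R v) w = inner v (R w)" for v w
      using T(2) by (simp add: R_def S_def selfadjoint_def inner_diff_left inner_diff_right)
    show "norm (R v) \<le> norm v" for v
      using L[of v] \<open>L > 0\<close> by (simp add: R_def field_simps)
  qed
  have "op_poly R q \<in> Z" for q
  proof (induction q)
    case 0
    have "op_poly R 0 = (\<lambda>v. 0)" by (rule ext) simp
    then show ?case by (simp add: Z_zero)
  next
    case (pCons a q)
    have "op_poly R (pCons a q) = (\<lambda>v. a *\<^sub>R v + R (op_poly R q v))"
      by (rule ext) (rule R.ev_pCons)
    then show ?case
      using pCons by (simp add: Z_add Z_scaleR Z_id Z_comp R)
  qed
  then have s: "R.sign_op \<in> Z"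
    by (rule Z_lim[of "\<lambda>n. op_poly R (sign_poly n)"]) (rule R.norm_sign_poly_le R.sign_op_lim)+
  let ?s = R.sign_op
  note lin_s = R.linear_sign_op
  have s_cube: "?s (?s (?s v)) = ?s v" for v
    by (rule R.sign_op_cube)
  \<comment> \<open>The spectral projections of R for the positive and negative half-line;
    \<epsilon> = 1 and \<epsilon> = -1 are handled together.\<close>
  have half: "(\<forall>v. q v = 0) \<or> (\<forall>v. q v = v)"
    if q: "q = (\<lambda>v. (1/2) *\<^sub>R (?s (?s v) + \<epsilon> *\<^sub>R ?s v))" and \<epsilon>: "\<epsilon> * \<epsilon> = 1" for q \<epsilon>
  proof (rule invariant_projection.projection_trivial)
    show "invariant_projection G enum Z q"
    proof
      show "q \<in> Z"
        unfolding q by (rule Z_scaleR[OF Z_add[OF Z_comp[OF s s] Z_scaleR[OF s]]])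
      show "selfadjoint q"
        by (simp add: q selfadjoint_def inner_add_left inner_add_right R.selfadjoint_sign_op)
      fix v
      have "q (q v) = (1/4) *\<^sub>R (?s (?s v) + \<epsilon> *\<^sub>R ?s v + \<epsilon> *\<^sub>R ?s v + (\<epsilon> * \<epsilon>) *\<^sub>R ?s (?s v))"
        by (simp add: q linear_add[OF lin_s] linear_cmul[OF lin_s] s_cube algebra_simps)
      also have "\<dots> = (1/4) *\<^sub>R (2 *\<^sub>R (?s (?s v) + \<epsilon> *\<^sub>R ?s v))"
        by (simp add: \<epsilon> scaleR_2 algebra_simps) (simp flip: scaleR_add_left)
      also have "\<dots> = q v"
        by (simp add: q)
      finally show "q (q v) = q v" .
    qed
  qed
  have plus: "(\<forall>v. ?s (?s v) + ?s v = 0) \<or> (\<forall>v. (1/2) *\<^sub>R (?s (?s v) + ?s v) = v)"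
    using half[OF refl, of 1] by simp
  have minus: "(\<forall>v. ?s (?s v) - ?s v = 0) \<or> (\<forall>v. (1/2) *\<^sub>R (?s (?s v) - ?s v) = v)"
    using half[OF refl, of "- 1"] by simp
  have tr: "inner (R unit_vec) unit_vec = 0"
    by (simp add: R_def S_def c_def inner_diff_left)
     (simp add: power2_norm_eq_inner[symmetric])
  have ge: "(norm (R unit_vec))\<^sup>2 \<le> inner (?s unit_vec) (R unit_vec)"
    by (rule R.inner_sign_op_ge)
  have "\<exists>t. ?s unit_vec = t *\<^sub>R unit_vec"
  proof -
    \<comment> \<open>If both projections vanish, then s = 0. If one is the identity, s^2 +
      \<epsilon> s = 2 with \<epsilon> = 1 or -1; applying s and using s^3 = s gives s^2 =
      \<epsilon> s, hence s = \<epsilon>.\<close>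
    consider "\<forall>v. ?s (?s v) + ?s v = 0" "\<forall>v. ?s (?s v) - ?s v = 0"
      | "\<forall>v. (1/2) *\<^sub>R (?s (?s v) + ?s v) = v" | "\<forall>v. (1/2) *\<^sub>R (?s (?s v) - ?s v) = v"
      using plus minus by blast
    then show ?thesis
    proof cases
      case 1
      then have "?s unit_vec + ?s unit_vec = 0"
        by (metis add_diff_cancel_left' diff_add_cancel eq_iff_diff_eq_0)
      then have "?s unit_vec = 0 *\<^sub>R unit_vec"
        by (metis scaleR_2 scaleR_eq_0_iff scaleR_zero_left zero_neq_numeral)
      then show ?thesis by blast
    next
      case 2
      then have "?s (?s v) + ?s v = 2 *\<^sub>R v" for v
        by (metis scaleR_half_double scaleR_2 scaleR_right_distrib)
      from this[of "?s unit_vec"] this[of unit_vec]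
      have "?s unit_vec + ?s (?s unit_vec) = 2 *\<^sub>R ?s unit_vec" "?s (?s unit_vec) + ?s unit_vec = 2 *\<^sub>R unit_vec"
        by (simp_all add: s_cube)
      then have "2 *\<^sub>R ?s unit_vec = 2 *\<^sub>R unit_vec"
        by (simp add: add.commute)
      then have "?s unit_vec = 1 *\<^sub>R unit_vec"
        by simp
      then show ?thesis by blast
    next
      case 3
      then have "?s (?s v) - ?s v = 2 *\<^sub>R v" for v
        by (metis scaleR_half_double scaleR_2 scaleR_right_distrib)
      from this[of "?s unit_vec"] this[of unit_vec]
      have "?s unit_vec - ?s (?s unit_vec) = 2 *\<^sub>R ?s unit_vec" "?s (?s unit_vec) - ?s unit_vec = 2 *\<^sub>R unit_vec"
        by (simp_all add: s_cube)
      then have "2 *\<^sub>R ?s unit_vec = 2 *\<^sub>R (- unit_vec)"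
        by (metis minus_diff_eq scaleR_minus_right)
      then have "?s unit_vec = - unit_vec"
        by (simp only: scaleR_cancel_left) simp
      then have "?s unit_vec = (- 1) *\<^sub>R unit_vec"
        by simp
      then show ?thesis by blast
    qed
  qed
  then have "(norm (R unit_vec))\<^sup>2 \<le> 0"
    using ge tr by (auto simp: inner_commute)
  then have "R unit_vec = 0"
    by simp
  moreover have "selfadjoint R"
    unfolding selfadjoint_def by (intro allI) (rule R.selfadjoint)
  ultimately have "R v = 0" for v
    by (rule convolver_eq_zero[OF Z_convolver[OF R], rotated])
  then have "S v = 0" for v
    using \<open>L > 0\<close> by (simp add: R_def)
  then show ?thesis
    by (intro exI[of _ c]) (simp add: S_def)
qed

end

section \<open>Adjoints\<close>

lemma has_sum_ComplexI:
  assumes "(f has_sum a) A" "(g has_sum b) A"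
  shows "((\<lambda>x. Complex (f x) (g x)) has_sum Complex a b) A"
  using has_sum_add[OF has_sum_of_real[OF assms(1), where 'a = complex]
      has_sum_cmult_right[OF has_sum_of_real[OF assms(2), where 'a = complex], of \<i>]]
  by (simp add: Complex_eq)

text \<open>The hermitian product is regained from two real ones, since Re (a * cnj (\<i> * b)) is
  the imaginary part of a * cnj b.\<close>

lemma infsum_coord_mult_cnj:
  "(\<Sum>\<^sub>\<infinity>x. coord v x * cnj (coord w x)) = Complex (inner v w) (inner v (scaleC \<i> w))"
proof -
  have "((\<lambda>x. Re (coord v x * cnj (coord w x))) has_sum inner v w) UNIV" for w
    unfolding inner_l2_def by (rule has_sum_infsum) (rule Re_mult_cnj_summable)
  note has_sum_ComplexI[OF this[of w] this[of "scaleC \<i> w"]]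
  moreover have "Complex (Re (a * cnj b)) (Re (a * cnj (\<i> * b))) = a * cnj b" for a b
    by (simp add: complex_eq_iff)
  ultimately show ?thesis
    by (intro infsumI) (simp only: coord_scaleC)
qed

definition truncate :: "nat \<Rightarrow> nat l2 \<Rightarrow> nat l2"
  where "truncate N v = (\<Sum>n<N. scaleC (coord v n) (delta n))"

lemma coord_sum: "coord (\<Sum>i\<in>I. f i) x = (\<Sum>i\<in>I. coord (f i) x)"
  by (induction I rule: infinite_finite_induct) simp_all

lemma coord_truncate: "coord (truncate N v) n = (if n < N then coord v n else 0)"
  by (simp add: truncate_def coord_sum if_distrib[of "\<lambda>x. _ * x"] sum.delta cong: if_cong)

lemma inner_truncate:
  assumes "\<And>n. n < N \<Longrightarrow> coord w n = coord v n"
  shows "inner w (truncate N v) = (\<Sum>n<N. (cmod (coord v n))\<^sup>2)"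
  unfolding truncate_def inner_sum_right inner_scaleC_delta
  by (rule sum.cong) (use assms Re_mult_cnj_self in \<open>auto simp: mult.commute simp del: times_complex.sel\<close>)

lemma truncate_tendsto: "(\<lambda>N. truncate N v) \<longlonglongrightarrow> v"
proof -
  let ?s = "\<lambda>N. \<Sum>n<N. (cmod (coord v n))\<^sup>2"
  have "(norm (truncate N v - v))\<^sup>2 = (norm v)\<^sup>2 - ?s N" for N
    using inner_truncate[of N v v] inner_truncate[of N "truncate N v" v]
    by (simp add: coord_truncate power2_norm_eq_inner inner_diff_left inner_diff_right inner_commute)
  moreover have "?s \<longlonglongrightarrow> (norm v)\<^sup>2"
    using has_sum_imp_sums[OF has_sum_infsum[OF coord_summable[of v]]]
    by (simp add: sums_def norm_square_l2)
  ultimately have "(\<lambda>N. (norm (truncate N v - v))\<^sup>2) \<longlonglongrightarrow> 0"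
    using tendsto_diff[OF tendsto_const[of "(norm v)\<^sup>2"], of ?s "(norm v)\<^sup>2" sequentially] by simp
  then have "(\<lambda>N. norm (truncate N v - v)) \<longlonglongrightarrow> 0"
    using tendsto_real_sqrt by fastforce
  then show ?thesis
    by (simp add: LIM_zero_cancel tendsto_norm_zero_iff)
qed

definition bounded_operator :: "('a l2 \<Rightarrow> 'a l2) \<Rightarrow> bool"
  where "bounded_operator T \<longleftrightarrow> bounded_linear T \<and> (\<forall>c v. T (scaleC c v) = scaleC c (T v))"

lemma bounded_operatorI:
  assumes "linear T" "\<And>c v. T (scaleC c v) = scaleC c (T v)" "\<And>v. norm (T v) \<le> K * norm v"
  shows "bounded_operator T"
  using assms unfolding bounded_operator_def
  by (auto intro!: bounded_linear_intro[where K = K] simp: linear_add linear_cmul mult.commute)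

lemma bounded_operator_scaleC: "bounded_operator T \<Longrightarrow> T (scaleC c v) = scaleC c (T v)"
  and bounded_operator_bounded_linear: "bounded_operator T \<Longrightarrow> bounded_linear T"
  by (auto simp: bounded_operator_def)

lemma bounded_operator_linear: "bounded_operator T \<Longrightarrow> linear T"
  by (simp add: bounded_operator_bounded_linear bounded_linear.linear)

text \<open>\<open>op_adj\<close> is a definite description, so an adjoint has to be exhibited
  before it can be computed. U w is assembled from its coordinates, the pairings of w with T at the
  basis vectors, and shown to be square-summable by duality.\<close>

lemma ex_adjoint:
  fixes T :: "nat l2 \<Rightarrow> nat l2"
  assumes T: "bounded_operator T"
  shows "\<exists>U. bounded_operator U \<and> (\<forall>v w. inner (T v) w = inner v (U w))"
proof -
  note lin = bounded_operator_linear[OF T]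
  obtain K where K: "K \<ge> 0" "\<And>v. norm (T v) \<le> K * norm v"
    using bounded_linear.nonneg_bounded[OF bounded_operator_bounded_linear[OF T]]
    by (auto simp: mult.commute)
  define u where "u w n = Complex (inner w (T (delta n))) (inner w (T (scaleC \<i> (delta n))))" for w n
  have scaleC_Re_Im: "scaleC c v = Re c *\<^sub>R v + Im c *\<^sub>R scaleC \<i> v" for c and v :: "nat l2"
    by (intro l2_eqI) (simp add: complex_eq_iff)
  have u: "inner w (T (scaleC c (delta n))) = Re (cnj (u w n) * c)" for w c n
    by (subst scaleC_Re_Im) (simp add: linear_add[OF lin] linear_cmul[OF lin] inner_add_right u_def)
  have bound: "(\<Sum>n\<in>F. (cmod (u w n))\<^sup>2) \<le> (K * norm w)\<^sup>2" if F: "finite F" for F w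
  proof -
    define s where "s = (\<Sum>n\<in>F. (cmod (u w n))\<^sup>2)"
    \<comment> \<open>The extremal test vector: pairing w with T x gives the sum s, which is also
      the squared norm of x, so one factor \<open>norm x\<close> cancels in the Cauchy-Schwarz
      estimate.\<close>
    define x where "x = (\<Sum>n\<in>F. scaleC (u w n) (delta n))"
    have coord_x: "coord x n = u w n" if "n \<in> F" for n
      using F that by (simp add: x_def coord_sum if_distrib[of "\<lambda>y. _ * y"] sum.delta cong: if_cong)
    have "inner w (T x) = (\<Sum>n\<in>F. Re (cnj (u w n) * u w n))"
      unfolding x_def linear_sum[OF lin] inner_sum_right u ..
    then have s1: "inner w (T x) = s"
      unfolding s_def by (simp add: mult.commute[of "cnj _"] Re_mult_cnj_self del: times_complex.sel)
    have "inner x x = (\<Sum>n\<in>F. Re (cnj (u w n) * coord x n))"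
      by (subst (2) x_def) (simp only: inner_sum_right inner_scaleC_delta)
    also have "\<dots> = s"
      unfolding s_def by (rule sum.cong[OF refl]) (simp only: coord_x mult.commute[of "cnj _"] Re_mult_cnj_self)
    finally have s2: "(norm x)\<^sup>2 = s"
      by (simp add: power2_norm_eq_inner)
    have "(norm x)\<^sup>2 \<le> norm w * (K * norm x)"
      using s1 s2 Cauchy_Schwarz_ineq2[of w "T x"] mult_left_mono[OF K(2)[of x] norm_ge_zero[of w]] by linarith
    then have "norm x * norm x \<le> (K * norm w) * norm x"
      by (simp add: power2_eq_square mult_ac)
    then have "norm x \<le> K * norm w"
      using K(1) by (cases "norm x = 0") (auto simp: mult_le_cancel_right)
    then have "(norm x)\<^sup>2 \<le> (K * norm w)\<^sup>2"
      by (intro power_mono) auto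
    then show ?thesis
      using s2 by (simp add: s_def)
  qed
  define U where "U w = Abs_l2 (u w)" for w
  have coord_U: "coord (U w) = u w" for w
    unfolding U_def by (rule coord_Abs_l2[OF ell2_bounded_sumsI(1)[OF bound]])
  have norm_U: "norm (U w) \<le> K * norm w" for w
    using ell2_bounded_sumsI(2)[OF bound, of w] K(1) unfolding U_def by simp
  have adj: "inner (T v) w = inner v (U w)" for v w
  proof -
    have "inner w (T (truncate N v)) = inner (truncate N v) (U w)" for N
    proof -
      have "inner w (T (truncate N v)) = (\<Sum>n<N. Re (cnj (u w n) * coord v n))"
        unfolding truncate_def linear_sum[OF lin] inner_sum_right u ..
      also have "\<dots> = (\<Sum>n<N. Re (cnj (coord v n) * u w n))"
        by (simp add: algebra_simps)
      also have "\<dots> = inner (U w) (truncate N v)"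
        unfolding truncate_def inner_sum_right inner_scaleC_delta coord_U ..
      finally show ?thesis
        by (simp add: inner_commute)
    qed
    moreover have "(\<lambda>N. inner w (T (truncate N v))) \<longlonglongrightarrow> inner w (T v)"
      by (intro tendsto_intros bounded_linear.tendsto[OF bounded_operator_bounded_linear[OF T]] truncate_tendsto)
    moreover have "(\<lambda>N. inner (truncate N v) (U w)) \<longlonglongrightarrow> inner v (U w)"
      by (intro tendsto_intros truncate_tendsto)
    ultimately have "inner w (T v) = inner v (U w)"
      using LIMSEQ_unique by simp
    then show ?thesis
      by (simp add: inner_commute)
  qed
  have eqI: "a = b" if "\<And>v. inner v a = inner v b" for a b :: "nat l2"
    using that vector_eq_ldot by blast
  have "linear U"
    by (intro linearI eqI) (simp_all add: adj[symmetric] inner_add_right)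
  moreover have "U (scaleC c w) = scaleC c (U w)" for c w
  proof (rule eqI)
    fix v
    have "inner v (U (scaleC c w)) = inner (T (scaleC (cnj c) v)) w"
      by (simp add: adj[symmetric] bounded_operator_scaleC[OF T] inner_scaleC_left)
    then show "inner v (U (scaleC c w)) = inner v (scaleC c (U w))"
      by (simp add: adj inner_scaleC_left)
  qed
  ultimately have "bounded_operator U"
    using norm_U by (rule bounded_operatorI)
  then show ?thesis
    using adj by blast
qed

section \<open>Operators on \<open>\<ell>\<^sup>2\<close> of the group\<close>

context enumerated_group
begin

definition to_l2 :: "('g \<Rightarrow> complex) \<Rightarrow> nat l2"
  where "to_l2 f = Abs_l2 (\<lambda>n. f (enum n))"

definition of_l2 :: "nat l2 \<Rightarrow> 'g \<Rightarrow> complex"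
  where "of_l2 v = (\<lambda>x. if x \<in> carrier G then entry v x else 0)"

text \<open>The restriction makes \<open>op_of\<close> and \<open>to_op\<close> mutually inverse on
  bounded operators, so identities of extensional operators can be proved as identities of functions
  on \<open>nat l2\<close>.\<close>

definition op_of :: "(nat l2 \<Rightarrow> nat l2) \<Rightarrow> 'g op"
  where "op_of T = (\<lambda>f\<in>ell2 (carrier G). of_l2 (T (to_l2 f)))"

definition to_op :: "'g op \<Rightarrow> nat l2 \<Rightarrow> nat l2"
  where "to_op T v = to_l2 (T (of_l2 v))"

abbreviation "S \<equiv> carrier G"

lemma coord_to_l2: "f \<in> ell2 S \<Longrightarrow> coord (to_l2 f) n = f (enum n)"
  using summable_on_reindex_bij_betw[OF bij_enum, of "\<lambda>x. (cmod (f x))\<^sup>2"]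
  by (simp add: to_l2_def coord_Abs_l2 ell2_UNIV_iff ell2_def)

lemma entry_to_l2: "f \<in> ell2 S \<Longrightarrow> x \<in> S \<Longrightarrow> entry (to_l2 f) x = f x"
  by (simp add: entry_def coord_to_l2)

lemma of_l2_enum: "of_l2 v (enum n) = coord v n"
  by (simp add: of_l2_def entry_def)

lemma of_l2_ell2: "of_l2 v \<in> ell2 S"
  using summable_on_reindex_bij_betw[OF bij_enum, of "\<lambda>x. (cmod (of_l2 v x))\<^sup>2"] coord_summable[of v]
  by (simp add: ell2_def of_l2_enum) (simp add: of_l2_def)

lemma to_l2_of_l2 [simp]: "to_l2 (of_l2 v) = v"
  by (intro l2_eqI) (simp add: coord_to_l2 of_l2_ell2 of_l2_enum)

lemma of_l2_to_l2 [simp]: "f \<in> ell2 S \<Longrightarrow> of_l2 (to_l2 f) = f"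
  by (auto simp: of_l2_def entry_to_l2 fun_eq_iff ell2_def)

lemma of_l2_add: "of_l2 (v + w) = (\<lambda>x. of_l2 v x + of_l2 w x)"
  by (auto simp: of_l2_def entry_add)

lemma of_l2_scaleC: "of_l2 (scaleC c v) = (\<lambda>x. c * of_l2 v x)"
  by (auto simp: of_l2_def entry_scaleC)

lemma to_l2_add:
  assumes "f \<in> ell2 S" "g \<in> ell2 S"
  shows "to_l2 (\<lambda>x. f x + g x) = to_l2 f + to_l2 g"
  using assms to_l2_of_l2[of "to_l2 f + to_l2 g"] by (simp add: of_l2_add)

lemma to_l2_scale:
  assumes "f \<in> ell2 S"
  shows "to_l2 (\<lambda>x. c * f x) = scaleC c (to_l2 f)"
  using assms to_l2_of_l2[of "scaleC c (to_l2 f)"] by (simp add: of_l2_scaleC)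

lemma ell2_inner_eq:
  assumes "f \<in> ell2 S" "g \<in> ell2 S"
  shows "ell2_inner S f g = Complex (inner (to_l2 f) (to_l2 g)) (inner (to_l2 f) (scaleC \<i> (to_l2 g)))"
  unfolding ell2_inner_def infsum_coord_mult_cnj[symmetric]
  using infsum_reindex_bij_betw[OF bij_enum, of "\<lambda>x. f x * cnj (g x)"] assms by (simp add: coord_to_l2)

lemma ell2_norm_eq:
  assumes "f \<in> ell2 S"
  shows "ell2_norm S f = norm (to_l2 f)"
proof -
  have "(ell2_norm S f)\<^sup>2 = (norm (to_l2 f))\<^sup>2"
    unfolding ell2_norm_def norm_square_l2
    using infsum_reindex_bij_betw[OF bij_enum, of "\<lambda>x. (cmod (f x))\<^sup>2"] assms
    by (simp add: coord_to_l2 infsum_nonneg)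
  then show ?thesis
    by (simp add: ell2_norm_def infsum_nonneg)
qed

lemma op_of_ell2: "f \<in> ell2 S \<Longrightarrow> op_of T f \<in> ell2 S"
  by (simp add: op_of_def of_l2_ell2)

lemma to_l2_op_of: "f \<in> ell2 S \<Longrightarrow> to_l2 (op_of T f) = T (to_l2 f)"
  by (simp add: op_of_def)

lemma to_op_op_of [simp]: "to_op (op_of T) = T"
  by (rule ext) (simp add: to_op_def op_of_def of_l2_ell2)

lemma op_of_to_op: "T \<in> ell2 S \<rightarrow>\<^sub>E ell2 S \<Longrightarrow> op_of (to_op T) = T"
  by (rule ext) (auto simp: op_of_def to_op_def PiE_iff extensional_def)

lemma op_of_inject: "op_of T = op_of U \<longleftrightarrow> T = U"
  by (metis to_op_op_of)

lemma bounded_ops_PiE: "T \<in> bounded_ops S \<Longrightarrow> T \<in> ell2 S \<rightarrow>\<^sub>E ell2 S"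
  by (simp add: bounded_ops_def)

lemma op_of_to_op_bounded: "T \<in> bounded_ops S \<Longrightarrow> op_of (to_op T) = T"
  by (rule op_of_to_op[OF bounded_ops_PiE])

lemma bounded_operator_to_op:
  assumes T: "T \<in> bounded_ops S"
  shows "bounded_operator (to_op T)"
proof -
  have Tf: "T f \<in> ell2 S" if "f \<in> ell2 S" for f
    using bounded_ops_PiE[OF T] that by auto
  obtain K where K: "\<And>f. f \<in> ell2 S \<Longrightarrow> ell2_norm S (T f) \<le> K * ell2_norm S f"
    using T unfolding bounded_ops_def by blast
  have add: "\<And>f g. f \<in> ell2 S \<Longrightarrow> g \<in> ell2 S \<Longrightarrow> T (\<lambda>x. f x + g x) = (\<lambda>x. T f x + T g x)"
    and scale: "\<And>f c. f \<in> ell2 S \<Longrightarrow> T (\<lambda>x. c * f x) = (\<lambda>x. c * T f x)"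
    using T unfolding bounded_ops_def by blast+
  have scaleC: "to_op T (scaleC c v) = scaleC c (to_op T v)" for c v
    by (simp add: to_op_def of_l2_scaleC scale of_l2_ell2 to_l2_scale Tf)
  show ?thesis
  proof (rule bounded_operatorI)
    show "linear (to_op T)"
    proof (rule linearI)
      show "to_op T (v + w) = to_op T v + to_op T w" for v w
        by (simp add: to_op_def of_l2_add add of_l2_ell2 to_l2_add Tf)
      show "to_op T (r *\<^sub>R v) = r *\<^sub>R to_op T v" for r v
        using scaleC[of "of_real r" v] by (simp add: scaleC_of_real)
    qed
    show "norm (to_op T v) \<le> K * norm v" for v
      using K[OF of_l2_ell2[of v]] by (simp add: to_op_def ell2_norm_eq of_l2_ell2 Tf)
  qed (rule scaleC)
qed

lemma op_of_bounded_ops: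
  assumes T: "bounded_operator T"
  shows "op_of T \<in> bounded_ops S"
  unfolding bounded_ops_def mem_Collect_eq
proof (intro conjI ballI allI)
  have closed: "(\<lambda>x. f x + g x) \<in> ell2 S" "(\<lambda>x. c * f x) \<in> ell2 S" if "f \<in> ell2 S" "g \<in> ell2 S" for f g c
    using of_l2_ell2[of "to_l2 f + to_l2 g"] of_l2_ell2[of "scaleC c (to_l2 f)"] that
    by (simp_all add: of_l2_add of_l2_scaleC)
  show "op_of T \<in> ell2 S \<rightarrow>\<^sub>E ell2 S"
    by (auto simp: op_of_def of_l2_ell2)
  show "op_of T (\<lambda>x. f x + g x) = (\<lambda>x. op_of T f x + op_of T g x)" if "f \<in> ell2 S" "g \<in> ell2 S" for f g
    using that closed[OF that] by (simp add: op_of_def to_l2_add linear_add[OF bounded_operator_linear[OF T]] of_l2_add)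
  show "op_of T (\<lambda>x. c * f x) = (\<lambda>x. c * op_of T f x)" if "f \<in> ell2 S" for c f
    using that closed[OF that that] by (simp add: op_of_def to_l2_scale bounded_operator_scaleC[OF T] of_l2_scaleC)
  obtain K where K: "\<And>v. norm (T v) \<le> norm v * K"
    using bounded_linear.bounded[OF bounded_operator_bounded_linear[OF T]] by blast
  show "\<exists>K. \<forall>f\<in>ell2 S. ell2_norm S (op_of T f) \<le> K * ell2_norm S f"
    using K by (intro exI[of _ K] ballI) (simp add: ell2_norm_eq op_of_ell2 to_l2_op_of mult.commute)
qed

lemma op_of_id: "op_of (\<lambda>v. v) = op_id S"
  by (auto simp: op_of_def op_id_def fun_eq_iff)

lemma op_of_add: "op_of (\<lambda>v. T v + U v) = op_add S (op_of T) (op_of U)"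
  by (auto simp: op_of_def op_add_def fun_eq_iff of_l2_add)

lemma op_of_scaleC: "op_of (\<lambda>v. scaleC c (T v)) = op_scale S c (op_of T)"
  by (auto simp: op_of_def op_scale_def fun_eq_iff of_l2_scaleC)

lemma op_of_comp: "op_of (\<lambda>v. T (U v)) = op_comp S (op_of T) (op_of U)"
  by (auto simp: op_of_def op_comp_def compose_def fun_eq_iff of_l2_ell2)

lemma op_of_left_op: "g \<in> S \<Longrightarrow> op_of (left_op g) = left_reg G g"
  by (auto simp: op_of_def left_reg_def fun_eq_iff of_l2_def entry_left_op entry_to_l2)

text \<open>An adjoint relation for the real product is enough: complex linearity of U extends it to
  the hermitian product, and the real product already separates vectors, which gives
  uniqueness.\<close>

lemma op_adj_eq:
  assumes T: "bounded_operator T" and U: "bounded_operator U" and adj: "\<And>v w. inner (T v) w = inner v (U w)"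
  shows "op_adj S (op_of T) = op_of U"
  unfolding op_adj_def
proof (rule the_equality)
  have "ell2_inner S (op_of T f) g = ell2_inner S f (op_of U g)" if "f \<in> ell2 S" "g \<in> ell2 S" for f g
    using that by (simp add: ell2_inner_eq op_of_ell2 to_l2_op_of adj bounded_operator_scaleC[OF U])
  then show "op_of U \<in> bounded_ops S \<and>
      (\<forall>f\<in>ell2 S. \<forall>g\<in>ell2 S. ell2_inner S (op_of T f) g = ell2_inner S f (op_of U g))"
    using op_of_bounded_ops[OF U] by blast
  fix V assume V: "V \<in> bounded_ops S \<and>
      (\<forall>f\<in>ell2 S. \<forall>g\<in>ell2 S. ell2_inner S (op_of T f) g = ell2_inner S f (V g))"
  then have Vg: "V g \<in> ell2 S" if "g \<in> ell2 S" for g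
    using bounded_ops_PiE that by blast
  have "inner v (to_op V w) = inner v (U w)" for v w
  proof -
    have "ell2_inner S (op_of T (of_l2 v)) (of_l2 w) = ell2_inner S (of_l2 v) (V (of_l2 w))"
      using V of_l2_ell2 by blast
    then show ?thesis
      by (simp add: ell2_inner_eq op_of_ell2 of_l2_ell2 Vg to_l2_op_of adj to_op_def)
  qed
  then have "to_op V = U"
    using vector_eq_ldot by (intro ext) blast
  then show "V = op_of U"
    using op_of_to_op_bounded[of V] V by simp
qed

lemma bounded_operator_left_op: "g \<in> S \<Longrightarrow> bounded_operator (left_op g)"
  by (rule bounded_operatorI[where K = 1])
     (simp_all add: linear_left_op left_op_scaleC norm_eq_sqrt_inner inner_left_op)

lemma op_adj_left_reg: "g \<in> S \<Longrightarrow> op_adj S (left_reg G g) = op_of (left_op (inv g))"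
  unfolding op_of_left_op[symmetric]
  by (rule op_adj_eq) (simp_all add: bounded_operator_left_op inner_left_op_left)

lemma continuous_map_wot_coefficient:
  assumes "f \<in> ell2 S" "g \<in> ell2 S"
  shows "continuous_map (wot S) euclidean (\<lambda>T. ell2_inner S (T f) g)"
proof -
  have "continuous_map (wot S) euclidean
      ((\<lambda>x. x (f, g)) \<circ> (\<lambda>T. restrict (\<lambda>(f, g). ell2_inner S (T f) g) (ell2 S \<times> ell2 S)))"
    unfolding wot_def by (intro continuous_map_pullback continuous_map_product_projection) (use assms in auto)
  then show ?thesis
    using assms by (simp add: o_def)
qed

text \<open>The topology is pulled back from a product, so convergence can be tested on each
  coefficient.\<close>

lemma limitin_wot:
  assumes T: "\<And>n. T n \<in> bounded_ops S" "L \<in> bounded_ops S"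
    and lim: "\<And>f g. f \<in> ell2 S \<Longrightarrow> g \<in> ell2 S \<Longrightarrow> (\<lambda>n. ell2_inner S (T n f) g) \<longlonglongrightarrow> ell2_inner S (L f) g"
  shows "limitin (wot S) T L sequentially"
proof -
  let ?c = "\<lambda>T. restrict (\<lambda>(f, g). ell2_inner S (T f) g) (ell2 S \<times> ell2 S)"
  have "limitin (product_topology (\<lambda>_. euclidean) (ell2 S \<times> ell2 S)) (\<lambda>n. ?c (T n)) (?c L) sequentially"
    unfolding limitin_componentwise using lim by auto
  then show ?thesis
    unfolding wot_def limitin_def openin_pullback_topology topspace_pullback_topology
    using T by auto
qed

lemma to_op_left_reg_span:
  assumes "T \<in> left_reg_span G"
  obtains F c where "finite F" "F \<subseteq> S" "to_op T = (\<lambda>v. \<Sum>g\<in>F. scaleC (c g) (left_op g v))"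
proof -
  obtain F c where F: "finite F" "F \<subseteq> S" "T = (\<lambda>f\<in>ell2 S. \<lambda>x. \<Sum>g\<in>F. c g * left_reg G g f x)"
    using assms by (auto simp: left_reg_span_def)
  have img: "of_l2 (\<Sum>g\<in>F. scaleC (c g) (left_op g v)) = (\<lambda>x. \<Sum>g\<in>F. c g * left_reg G g (of_l2 v) x)" for v
    using F(1,2)
  proof (induction F rule: finite_induct)
    case empty
    then show ?case by (auto simp: of_l2_def entry_def)
  next
    case (insert g F)
    have "left_reg G g (of_l2 v) = of_l2 (left_op g v)"
      using insert.prems by (simp add: op_of_left_op[symmetric] op_of_def of_l2_ell2)
    with insert show ?case
      by (simp add: of_l2_add of_l2_scaleC)
  qed
  have "to_op T v = (\<Sum>g\<in>F. scaleC (c g) (left_op g v))" for v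
  proof -
    have "T (of_l2 v) = of_l2 (\<Sum>g\<in>F. scaleC (c g) (left_op g v))"
      unfolding img F(3) by (simp only: restrict_apply' of_l2_ell2)
    then show ?thesis
      by (simp only: to_op_def to_l2_of_l2)
  qed
  then have "to_op T = (\<lambda>v. \<Sum>g\<in>F. scaleC (c g) (left_op g v))"
    by (rule ext)
  then show ?thesis
    by (rule that[OF F(1,2)])
qed

text \<open>Commuting with a right translation is a weakly closed condition, and left translations
  satisfy it by associativity. This places L(Gamma) in the commutant of the right regular
  representation.\<close>

lemma group_vN_commute_right_op:
  assumes T: "T \<in> group_vN G" and h: "h \<in> S"
  shows "to_op T (right_op h v) = right_op h (to_op T v)"
proof -
  have bounded: "T \<in> bounded_ops S"
    using T closure_of_subset_topspace[of "wot S"] by (auto simp: group_vN_def topspace_wot)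
  then have Tf: "T f \<in> ell2 S" if "f \<in> ell2 S" for f
    using bounded_ops_PiE that by blast
  have "inner (to_op T (right_op h v)) w = inner (right_op h (to_op T v)) w" for w
  proof -
    let ?f = "\<lambda>T. ell2_inner S (T (of_l2 (right_op h v))) (of_l2 w)"
    \<comment> \<open>With the translation moved to the second argument, this side too is a matrix
      coefficient of T, hence continuous.\<close>
    let ?g = "\<lambda>T. ell2_inner S (T (of_l2 v)) (of_l2 (right_op (inv h) w))"
    \<comment> \<open>Intersecting with the whole space records that the approximating operators are
      bounded.\<close>
    have "T \<in> wot S closure_of (topspace (wot S) \<inter> left_reg_span G)"
      using T unfolding group_vN_def closure_of_restrict[symmetric] .
    then have "?f T = ?g T"
    proof (rule forall_in_closure_of_eq[where Y = euclidean and f = ?f and g = ?g])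
      fix R assume R: "R \<in> topspace (wot S) \<inter> left_reg_span G"
      then obtain F c where F: "finite F" "F \<subseteq> S" "to_op R = (\<lambda>v. \<Sum>g\<in>F. scaleC (c g) (left_op g v))"
        using to_op_left_reg_span by blast
      have Rf: "R f \<in> ell2 S" if "f \<in> ell2 S" for f
        using R bounded_ops_PiE[of R] that by (auto simp: topspace_wot)
      have "to_op R (right_op h v) = right_op h (to_op R v)"
        using F(2) h unfolding F(3)
        by (auto simp: linear_sum[OF linear_right_op] right_op_scaleC left_right_commute subset_iff intro!: sum.cong)
      then have "inner (to_op R (right_op h v)) w' = inner (to_op R v) (right_op (inv h) w')" for w'
        using h by (simp add: inner_right_op_left)
      then show "?f R = ?g R"
        using h by (simp add: ell2_inner_eq Rf of_l2_ell2 to_op_def right_op_scaleC)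
    qed (auto intro: continuous_map_wot_coefficient of_l2_ell2)
    then show ?thesis
      using h by (simp add: ell2_inner_eq Tf of_l2_ell2 to_op_def inner_right_op_left)
  qed
  then show ?thesis
    using vector_eq_rdot by blast
qed

end

section \<open>Conjugation-invariant von Neumann subalgebras\<close>

locale invariant_subalgebra = enumerated_group G enum for G :: "('g, 'b) monoid_scheme" (structure) and enum +
  fixes A :: "'g op set"
  assumes vN: "von_neumann_algebra (carrier G) A"
    and subalgebra: "A \<subseteq> group_vN G"
    and invariant: "conj_invariant G A"
begin

definition center :: "(nat l2 \<Rightarrow> nat l2) set"
  where "center = {T. op_of T \<in> A \<and> (\<forall>U v. op_of U \<in> A \<longrightarrow> T (U v) = U (T v))}"

lemma A_bounded_ops: "T \<in> A \<Longrightarrow> T \<in> bounded_ops S"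
  using vN by (auto simp: von_neumann_algebra_def)

lemma op_of_to_op_A: "T \<in> A \<Longrightarrow> op_of (to_op T) = T"
  by (intro op_of_to_op_bounded A_bounded_ops)

lemma A_bounded_operator: "op_of T \<in> A \<Longrightarrow> bounded_operator T"
  using bounded_operator_to_op[OF A_bounded_ops, of "op_of T"] by simp

lemma A_id: "op_of (\<lambda>v. v) \<in> A"
  and A_add: "op_of T \<in> A \<Longrightarrow> op_of U \<in> A \<Longrightarrow> op_of (\<lambda>v. T v + U v) \<in> A"
  and A_scaleC: "op_of T \<in> A \<Longrightarrow> op_of (\<lambda>v. scaleC c (T v)) \<in> A"
  and A_comp: "op_of T \<in> A \<Longrightarrow> op_of U \<in> A \<Longrightarrow> op_of (\<lambda>v. T (U v)) \<in> A"
  and A_adj: "op_of T \<in> A \<Longrightarrow> op_adj S (op_of T) \<in> A"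
  using vN unfolding op_of_id op_of_add op_of_scaleC op_of_comp von_neumann_algebra_def by auto

lemma A_lim:
  assumes T: "\<And>n. op_of (T n) \<in> A" and L: "bounded_operator L"
    and lim: "\<And>v. (\<lambda>n. T n v) \<longlonglongrightarrow> L v"
  shows "op_of L \<in> A"
proof (rule limitin_closedin)
  show "closedin (wot S) A"
    using vN by (simp add: von_neumann_algebra_def)
  show "limitin (wot S) (\<lambda>n. op_of (T n)) (op_of L) sequentially"
  proof (rule limitin_wot)
    fix f g assume "f \<in> ell2 S" "g \<in> ell2 S"
    then show "(\<lambda>n. ell2_inner S (op_of (T n) f) g) \<longlonglongrightarrow> ell2_inner S (op_of L f) g"
      by (simp add: ell2_inner_eq op_of_ell2 to_l2_op_of) (intro tendsto_intros lim)
  qed (auto intro: A_bounded_ops T op_of_bounded_ops L)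
qed (use T in auto)

lemma A_conj:
  assumes "g \<in> S" "op_of T \<in> A"
  shows "op_of (conj_op g T) \<in> A"
proof -
  have "op_of (conj_op g T) = op_comp S (op_comp S (left_reg G g) (op_of T)) (op_adj S (left_reg G g))"
    unfolding op_adj_left_reg[OF assms(1)]
    unfolding op_of_left_op[OF assms(1), symmetric] op_of_comp[symmetric] op_of_inject
    by (rule ext) (rule conj_op_def)
  also have "\<dots> \<in> (\<lambda>T. op_comp S (op_comp S (left_reg G g) T) (op_adj S (left_reg G g))) ` A"
    using assms(2) by (rule imageI)
  also have "\<dots> = A"
    using invariant assms(1) by (simp add: conj_invariant_def)
  finally show ?thesis .
qed

lemma A_convolver:
  assumes "op_of T \<in> A"
  shows "convolver T"
  using assms bounded_operator_linear[OF A_bounded_operator[OF assms]]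
    bounded_operator_scaleC[OF A_bounded_operator[OF assms]]
    group_vN_commute_right_op[OF subsetD[OF subalgebra assms]]
  by (simp add: convolver_def)

lemma centerI: "op_of T \<in> A \<Longrightarrow> (\<And>U v. op_of U \<in> A \<Longrightarrow> T (U v) = U (T v)) \<Longrightarrow> T \<in> center"
  by (simp add: center_def)

lemma center_A: "T \<in> center \<Longrightarrow> op_of T \<in> A"
  and center_commute: "T \<in> center \<Longrightarrow> op_of U \<in> A \<Longrightarrow> T (U v) = U (T v)"
  by (simp_all add: center_def)

lemma A_linear: "op_of T \<in> A \<Longrightarrow> linear T"
  by (intro bounded_operator_linear A_bounded_operator)

lemma center_add: "T \<in> center \<Longrightarrow> U \<in> center \<Longrightarrow> (\<lambda>v. T v + U v) \<in> center"
  by (rule centerI) (simp_all add: A_add center_A center_commute linear_add[OF A_linear])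

lemma center_scaleC: "T \<in> center \<Longrightarrow> (\<lambda>v. scaleC c (T v)) \<in> center"
  by (rule centerI) (simp_all add: A_scaleC center_A center_commute bounded_operator_scaleC[OF A_bounded_operator])

lemma center_scaleR: "T \<in> center \<Longrightarrow> (\<lambda>v. r *\<^sub>R T v) \<in> center"
  using center_scaleC[of T "of_real r"] by (simp add: scaleC_of_real)

lemma center_conj:
  assumes "g \<in> S" "T \<in> center"
  shows "conj_op g T \<in> center"
proof (rule centerI)
  show "op_of (conj_op g T) \<in> A"
    using assms by (intro A_conj center_A)
  fix U v assume U: "op_of U \<in> A"
  \<comment> \<open>By invariance, U conjugated by \<open>inv g\<close> is again in A, where T
    commutes with it.\<close>
  have "conj_op g T (U v) = left_op g (T (conj_op (inv g) U (left_op (inv g) v)))"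
    using assms(1) by (simp add: conj_op_def)
  also have "\<dots> = left_op g (conj_op (inv g) U (T (left_op (inv g) v)))"
    using assms by (simp add: center_commute A_conj U)
  also have "\<dots> = U (conj_op g T v)"
    using assms(1) by (simp add: conj_op_def)
  finally show "conj_op g T (U v) = U (conj_op g T v)" .
qed

lemma center_lim:
  assumes T: "\<And>n. T n \<in> center" and contr: "\<And>n v. norm (T n v) \<le> norm v"
    and lim: "\<And>v. (\<lambda>n. T n v) \<longlonglongrightarrow> L v"
  shows "L \<in> center"
proof (rule centerI)
  have scaleC_lim: "(\<lambda>n. scaleC c (u n)) \<longlonglongrightarrow> scaleC c a" if "u \<longlonglongrightarrow> a" for c u and a :: "nat l2"
  proof -
    have "bounded_linear (scaleC c :: nat l2 \<Rightarrow> nat l2)"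
      by (rule bounded_linear_intro[where K = "cmod c"])
         (simp_all add: scaleC_add_right norm_scaleC mult.commute flip: scaleC_of_real)
    then show ?thesis
      using that by (rule bounded_linear.tendsto)
  qed
  note Tn = A_bounded_operator[OF center_A[OF T]]
  have "bounded_operator L"
  proof (rule bounded_operatorI[where K = 1])
    show "linear L"
    proof (rule linearI)
      show "L (v + w) = L v + L w" for v w
        using tendsto_add[OF lim[of v] lim[of w]]
        by (intro LIMSEQ_unique[OF lim]) (simp add: linear_add[OF bounded_operator_linear[OF Tn]])
      show "L (r *\<^sub>R v) = r *\<^sub>R L v" for r v
        using tendsto_scaleR[OF tendsto_const[of r] lim[of v]]
        by (intro LIMSEQ_unique[OF lim]) (simp add: linear_cmul[OF bounded_operator_linear[OF Tn]])
    qed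
    show "L (scaleC c v) = scaleC c (L v)" for c v
      using scaleC_lim[OF lim[of v], of c] by (intro LIMSEQ_unique[OF lim]) (simp add: bounded_operator_scaleC[OF Tn])
    show "norm (L v) \<le> 1 * norm v" for v
      using tendsto_norm[OF lim[of v]] by (rule LIMSEQ_le_const2) (use contr in auto)
  qed
  then show "op_of L \<in> A"
    by (rule A_lim[OF center_A[OF T] _ lim])
  fix U v assume U: "op_of U \<in> A"
  have "(\<lambda>n. U (T n v)) \<longlonglongrightarrow> U (L v)"
    by (rule bounded_linear.tendsto[OF bounded_operator_bounded_linear[OF A_bounded_operator[OF U]] lim])
  then show "L (U v) = U (L v)"
    by (intro LIMSEQ_unique[OF lim]) (simp add: center_commute[OF T U])
qed

lemma A_adjoint:
  assumes "op_of T \<in> A"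
  obtains U where "op_of U \<in> A" "\<And>v w. inner (T v) w = inner v (U w)"
proof -
  obtain U where U: "bounded_operator U" "\<And>v w. inner (T v) w = inner v (U w)"
    using ex_adjoint[OF A_bounded_operator[OF assms]] by blast
  then have "op_adj S (op_of T) = op_of U"
    by (intro op_adj_eq[OF A_bounded_operator[OF assms]])
  then have "op_of U \<in> A"
    using A_adj[OF assms] by simp
  then show ?thesis
    using that U(2) by blast
qed

text \<open>A is closed under adjoints: T commutes with the adjoint of each V in A, and taking
  adjoints gives the claim.\<close>

lemma center_adjoint:
  assumes T: "T \<in> center"
  obtains U where "U \<in> center" "\<And>v w. inner (T v) w = inner v (U w)"
proof -
  obtain U where U: "op_of U \<in> A" "\<And>v w. inner (T v) w = inner v (U w)"
    using A_adjoint[OF center_A[OF T]] by blast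
  have "U (V w) = V (U w)" if V: "op_of V \<in> A" for V w
  proof -
    obtain V' where V': "op_of V' \<in> A" "\<And>v w. inner (V v) w = inner v (V' w)"
      using A_adjoint[OF V] by blast
    then have V'': "inner v (V w) = inner (V' v) w" for v w
      by (metis inner_commute)
    have "inner v (U (V w)) = inner v (V (U w))" for v
      by (simp add: U(2)[symmetric] V'' center_commute[OF T V'(1)])
    then show ?thesis
      using vector_eq_ldot by blast
  qed
  then have "U \<in> center"
    by (intro centerI U(1))
  then show ?thesis
    using that U(2) by blast
qed

lemma op_center_eq: "op_center S A = op_of ` center"
proof (intro Set.set_eqI iffI)
  fix T assume "T \<in> op_center S A"
  then have T: "T \<in> A" "\<And>U. U \<in> A \<Longrightarrow> op_comp S T U = op_comp S U T"
    by (auto simp: op_center_def)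
  have "to_op T \<in> center"
  proof (rule centerI)
    fix U v assume "op_of U \<in> A"
    then have "op_of (\<lambda>v. to_op T (U v)) = op_of (\<lambda>v. U (to_op T v))"
      using T by (simp add: op_of_comp op_of_to_op_A)
    then show "to_op T (U v) = U (to_op T v)"
      unfolding op_of_inject by (rule fun_cong)
  qed (simp add: op_of_to_op_A T(1))
  then show "T \<in> op_of ` center"
    using op_of_to_op_A[OF T(1)] by (metis imageI)
next
  fix T assume "T \<in> op_of ` center"
  then obtain t where t: "T = op_of t" "t \<in> center" by blast
  have "op_comp S (op_of t) U = op_comp S U (op_of t)" if "U \<in> A" for U
  proof -
    have "op_comp S (op_of t) (op_of (to_op U)) = op_comp S (op_of (to_op U)) (op_of t)"
      unfolding op_of_comp[symmetric] op_of_inject using that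
      by (intro ext center_commute t(2)) (simp add: op_of_to_op_A)
    then show ?thesis
      by (simp add: op_of_to_op_A that)
  qed
  then show "T \<in> op_center S A"
    using t center_A by (auto simp: op_center_def)
qed

text \<open>Real and imaginary parts: with U the adjoint of T, both (T + U) / 2 and (T - U) / (2
  \<i>) are central and self-adjoint, hence real scalars a and b, and T is the scalar a + \<i>
  b.\<close>

lemma factorI:
  assumes scalar: "\<And>T. T \<in> center \<Longrightarrow> selfadjoint T \<Longrightarrow> \<exists>c. \<forall>v. T v = c *\<^sub>R v"
  shows "factor S A"
  unfolding factor_def
proof (intro conjI vN)
  have scalars: "op_scale S c (op_id S) = op_of (scaleC c)" for c
    using op_of_scaleC[of c "\<lambda>v. v"] by (simp add: op_of_id)
  have "\<exists>c. T = scaleC c" if T: "T \<in> center" for T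
  proof -
    obtain U where U: "U \<in> center" "\<And>v w. inner (T v) w = inner v (U w)"
      using center_adjoint[OF T] by blast
    then have U': "inner (U v) w = inner v (T w)" for v w
      by (metis inner_commute)
    define P where "P v = (1/2) *\<^sub>R (T v + U v)" for v
    define Q where "Q v = scaleC (- \<i> / 2) (T v + scaleC (- 1) (U v))" for v
    have "P \<in> center" "Q \<in> center"
      unfolding P_def Q_def by (intro center_scaleR center_scaleC center_add T U(1))+
    moreover have "selfadjoint P"
      by (simp add: P_def selfadjoint_def inner_add_left inner_add_right U(2) U')
    moreover have "selfadjoint Q"
    proof -
      have "inner (scaleC c (T v)) w = inner (scaleC c v) (U w)" "inner (scaleC c (U v)) w = inner (scaleC c v) (T w)"
        for c v w
        using U(2)[of "scaleC c v" w] U'[of "scaleC c v" w]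
        by (simp_all add: bounded_operator_scaleC[OF A_bounded_operator[OF center_A]] T U(1))
      then show ?thesis
        by (simp add: Q_def selfadjoint_def inner_add_left inner_add_right scaleC_add_right inner_scaleC_right)
    qed
    ultimately obtain a b where ab: "\<And>v. P v = a *\<^sub>R v" "\<And>v. Q v = b *\<^sub>R v"
      using scalar by meson
    have "T v = scaleC (of_real a + \<i> * of_real b) v" for v
    proof -
      have "T v = P v + scaleC \<i> (Q v)"
        by (intro l2_eqI) (simp add: P_def Q_def field_simps)
      then show ?thesis
        by (simp add: ab scaleC_add_left flip: scaleC_of_real)
    qed
    then show ?thesis by blast
  qed
  moreover have "scaleC c \<in> center" for c
  proof (rule centerI)
    show "op_of (scaleC c) \<in> A"
      using A_scaleC[OF A_id, of c] by simp
  qed (simp add: bounded_operator_scaleC[OF A_bounded_operator])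
  ultimately have "center = range scaleC"
    by auto
  then show "op_center S A = {op_scale S c (op_id S) | c. True}"
    unfolding op_center_eq scalars by auto
qed

end

section \<open>The center of an invariant subalgebra as an instance of the abstract setting\<close>

theorem theorem3p2:
  fixes \<Gamma> :: "'g monoid" and A :: "'g op set"
  assumes "group \<Gamma>"
    and "countable (carrier \<Gamma>)"
    and "icc_group \<Gamma>"
    and "abstract_simple_group \<Gamma>"
    and "\<And>(M :: real measure) (\<phi> :: 'g \<Rightarrow> real \<Rightarrow> real).
           standard_prob_space M \<Longrightarrow> pmp_action \<Gamma> M \<phi> \<Longrightarrow> ergodic_action \<Gamma> M \<phi> \<Longrightarrow>
           ae_faithful_action \<Gamma> M \<phi> \<Longrightarrow> essentially_free_action \<Gamma> M \<phi>"
    and "von_neumann_algebra (carrier \<Gamma>) A"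
    and "A \<subseteq> group_vN \<Gamma>"
    and "conj_invariant \<Gamma> A"
  shows "factor (carrier \<Gamma>) A"
proof -
  interpret group \<Gamma> by fact
  have icc: "infinite {g \<otimes>\<^bsub>\<Gamma>\<^esub> h \<otimes>\<^bsub>\<Gamma>\<^esub> inv\<^bsub>\<Gamma>\<^esub> g | g. g \<in> carrier \<Gamma>}"
    if "h \<in> carrier \<Gamma>" "h \<noteq> \<one>\<^bsub>\<Gamma>\<^esub>" for h
    using assms(3) that by (simp add: icc_group_def)
  \<comment> \<open>A simple group is nontrivial, and one infinite conjugacy class makes the carrier
    infinite. Only then does \<open>from_nat_into\<close> enumerate it without repetition.\<close>
  obtain h where h: "h \<in> carrier \<Gamma>" "h \<noteq> \<one>\<^bsub>\<Gamma>\<^esub>"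
    using assms(4) one_closed unfolding abstract_simple_group_def by blast
  have "{g \<otimes>\<^bsub>\<Gamma>\<^esub> h \<otimes>\<^bsub>\<Gamma>\<^esub> inv\<^bsub>\<Gamma>\<^esub> g | g. g \<in> carrier \<Gamma>} \<subseteq> carrier \<Gamma>"
    using h(1) by auto
  then have "infinite (carrier \<Gamma>)"
    using icc[OF h] finite_subset by blast
  then have "bij_betw (from_nat_into (carrier \<Gamma>)) UNIV (carrier \<Gamma>)"
    by (rule bij_betw_from_nat_into[OF assms(2)])
  then interpret invariant_subalgebra \<Gamma> "from_nat_into (carrier \<Gamma>)" A
    by (intro invariant_subalgebra.intro enumerated_group.intro enumerated_group_axioms.intro
        invariant_subalgebra_axioms.intro assms(1,6-8))
  have "invariant_center \<Gamma> (from_nat_into (carrier \<Gamma>)) center"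
  proof (intro invariant_center.intro invariant_center_axioms.intro enumerated_group_axioms)
    show "T \<in> center \<Longrightarrow> convolver T" for T
      by (intro A_convolver center_A)
    show "\<exists>K. \<forall>v. norm (T v) \<le> K * norm v" if "T \<in> center" for T
      using bounded_linear.bounded[OF bounded_operator_bounded_linear[OF A_bounded_operator[OF center_A[OF that]]]]
      by (simp add: mult.commute)
    show "T \<in> center \<Longrightarrow> U \<in> center \<Longrightarrow> T (U v) = U (T v)" for T U v
      by (intro center_commute center_A)
    show "(\<lambda>v. v) \<in> center"
      by (rule centerI) (simp_all add: A_id)
    show "T \<in> center \<Longrightarrow> U \<in> center \<Longrightarrow> (\<lambda>v. T (U v)) \<in> center" for T U
      by (rule centerI) (simp_all add: A_comp center_A center_commute)
    show "N \<lhd> \<Gamma> \<Longrightarrow> N = carrier \<Gamma> \<or> N = {\<one>\<^bsub>\<Gamma>\<^esub>}" for N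
      using assms(4) by (simp add: abstract_simple_group_def)
  qed (fact center_add center_scaleR center_lim center_conj icc assms(5))+
  then interpret invariant_center \<Gamma> "from_nat_into (carrier \<Gamma>)" center .
  show ?thesis
    by (rule factorI) (rule selfadjoint_scalar)
qed

end
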